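(* The picture of a single torus determines finitely many candidates for the elliptic absolute, assuming a generic camera position. Precisely: for every admissible pair of real parameters $(a,b)$ there is a non-empty Zariski open subset $U_{a,b}\subset\mathbb{P}^3$ of centers, disjoint from the infinite plane, such that the following holds. Let $(a,b)$ be admissible and let $\pi:\mathbb{P}^3\setminus\{o\}\to\mathbb{P}^2$ be a real central projection with real center $o\in U_{a,b}$. Let $T'=\pi(T_{a,b})'$ denote the picture of the torus $T_{a,b}$ under $\pi$. Then the set of all conics $D\subset\mathbb{P}^2$ for which there exist an admissible pair $(a_1,b_1)$ and a real central projection $\pi_1$ with real center $o_1\in U_{a_1,b_1}$ such that the picture of $T_{a_1,b_1}$ under $\pi_1$ equals $T'$ and $\pi_1(C_A)=D$ is finite. (This set contains the elliptic absolute $C_E=\pi(C_A)$.)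
   Context: Varieties are defined by real forms, but their complex points are considered. Use coordinates $(x:y:z:w)$ on $\mathbb{P}^3$. The Euclidean absolute is the conic $C_A\subset\mathbb{P}^3$ defined by $w=0$ and $x^2+y^2+z^2=0$; the infinite plane is $w=0$. A real central projection $\pi:\mathbb{P}^3\setminus\{o\}\to\mathbb{P}^2$ is the map given by a rank-three matrix in $\mathbb{R}^{3\times 4}$ whose one-dimensional kernel is the point $o$, called its center. If $o$ is not in the infinite plane, $C_E:=\pi(C_A)$ is an irreducible conic without real points, called the elliptic absolute. A camera is calibrated when $C_E$ is known. A pair $(a,b)$ of real numbers is called admissible if $a>0$, $b>0$ and $b\neq 4a$. The torus $T_{a,b}\subset\mathbb{P}^3$ is the quartic surface $$(x^2+y^2+z^2+aw^2)^2-b(x^2+y^2)w^2=0.$$ Every torus has this form in suitable Euclidean coordinates (coordinates in which $C_A$ has the equations $w=0$ and $x^2+y^2+z^2=0$); since $\pi$ ranges over all real central projections, fixing this normal form loses no torus positions. The picture of an algebraic surface $S\subset\mathbb{P}^3$ under $\pi$ is the Zariski closure in $\mathbb{P}^2$ of the set of critical values of the restriction of $\pi$ to the smooth part of $S$; it is an algebraic curve. *)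

theory Defs
  imports "HOL-Analysis.Analysis"
begin

section \<open>Complex projective space and its Zariski topology\<close>

text \<open>A point is a one-dimensional subspace of the space of coordinate vectors, so
  \<open>4 cproj\<close> is complex projective 3-space and \<open>3 cproj\<close> is the complex projective plane.\<close>

typedef 'n cproj = "{L :: (complex ^ 'n::finite) set. vec.subspace L \<and> vec.dim L = 1}"
  morphisms line Point
proof
  let ?e = "axis undefined 1 :: complex ^ 'n"
  have "?e \<noteq> 0" by (simp add: axis_eq_0_iff)
  then have "vec.dim (vec.span {?e}) = 1"
    by (simp add: vec.dim_eq_card_independent)
  then show "vec.span {?e} \<in> {L. vec.subspace L \<and> vec.dim L = 1}"
    by simp
qed

text \<open>Since the field of complex numbers is infinite, forms are identified with the functions
  they induce. The exponent vectors of total degree \<open>d\<close> form a finite set.\<close>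

definition is_form :: "nat \<Rightarrow> (complex ^ 'n::finite \<Rightarrow> complex) \<Rightarrow> bool" where
  "is_form d f \<longleftrightarrow>
     (\<exists>c. f = (\<lambda>v. \<Sum>m | (\<Sum>i\<in>UNIV. m i) = d. c m * (\<Prod>i\<in>UNIV. v $ i ^ m i)))"

definition zero_locus :: "(complex ^ 'n::finite \<Rightarrow> complex) set \<Rightarrow> 'n cproj set" where
  "zero_locus F = {p. \<forall>f\<in>F. \<forall>v\<in>line p. f v = 0}"

definition zariski_closed :: "'n::finite cproj set \<Rightarrow> bool" where
  "zariski_closed Z \<longleftrightarrow> (\<exists>F. (\<forall>f\<in>F. \<exists>d. is_form d f) \<and> Z = zero_locus F)"

definition zariski_open :: "'n::finite cproj set \<Rightarrow> bool" where
  "zariski_open U \<longleftrightarrow> zariski_closed (- U)"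

definition zariski_closure :: "'n::finite cproj set \<Rightarrow> 'n cproj set" where
  "zariski_closure X = \<Inter>{Z. zariski_closed Z \<and> X \<subseteq> Z}"

definition vanishing_forms :: "'n::finite cproj set \<Rightarrow> (complex ^ 'n \<Rightarrow> complex) set" where
  "vanishing_forms X = {f. (\<exists>d. is_form d f) \<and> X \<subseteq> zero_locus {f}}"

definition is_conic :: "3 cproj set \<Rightarrow> bool" where
  "is_conic D \<longleftrightarrow> (\<exists>q. is_form 2 q \<and> q \<noteq> (\<lambda>v. 0) \<and> D = zero_locus {q})"


section \<open>Smooth points of surfaces\<close>

text \<open>The embedded tangent space is represented by its affine cone, the joint kernel of the
  differentials of all forms that vanish on the variety. A point of a surface is smooth if this
  cone has dimension 3, that is, if the tangent space is a projective plane. Using all vanishing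
  forms gives the notion for the reduced variety, independently of a choice of equations.\<close>

definition tangent_cone_space :: "'n::finite cproj set \<Rightarrow> 'n cproj \<Rightarrow> (complex ^ 'n) set" where
  "tangent_cone_space X p =
     {u. \<forall>f\<in>vanishing_forms X. \<forall>v\<in>line p - {0}. deriv (\<lambda>t. f (v + t *s u)) 0 = 0}"

definition smooth_part :: "4 cproj set \<Rightarrow> 4 cproj set" where
  "smooth_part S = {p \<in> S. vec.dim (tangent_cone_space S p) = 3}"


section \<open>Real central projections and pictures\<close>

definition complexify :: "real ^ 'n ^ 'm \<Rightarrow> complex ^ 'n ^ 'm" where
  "complexify A = (\<chi> i j. complex_of_real (A $ i $ j))"

text \<open>A real central projection is given by a matrix satisfying this predicate. Its center
  is spanned by a real vector, hence is automatically a real point.\<close>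

definition central_projection :: "real ^ 4 ^ 3 \<Rightarrow> bool" where
  "central_projection A \<longleftrightarrow> rank A = 3"

definition center :: "real ^ 4 ^ 3 \<Rightarrow> 4 cproj" where
  "center A = Point {v. complexify A *v v = 0}"

text \<open>Meaningful only for points other than the center.\<close>

definition proj_map :: "real ^ 4 ^ 3 \<Rightarrow> 4 cproj \<Rightarrow> 3 cproj" where
  "proj_map A p = Point ((\<lambda>v. complexify A *v v) ` line p)"

definition proj_image :: "real ^ 4 ^ 3 \<Rightarrow> 4 cproj set \<Rightarrow> 3 cproj set" where
  "proj_image A X = proj_map A ` (X - {center A})"

text \<open>Up to a twist by a line, the differential at \<open>p\<close> of the restricted projection is the map
  induced by the matrix from the tangent cone modulo \<open>line p\<close> to the coordinate space modulo
  \<open>line (proj_map A p)\<close>. As the tangent cone contains \<open>line p\<close>, this map is surjective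
  if and only if the matrix maps the tangent cone onto the whole space.\<close>

definition critical_points :: "real ^ 4 ^ 3 \<Rightarrow> 4 cproj set \<Rightarrow> 4 cproj set" where
  "critical_points A S =
     {p \<in> smooth_part S - {center A}.
        (\<lambda>v. complexify A *v v) ` tangent_cone_space S p \<noteq> UNIV}"

definition picture :: "real ^ 4 ^ 3 \<Rightarrow> 4 cproj set \<Rightarrow> 3 cproj set" where
  "picture A S = zariski_closure (proj_map A ` critical_points A S)"


section \<open>The Euclidean absolute and tori\<close>

text \<open>The components 1, 2, 3, 4 of a vector are the coordinates \<open>x, y, z, w\<close>.\<close>

definition infinite_plane :: "4 cproj set" where
  "infinite_plane = zero_locus {\<lambda>v. v $ 4}"

definition euclidean_absolute :: "4 cproj set" where
  "euclidean_absolute =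
     zero_locus {\<lambda>v. v $ 4, \<lambda>v. (v $ 1)\<^sup>2 + (v $ 2)\<^sup>2 + (v $ 3)\<^sup>2}"

definition admissible :: "real \<Rightarrow> real \<Rightarrow> bool" where
  "admissible a b \<longleftrightarrow> a > 0 \<and> b > 0 \<and> b \<noteq> 4 * a"

definition torus :: "real \<Rightarrow> real \<Rightarrow> 4 cproj set" where
  "torus a b = zero_locus
     {\<lambda>v. ((v $ 1)\<^sup>2 + (v $ 2)\<^sup>2 + (v $ 3)\<^sup>2 + complex_of_real a * (v $ 4)\<^sup>2)\<^sup>2
          - complex_of_real b * ((v $ 1)\<^sup>2 + (v $ 2)\<^sup>2) * (v $ 4)\<^sup>2}"

end

theory Submission
  imports Defs "HOL-Computational_Algebra.Fundamental_Theorem_Algebra"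
begin

text \<open>
  Duality turns the picture into a curve that can be written down. Write \<open>b = 4 R^2\<close> and
  \<open>a = R^2 - r^2\<close>, so that \<open>R\<close> and \<open>r\<close> are the radii, normalise the center to \<open>(x : y : z : 1)\<close>, and let
  \<open>n = (u, v, t)\<close> be the normal of a plane through it, \<open>L = x u + y v + z t\<close>. Such a plane is tangent to
  the torus exactly if \<open>A^2 = b (u^2 + v^2) L^2\<close> with \<open>A = a (u^2 + v^2) - r^2 t^2 + L^2\<close>. This plane quartic
  is the dual of the picture, and the dual of the elliptic absolute is the conic \<open>u^2 + v^2 + t^2 = 0\<close> in
  the same coordinates. The theorem reduces to two claims: the picture determines the quartic, and
  a plane quartic has only finitely many presentations of this special shape.

  For the first claim, the quartic is parametrised by a curve \<open>s^2 = D(q)\<close> that is irreducible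
  because the center is off the torus, so its polynomial functions form an integral domain
  (\<open>vanishes_mult\<close>). Up to points on a line and a conic, the critical values are the images of an
  explicit map \<open>contour\<close> on this curve (\<open>vanishes_of_critical\<close>, \<open>critical_of_vanishes\<close>), so two cameras with the
  same picture have the same forms vanishing along their curves (\<open>transfer\<close>). If \<open>g\<close> is such a form of least
  degree, its gradient at a contour point is a multiple of the tangent line there, and not everywhere
  zero (\<open>gradient_is_normal\<close>). Hence the second quartic composed with the gradient of \<open>g\<close> is again a form that
  vanishes along both curves, that is, the second quartic vanishes on the first. A quartic
  form with this property is a multiple of the first quartic, since almost every line through the point
  \<open>u = v = 0\<close> meets it in four points (\<open>low_form_vanishing\<close>, \<open>quartic_relation\<close>).

  For the second claim, the only singular points of the quartic are its two nodes on \<open>L = 0\<close>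
  (\<open>quartic_singular\<close>), so \<open>L\<close> is determined up to a factor (\<open>offset_proportional\<close>). Comparing two presentations
  along \<open>L = 0\<close> shows that, up to factors, \<open>A\<close> changes to \<open>A + m L^2\<close> and \<open>B = b (u^2 + v^2)\<close> to
  \<open>B + 2 m A + m^2 L^2\<close> for some number \<open>m\<close> (\<open>presentation_shift\<close>). The new \<open>B\<close> has rank two, so its determinant
  vanishes; this is a nonzero polynomial condition on \<open>m\<close> (\<open>degenerate_shift\<close>). Finally, \<open>m\<close> determines the conic:
  two presentations with the same \<open>m\<close> give two ways to split \<open>A\<close> into multiples of \<open>B\<close>, \<open>L^2\<close> and the square of
  a linear form, and a rank argument shows that they agree up to factors that preserve
  \<open>u^2 + v^2 + t^2\<close> up to scale (\<open>rank_one_rigidity\<close>, \<open>same_presentation_conformal\<close>).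
\<close>

section \<open>Forms and their gradients\<close>

abbreviation monomial_fun :: "('n \<Rightarrow> nat) \<Rightarrow> complex ^ 'n::finite \<Rightarrow> complex" where
  "monomial_fun m v \<equiv> (\<Prod>i\<in>UNIV. v $ i ^ m i)"

lemma finite_exponents: "finite {m :: 'n::finite \<Rightarrow> nat. (\<Sum>i\<in>UNIV. m i) = d}"
proof (rule finite_subset)
  show "{m :: 'n \<Rightarrow> nat. (\<Sum>i\<in>UNIV. m i) = d}
      \<subseteq> {f. \<forall>x. (x \<in> UNIV \<longrightarrow> f x \<in> {..d}) \<and> (x \<notin> UNIV \<longrightarrow> f x = 0)}"
    by (auto intro: member_le_sum)
  show "finite {f :: 'n \<Rightarrow> nat. \<forall>x. (x \<in> UNIV \<longrightarrow> f x \<in> {..d}) \<and> (x \<notin> UNIV \<longrightarrow> f x = 0)}"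
    by (rule finite_set_of_finite_funs) auto
qed

lemma is_form_zero [simp]: "is_form d (\<lambda>v :: complex ^ 'n::finite. 0)"
  unfolding is_form_def by (rule exI[of _ "\<lambda>_. 0"]) simp

lemma is_form_add: "is_form d f \<Longrightarrow> is_form d g \<Longrightarrow> is_form d (\<lambda>v. f v + g v)"
  unfolding is_form_def
proof (elim exE)
  fix c c'
  assume "f = (\<lambda>v. \<Sum>m | (\<Sum>i\<in>UNIV. m i) = d. c m * monomial_fun m v)"
    "g = (\<lambda>v. \<Sum>m | (\<Sum>i\<in>UNIV. m i) = d. c' m * monomial_fun m v)"
  then show "\<exists>c. (\<lambda>v. f v + g v) = (\<lambda>v. \<Sum>m | (\<Sum>i\<in>UNIV. m i) = d. c m * monomial_fun m v)"
    by (intro exI[of _ "\<lambda>m. c m + c' m"]) (simp add: sum.distrib distrib_right)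
qed

lemma is_form_scale: "is_form d f \<Longrightarrow> is_form d (\<lambda>v. k * f v)"
  unfolding is_form_def
proof (elim exE)
  fix c
  assume "f = (\<lambda>v. \<Sum>m | (\<Sum>i\<in>UNIV. m i) = d. c m * monomial_fun m v)"
  then show "\<exists>c. (\<lambda>v. k * f v) = (\<lambda>v. \<Sum>m | (\<Sum>i\<in>UNIV. m i) = d. c m * monomial_fun m v)"
    by (intro exI[of _ "\<lambda>m. k * c m"]) (simp add: sum_distrib_left mult.assoc)
qed

lemma is_form_diff: "is_form d f \<Longrightarrow> is_form d g \<Longrightarrow> is_form d (\<lambda>v. f v - g v)"
  using is_form_add[of d f "\<lambda>v. (-1) * g v"] is_form_scale[of d g "-1"] by simp

lemma is_form_sum:
  "(\<And>k. k \<in> S \<Longrightarrow> is_form d (f k)) \<Longrightarrow> is_form d (\<lambda>v. \<Sum>k\<in>S. f k v)"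
  by (induction S rule: infinite_finite_induct) (auto intro: is_form_add)

lemma is_form_monomial:
  assumes "(\<Sum>i\<in>UNIV. m i) = d"
  shows "is_form d (monomial_fun m)"
  unfolding is_form_def
proof (rule exI[of _ "\<lambda>k. if k = m then 1 else 0"], rule ext)
  fix v :: "complex ^ 'a"
  have "(\<Sum>k | (\<Sum>i\<in>UNIV. k i) = d. (if k = m then 1 else 0) * monomial_fun k v)
     = (\<Sum>k | (\<Sum>i\<in>UNIV. k i) = d. if m = k then monomial_fun k v else 0)"
    by (intro sum.cong) auto
  also have "\<dots> = monomial_fun m v"
    using assms by (simp add: sum.delta' finite_exponents)
  finally show "monomial_fun m v
     = (\<Sum>k | (\<Sum>i\<in>UNIV. k i) = d. (if k = m then 1 else 0) * monomial_fun k v)" by simp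
qed

text \<open>Polynomials in several variables are handled as functions, so an induction over the monomials of
  a form replaces a recursion on its coefficients.\<close>

lemma is_form_induct [consumes 1, case_names zero add monomial]:
  fixes f :: "complex ^ 'n::finite \<Rightarrow> complex"
  assumes "is_form d f"
    and zero: "P (\<lambda>v. 0)"
    and add: "\<And>f g. is_form d f \<Longrightarrow> is_form d g \<Longrightarrow> P f \<Longrightarrow> P g \<Longrightarrow> P (\<lambda>v. f v + g v)"
    and mono: "\<And>k m. (\<Sum>i\<in>UNIV. m i) = d \<Longrightarrow> P (\<lambda>v. k * monomial_fun m v)"
  shows "P f"
proof -
  from assms(1) obtain c where f: "f = (\<lambda>v. \<Sum>m | (\<Sum>i\<in>UNIV. m i) = d. c m * monomial_fun m v)"
    unfolding is_form_def by blast
  have "is_form d (\<lambda>v. \<Sum>m\<in>S. c m * monomial_fun m v) \<and> P (\<lambda>v. \<Sum>m\<in>S. c m * monomial_fun m v)"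
    if "finite S" "S \<subseteq> {m. (\<Sum>i\<in>UNIV. m i) = d}" for S
    using that
  proof (induction S rule: finite_induct)
    case empty
    then show ?case using zero by simp
  next
    case (insert m S)
    then have m: "(\<Sum>i\<in>UNIV. m i) = d" by simp
    have "is_form d (\<lambda>v. c m * monomial_fun m v)"
      by (intro is_form_scale is_form_monomial m)
    then show ?case
      using insert mono[OF m, of "c m"] add[of "\<lambda>v. c m * monomial_fun m v" "\<lambda>v. \<Sum>m\<in>S. c m * monomial_fun m v"]
        is_form_add[of d "\<lambda>v. c m * monomial_fun m v" "\<lambda>v. \<Sum>m\<in>S. c m * monomial_fun m v"] by simp
  qed
  from this[OF finite_exponents subset_refl] show ?thesis unfolding f by blast
qed

lemma is_form_mult:
  assumes "is_form d f" "is_form e g"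
  shows "is_form (d + e) (\<lambda>v. f v * g v)"
  using assms(1)
proof (induction rule: is_form_induct)
  case (monomial k m)
  show ?case using assms(2)
  proof (induction rule: is_form_induct)
    case (monomial k' m')
    have "is_form (d + e) (\<lambda>v. (k * k') * monomial_fun (\<lambda>i. m i + m' i) v)"
      using monomial \<open>(\<Sum>i\<in>UNIV. m i) = d\<close>
      by (intro is_form_scale is_form_monomial) (simp add: sum.distrib)
    then show ?case by (simp add: power_add prod.distrib mult_ac)
  qed (auto simp: distrib_left intro: is_form_add)
qed (auto simp: distrib_right intro: is_form_add)

lemma is_form_const: "is_form 0 (\<lambda>v :: complex ^ 'n::finite. k)"
  using is_form_scale[OF is_form_monomial[of "\<lambda>_ :: 'n. 0" 0], of k] by simp

lemma is_form_coord: "is_form 1 (\<lambda>v :: complex ^ 'n::finite. v $ i)"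
proof -
  have "is_form 1 (monomial_fun (\<lambda>j. if j = i then 1 else 0))"
    by (intro is_form_monomial) simp
  moreover have "monomial_fun (\<lambda>j. if j = i then 1 else 0) v = v $ i" for v :: "complex ^ 'n"
  proof -
    have "monomial_fun (\<lambda>j. if j = i then 1 else 0) v = (\<Prod>j\<in>UNIV. if j = i then v $ j else 1)"
      by (intro prod.cong) auto
    then show ?thesis by simp
  qed
  ultimately show ?thesis by simp
qed

lemma is_form_power: "is_form d f \<Longrightarrow> is_form (n * d) (\<lambda>v. f v ^ n)"
proof (induction n)
  case 0 then show ?case using is_form_const[of 1] by simp
next
  case (Suc n) then show ?case using is_form_mult[of d f "n * d" "\<lambda>v. f v ^ n"] by simp
qed

lemma is_form_coord_square: "is_form 2 (\<lambda>v :: complex ^ 'n::finite. (v $ i)^2)"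
  using is_form_power[OF is_form_coord, of 2 i] by simp

lemma is_form_prod:
  "finite S \<Longrightarrow> (\<And>k. k \<in> S \<Longrightarrow> is_form (d k) (f k)) \<Longrightarrow> is_form (\<Sum>k\<in>S. d k) (\<lambda>v. \<Prod>k\<in>S. f k v)"
proof (induction S rule: finite_induct)
  case empty then show ?case using is_form_const[of 1] by simp
next
  case (insert k S)
  then show ?case using is_form_mult[of "d k" "f k" "sum d S" "\<lambda>v. \<Prod>k\<in>S. f k v"] by simp
qed

lemma is_form_compose:
  fixes f :: "complex ^ 'n::finite \<Rightarrow> complex" and V :: "complex ^ 'm::finite \<Rightarrow> complex ^ 'n"
  assumes "is_form d f" "\<And>i. is_form e (\<lambda>v. V v $ i)"
  shows "is_form (d * e) (\<lambda>v. f (V v))"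
  using assms(1)
proof (induction rule: is_form_induct)
  case (monomial k m)
  have "is_form (\<Sum>i\<in>UNIV. m i * e) (\<lambda>v. monomial_fun m (V v))"
    by (intro is_form_prod is_form_power assms) auto
  also have "(\<Sum>i\<in>UNIV. m i * e) = d * e" using monomial by (simp add: sum_distrib_right[symmetric])
  finally show ?case by (rule is_form_scale)
qed (auto intro: is_form_add)

lemma is_form_matrix:
  fixes f :: "complex ^ 'n::finite \<Rightarrow> complex" and A :: "complex ^ 'm::finite ^ 'n"
  assumes "is_form d f"
  shows "is_form d (\<lambda>v. f (A *v v))"
proof -
  have "is_form 1 (\<lambda>v. (A *v v) $ i)" for i
    unfolding matrix_vector_mult_def by (simp add: is_form_sum is_form_scale is_form_coord[simplified])
  from is_form_compose[OF assms this] show ?thesis by simp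
qed

lemma form_homogeneous: "is_form d f \<Longrightarrow> f (k *s v) = k ^ d * f v"
proof (induction rule: is_form_induct)
  case (monomial c m)
  have "(\<Prod>i\<in>UNIV. k ^ m i) = k ^ d" using monomial by (simp add: power_sum[symmetric])
  then show ?case by (simp add: power_mult_distrib prod.distrib)
qed (simp_all add: distrib_left)

lemma form_continuous: "is_form d f \<Longrightarrow> continuous_on S f"
  by (induction rule: is_form_induct) (auto intro!: continuous_intros)

text \<open>A property rather than a function: partial derivatives that satisfy the chain rule along every
  holomorphic curve. It is stable under linear substitution and needs no total derivative.\<close>

definition gradient_of ::
  "(complex ^ 'n::finite \<Rightarrow> complex) \<Rightarrow> ('n \<Rightarrow> complex ^ 'n \<Rightarrow> complex) \<Rightarrow> bool" where
  "gradient_of f G \<longleftrightarrow> (\<forall>\<gamma> \<gamma>' t. (\<forall>i. ((\<lambda>\<tau>. \<gamma> \<tau> $ i) has_field_derivative \<gamma>' $ i) (at t)) \<longrightarrow>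
     ((\<lambda>\<tau>. f (\<gamma> \<tau>)) has_field_derivative (\<Sum>i\<in>UNIV. G i (\<gamma> t) * \<gamma>' $ i)) (at t))"

lemma gradient_ofD:
  "gradient_of f G \<Longrightarrow> (\<And>i. ((\<lambda>\<tau>. \<gamma> \<tau> $ i) has_field_derivative \<gamma>' $ i) (at t)) \<Longrightarrow>
     ((\<lambda>\<tau>. f (\<gamma> \<tau>)) has_field_derivative (\<Sum>i\<in>UNIV. G i (\<gamma> t) * \<gamma>' $ i)) (at t)"
  unfolding gradient_of_def by blast

lemma form_gradient:
  fixes f :: "complex ^ 'n::finite \<Rightarrow> complex"
  assumes "is_form d f"
  shows "\<exists>G. (\<forall>i. is_form (d - 1) (G i)) \<and> gradient_of f G"
  using assms
proof (induction rule: is_form_induct)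
  case zero
  show ?case by (rule exI[of _ "\<lambda>_ _. 0"]) (simp add: gradient_of_def)
next
  case (add f g)
  then obtain G H where G: "\<forall>i. is_form (d - 1) (G i)" "gradient_of f G"
    and H: "\<forall>i. is_form (d - 1) (H i)" "gradient_of g H" by blast
  have "gradient_of (\<lambda>v. f v + g v) (\<lambda>i v. G i v + H i v)"
    unfolding gradient_of_def
  proof (intro allI impI)
    fix \<gamma> :: "complex \<Rightarrow> complex ^ 'n" and \<gamma>' t
    assume "\<forall>i. ((\<lambda>\<tau>. \<gamma> \<tau> $ i) has_field_derivative \<gamma>' $ i) (at t)"
    then show "((\<lambda>\<tau>. f (\<gamma> \<tau>) + g (\<gamma> \<tau>)) has_field_derivative
        (\<Sum>i\<in>UNIV. (G i (\<gamma> t) + H i (\<gamma> t)) * \<gamma>' $ i)) (at t)"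
      using DERIV_add[OF gradient_ofD[OF G(2)] gradient_ofD[OF H(2)]]
      by (simp add: distrib_right sum.distrib)
  qed
  then show ?case using G H is_form_add by (intro exI[of _ "\<lambda>i v. G i v + H i v"]) blast
next
  case (monomial k m)
  define G where "G = (\<lambda>i (v :: complex ^ 'n). k * (of_nat (m i) * v $ i ^ (m i - 1) * (\<Prod>j\<in>UNIV - {i}. v $ j ^ m j)))"
  have "is_form (d - 1) (G i)" for i
  proof (cases "m i = 0")
    case True
    then show ?thesis unfolding G_def by simp
  next
    case False
    have "d = m i + (\<Sum>j\<in>UNIV - {i}. m j)"
      using monomial by (metis UNIV_I finite sum.remove)
    then have d: "d - 1 = (m i - 1) * 1 + (\<Sum>j\<in>UNIV - {i}. m j * 1)" using False by simp
    have "is_form (d - 1) (\<lambda>v. v $ i ^ (m i - 1) * (\<Prod>j\<in>UNIV - {i}. v $ j ^ m j))"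
      unfolding d by (intro is_form_mult is_form_power is_form_prod is_form_coord) auto
    then show ?thesis unfolding G_def
      by (auto intro!: is_form_scale simp: mult.assoc)
  qed
  moreover have "gradient_of (\<lambda>v. k * monomial_fun m v) G"
    unfolding gradient_of_def
  proof (intro allI impI)
    fix \<gamma> :: "complex \<Rightarrow> complex ^ 'n" and \<gamma>' t
    assume \<gamma>: "\<forall>i. ((\<lambda>\<tau>. \<gamma> \<tau> $ i) has_field_derivative \<gamma>' $ i) (at t)"
    have "((\<lambda>\<tau>. monomial_fun m (\<gamma> \<tau>)) has_field_derivative
      (\<Sum>i\<in>UNIV. (of_nat (m i) * \<gamma> t $ i ^ (m i - 1) * \<gamma>' $ i) * (\<Prod>j\<in>UNIV - {i}. \<gamma> t $ j ^ m j))) (at t)"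
      by (rule has_field_derivative_prod)
         (use \<gamma> in \<open>auto intro!: derivative_eq_intros\<close>)
    then have "((\<lambda>\<tau>. k * monomial_fun m (\<gamma> \<tau>)) has_field_derivative
      k * (\<Sum>i\<in>UNIV. (of_nat (m i) * \<gamma> t $ i ^ (m i - 1) * \<gamma>' $ i) * (\<Prod>j\<in>UNIV - {i}. \<gamma> t $ j ^ m j))) (at t)"
      by (rule DERIV_cmult)
    then show "((\<lambda>\<tau>. k * monomial_fun m (\<gamma> \<tau>)) has_field_derivative
        (\<Sum>i\<in>UNIV. G i (\<gamma> t) * \<gamma>' $ i)) (at t)"
      by (simp add: G_def sum_distrib_left mult_ac)
  qed
  ultimately show ?case by blast
qed

lemma gradient_line:
  assumes "gradient_of f G"
  shows "((\<lambda>\<tau>. f (v + \<tau> *s u)) has_field_derivative (\<Sum>i\<in>UNIV. G i v * u $ i)) (at 0)"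
proof -
  have "((\<lambda>\<tau>. (v + \<tau> *s u) $ i) has_field_derivative u $ i) (at 0)" for i
    by (auto intro!: derivative_eq_intros)
  from gradient_ofD[OF assms, where \<gamma> = "\<lambda>\<tau>. v + \<tau> *s u", OF this] show ?thesis by simp
qed

lemma euler_form:
  assumes "is_form d f" "gradient_of f G"
  shows "(\<Sum>i\<in>UNIV. G i v * v $ i) = of_nat d * f v"
proof -
  have "((\<lambda>\<tau>. (\<tau> *s v) $ i) has_field_derivative v $ i) (at 1)" for i
    by (auto intro!: derivative_eq_intros)
  from gradient_ofD[OF assms(2), where \<gamma> = "\<lambda>\<tau>. \<tau> *s v", OF this]
  have "((\<lambda>\<tau>. f (\<tau> *s v)) has_field_derivative (\<Sum>i\<in>UNIV. G i v * v $ i)) (at 1)" by simp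
  moreover have "((\<lambda>\<tau>. f (\<tau> *s v)) has_field_derivative of_nat d * f v) (at 1)"
    unfolding form_homogeneous[OF assms(1)] by (auto intro!: derivative_eq_intros)
  ultimately show ?thesis by (rule DERIV_unique)
qed

lemma prod_UNIV_3: "prod f (UNIV :: 3 set) = f 1 * f 2 * f 3"
  unfolding UNIV_3 by (simp add: ac_simps)

text \<open>Restricting to a line through \<open>(0 : 0 : 1)\<close> gives a polynomial whose top coefficient does not
  depend on the line; only the pure power of the last coordinate contributes to it.\<close>

lemma form_restricted_to_line:
  fixes f :: "complex ^ 3 \<Rightarrow> complex"
  assumes "is_form d f"
  shows "\<exists>p. degree p \<le> d \<and> coeff p d = f (vector [0,0,1]) \<and> (\<forall>t. f (vector [u,v,t]) = poly p t)"
  using assms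
proof (induction rule: is_form_induct)
  case zero
  show ?case by (rule exI[of _ 0]) simp
next
  case (add f g)
  then obtain p q where "degree p \<le> d" "coeff p d = f (vector [0,0,1])" "\<forall>t. f (vector [u,v,t]) = poly p t"
    "degree q \<le> d" "coeff q d = g (vector [0,0,1])" "\<forall>t. g (vector [u,v,t]) = poly q t" by blast
  then show ?case by (intro exI[of _ "p + q"]) (auto intro: degree_add_le)
next
  case (monomial k m)
  have m: "m 1 + m 2 + m 3 = d" using monomial by (simp add: sum_3)
  show ?case
  proof (rule exI[of _ "monom (k * u ^ m 1 * v ^ m 2) (m 3)"], intro conjI allI)
    show "degree (monom (k * u ^ m 1 * v ^ m 2) (m 3)) \<le> d"
      using m degree_monom_le[of "k * u ^ m 1 * v ^ m 2" "m 3"] by linarith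
    show "coeff (monom (k * u ^ m 1 * v ^ m 2) (m 3)) d
        = k * (\<Prod>i\<in>UNIV. vector [0, 0, 1] $ i ^ m i)"
      using m by (auto simp: prod_UNIV_3 vector_3 power_0_left)
  qed (simp add: poly_monom prod_UNIV_3 vector_3)
qed

section \<open>Polynomial functions on a double cover of the line\<close>

text \<open>A root of odd order prevents \<open>D\<close> from being a square in the field of rational functions, so the curve
  \<open>s^2 = D(q)\<close> is irreducible. The bound on the degree makes \<open>s\<close> behave like a polynomial of degree two
  in \<open>q\<close>, which gives the functions below an additive weight.\<close>

locale double_cover =
  fixes D :: "complex poly"
  assumes D0: "D \<noteq> 0" and degree_D: "degree D \<le> 4" and odd_root: "\<exists>a. odd (order a D)"
begin

definition on_curve :: "complex \<Rightarrow> complex \<Rightarrow> bool" where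
  "on_curve q s \<longleftrightarrow> s^2 = poly D q"

definition regular_fun :: "nat \<Rightarrow> (complex \<Rightarrow> complex \<Rightarrow> complex) \<Rightarrow> bool" where
  "regular_fun M h \<longleftrightarrow> (\<exists>P S. degree P \<le> M \<and> (S = 0 \<or> degree S + 2 \<le> M) \<and>
     (\<forall>q s. on_curve q s \<longrightarrow> h q s = poly P q + poly S q * s))"

definition vanishes :: "(complex \<Rightarrow> complex \<Rightarrow> complex) \<Rightarrow> bool" where
  "vanishes h \<longleftrightarrow> (\<forall>q s. on_curve q s \<longrightarrow> h q s = 0)"

lemma on_curve_csqrt: "on_curve q (csqrt (poly D q))"
  by (simp add: on_curve_def)

lemma on_curve_uminus: "on_curve q s \<Longrightarrow> on_curve q (- s)"
  by (simp add: on_curve_def)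

text \<open>The order of a square at any point is even, whereas \<open>D\<close> has a root of odd order.\<close>

lemma square_multiple_zero:
  assumes "P^2 = S^2 * D"
  shows "P = 0 \<and> S = 0"
proof -
  obtain a where a: "odd (order a D)" using odd_root by blast
  have "S = 0"
  proof (rule ccontr)
    assume S: "S \<noteq> 0"
    then have P: "P \<noteq> 0" using assms D0 by auto
    have "order a (P * P) = order a P + order a P" using P by (intro order_mult) simp
    moreover have "order a (S * S * D) = order a (S * S) + order a D"
      using S D0 by (intro order_mult) simp
    moreover have "order a (S * S) = order a S + order a S" using S by (intro order_mult) simp
    moreover have "P * P = S * S * D" using assms unfolding power2_eq_square .
    ultimately have "order a P + order a P = order a S + order a S + order a D" by metis
    then have "even (order a S + order a S + order a D)" by (metis even_add)
    then show False using a by simp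
  qed
  moreover from this have "P^2 = 0" using assms by simp
  ultimately show ?thesis by simp
qed

lemma regular_fun_mono: "regular_fun M h \<Longrightarrow> M \<le> M' \<Longrightarrow> regular_fun M' h"
  unfolding regular_fun_def by (blast intro: le_trans)

lemma regular_const: "regular_fun 0 (\<lambda>q s. k)"
  unfolding regular_fun_def by (rule exI[of _ "[:k:]"], rule exI[of _ 0]) simp

lemma regular_poly: "degree P \<le> M \<Longrightarrow> regular_fun M (\<lambda>q s. poly P q)"
  unfolding regular_fun_def by (rule exI[of _ P], rule exI[of _ 0]) simp

lemma regular_s: "regular_fun 2 (\<lambda>q s. s)"
  unfolding regular_fun_def by (rule exI[of _ 0], rule exI[of _ 1]) simp

lemma regular_add:
  assumes "regular_fun M h" "regular_fun M h'"
  shows "regular_fun M (\<lambda>q s. h q s + h' q s)"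
proof -
  from assms obtain P S P' S' where 
    *: "degree P \<le> M" "S = 0 \<or> degree S + 2 \<le> M" "\<And>q s. on_curve q s \<Longrightarrow> h q s = poly P q + poly S q * s"
      "degree P' \<le> M" "S' = 0 \<or> degree S' + 2 \<le> M" "\<And>q s. on_curve q s \<Longrightarrow> h' q s = poly P' q + poly S' q * s"
    unfolding regular_fun_def by blast
  have "S + S' = 0 \<or> degree (S + S') + 2 \<le> M"
    using *(2,5) degree_add_le_max[of S S'] by auto
  then show ?thesis
    unfolding regular_fun_def using *
    by (rule_tac exI[of _ "P + P'"], rule_tac exI[of _ "S + S'"]) (simp add: algebra_simps degree_add_le)
qed

lemma regular_mult:
  assumes "regular_fun M h" "regular_fun M' h'"
  shows "regular_fun (M + M') (\<lambda>q s. h q s * h' q s)"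
proof -
  from assms obtain P S P' S' where
    *: "degree P \<le> M" "S = 0 \<or> degree S + 2 \<le> M" "\<And>q s. on_curve q s \<Longrightarrow> h q s = poly P q + poly S q * s"
      "degree P' \<le> M'" "S' = 0 \<or> degree S' + 2 \<le> M'" "\<And>q s. on_curve q s \<Longrightarrow> h' q s = poly P' q + poly S' q * s"
    unfolding regular_fun_def by blast
  have PP: "degree (P * P') \<le> M + M'"
    using degree_mult_le[of P P'] * by linarith
  have SSD: "degree (S * S' * D) \<le> M + M'"
  proof (cases "S = 0 \<or> S' = 0")
    case False
    then show ?thesis
      using degree_mult_le[of "S * S'" D] degree_mult_le[of S S'] *(2,5) degree_D by linarith
  qed auto
  have PS: "P * S' = 0 \<or> degree (P * S') + 2 \<le> M + M'"
    using degree_mult_le[of P S'] *(1,5) by (cases "S' = 0") auto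
  have SP: "S * P' = 0 \<or> degree (S * P') + 2 \<le> M + M'"
    using degree_mult_le[of S P'] *(2,4) by (cases "S = 0") auto
  have cross: "P * S' + S * P' = 0 \<or> degree (P * S' + S * P') + 2 \<le> M + M'"
    using PS SP degree_add_le_max[of "P * S'" "S * P'"] by auto
  show ?thesis
    unfolding regular_fun_def
  proof (rule exI[of _ "P * P' + S * S' * D"], rule exI[of _ "P * S' + S * P'"], intro conjI allI impI)
    show "degree (P * P' + S * S' * D) \<le> M + M'" using PP SSD by (rule degree_add_le)
    fix q s assume c: "on_curve q s"
    have "s * s = poly D q" using c by (simp add: on_curve_def power2_eq_square)
    then show "h q s * h' q s = poly (P * P' + S * S' * D) q + poly (P * S' + S * P') q * s"
      unfolding *(3)[OF c] *(6)[OF c] by (simp add: algebra_simps)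
  qed (rule cross)
qed

lemma regular_scale: "regular_fun M h \<Longrightarrow> regular_fun M (\<lambda>q s. k * h q s)"
  using regular_mult[OF regular_const[of k], of M h] by simp

lemma regular_diff:
  "regular_fun M h \<Longrightarrow> regular_fun M h' \<Longrightarrow> regular_fun M (\<lambda>q s. h q s - h' q s)"
  using regular_add[of M h "\<lambda>q s. (-1) * h' q s"] regular_scale[of M h' "-1"] by simp

lemma regular_sum:
  "(\<And>k. k \<in> A \<Longrightarrow> regular_fun M (h k)) \<Longrightarrow> regular_fun M (\<lambda>q s. \<Sum>k\<in>A. h k q s)"
proof (induction A rule: infinite_finite_induct)
  case (insert a A)
  then show ?case by (simp add: regular_add)
qed (auto intro: regular_fun_mono[OF regular_const])

lemma regular_power: "regular_fun M h \<Longrightarrow> regular_fun (n * M) (\<lambda>q s. h q s ^ n)"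
proof (induction n)
  case 0 then show ?case using regular_const[of 1] by simp
next
  case (Suc n)
  then show ?case using regular_mult[of M h "n * M" "\<lambda>q s. h q s ^ n"] by simp
qed

lemma regular_prod:
  "finite A \<Longrightarrow> (\<And>k. k \<in> A \<Longrightarrow> regular_fun (M k) (h k)) \<Longrightarrow>
     regular_fun (\<Sum>k\<in>A. M k) (\<lambda>q s. \<Prod>k\<in>A. h k q s)"
proof (induction A rule: finite_induct)
  case empty then show ?case using regular_const[of 1] by simp
next
  case (insert k A)
  then show ?case using regular_mult[of "M k" "h k" "sum M A" "\<lambda>q s. \<Prod>k\<in>A. h k q s"] by simp
qed

lemma regular_form:
  fixes f :: "complex ^ 'n::finite \<Rightarrow> complex"
  assumes "is_form d f" "\<And>i. regular_fun M (\<lambda>q s. V q s $ i)"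
  shows "regular_fun (d * M) (\<lambda>q s. f (V q s))"
  using assms(1)
proof (induction rule: is_form_induct)
  case zero
  show ?case using regular_fun_mono[OF regular_const] by simp
next
  case (add f g)
  then show ?case by (simp add: regular_add)
next
  case (monomial k m)
  have "regular_fun (\<Sum>i\<in>UNIV. m i * M) (\<lambda>q s. monomial_fun m (V q s))"
    by (intro regular_prod regular_power assms) auto
  also have "(\<Sum>i\<in>UNIV. m i * M) = d * M" using monomial by (simp add: sum_distrib_right[symmetric])
  finally show ?case by (rule regular_scale)
qed

text \<open>Multiplying with the conjugate \<open>s \<mapsto> - s\<close> eliminates \<open>s\<close> and leaves the norm \<open>P^2 - S^2 D\<close>, which is
  the zero polynomial only for \<open>P = S = 0\<close>.\<close>

lemma regular_norm:
  assumes "regular_fun M h"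
  shows "\<exists>N. degree N \<le> 2 * M \<and> (\<forall>q s. on_curve q s \<longrightarrow> h q s * h q (- s) = poly N q) \<and>
    (N = 0 \<longrightarrow> vanishes h)"
proof -
  from assms obtain P S where *: "degree P \<le> M" "S = 0 \<or> degree S + 2 \<le> M"
    "\<And>q s. on_curve q s \<Longrightarrow> h q s = poly P q + poly S q * s"
    unfolding regular_fun_def by blast
  show ?thesis
  proof (rule exI[of _ "P^2 - S\<^sup>2 * D"], intro conjI allI impI)
    have "degree (P^2) \<le> 2 * M" using degree_power_le[of P 2] *(1) by linarith
    moreover have "degree (S^2 * D) \<le> 2 * M"
      using *(2) degree_mult_le[of "S^2" D] degree_power_le[of S 2] degree_D by (cases "S = 0") auto
    ultimately show "degree (P^2 - S\<^sup>2 * D) \<le> 2 * M" by (rule degree_diff_le)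
    fix q s assume c: "on_curve q s"
    have "s * s = poly D q" using c by (simp add: on_curve_def power2_eq_square)
    then show "h q s * h q (- s) = poly (P^2 - S\<^sup>2 * D) q"
      unfolding *(3)[OF c] *(3)[OF on_curve_uminus[OF c]]
      by (simp add: power2_eq_square algebra_simps)
  next
    assume "P^2 - S\<^sup>2 * D = 0"
    then have "P = 0 \<and> S = 0" by (intro square_multiple_zero) simp
    then show "vanishes h" using *(3) by (simp add: vanishes_def)
  qed
qed

text \<open>The norm is multiplicative, and polynomials in \<open>q\<close> form an integral domain. This replaces
  every argument about generic points of the curve.\<close>

lemma vanishes_mult:
  assumes "regular_fun M h" "regular_fun M' h'" "vanishes (\<lambda>q s. h q s * h' q s)"
  shows "vanishes h \<or> vanishes h'"
proof -
  obtain N where "degree N \<le> 2 * M"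
    and N: "\<And>q s. on_curve q s \<Longrightarrow> h q s * h q (- s) = poly N q" "N = 0 \<Longrightarrow> vanishes h"
    using regular_norm[OF assms(1)] by auto
  obtain N' where "degree N' \<le> 2 * M'"
    and N': "\<And>q s. on_curve q s \<Longrightarrow> h' q s * h' q (- s) = poly N' q" "N' = 0 \<Longrightarrow> vanishes h'"
    using regular_norm[OF assms(2)] by auto
  have "poly (N * N') q = 0" for q
  proof -
    let ?s = "csqrt (poly D q)"
    have c: "on_curve q ?s" by (rule on_curve_csqrt)
    have "poly (N * N') q = (h q ?s * h q (- ?s)) * (h' q ?s * h' q (- ?s))"
      unfolding poly_mult N(1)[OF c] N'(1)[OF c] ..
    also have "\<dots> = (h q ?s * h' q ?s) * (h q (- ?s) * h' q (- ?s))"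
      by (simp only: mult_ac)
    also have "h q ?s * h' q ?s = 0" using assms(3) c unfolding vanishes_def by blast
    finally show ?thesis by simp
  qed
  then have "N * N' = 0" using poly_all_0_iff_0[of "N * N'"] by (simp only: simp_thms)
  then have "N = 0 \<or> N' = 0" by (simp only: mult_eq_0_iff)
  then show ?thesis using N(2) N'(2) by blast
qed

text \<open>The norm has degree at most \<open>2 * M\<close>, so one zero over each of more than \<open>2 * M\<close> values of \<open>q\<close>
  forces it to vanish.\<close>

lemma vanishes_by_counting:
  assumes "regular_fun M h" "\<And>k. k \<le> 2 * M \<Longrightarrow> h (of_nat k) (csqrt (poly D (of_nat k))) = 0"
  shows "vanishes h"
proof -
  obtain N where N: "degree N \<le> 2 * M" "\<And>q s. on_curve q s \<Longrightarrow> h q s * h q (- s) = poly N q"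
    "N = 0 \<Longrightarrow> vanishes h"
    using regular_norm[OF assms(1)] by auto
  have "N = 0"
  proof (rule ccontr)
    assume "N \<noteq> 0"
    have "poly N (of_nat k) = 0" if "k \<le> 2 * M" for k
      using N(2)[OF on_curve_csqrt, of "of_nat k"] assms(2)[OF that] by simp
    then have "of_nat ` {..2 * M} \<subseteq> {q. poly N q = 0}" by auto
    then have "card ((of_nat :: nat \<Rightarrow> complex) ` {..2 * M}) \<le> card {q. poly N q = 0}"
      by (intro card_mono poly_roots_finite \<open>N \<noteq> 0\<close>)
    also have "\<dots> \<le> degree N" by (rule card_poly_roots_bound[OF \<open>N \<noteq> 0\<close>])
    finally show False using N(1) by (simp add: card_image)
  qed
  then show ?thesis by (rule N(3))
qed

end

text \<open>Gaussian elimination: each equation removes at most one unknown.\<close>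

lemma homogeneous_system:
  fixes a :: "'k \<Rightarrow> 'i \<Rightarrow> complex"
  assumes "finite E" "finite I" "card E < card I"
  shows "\<exists>c. (\<exists>i\<in>I. c i \<noteq> 0) \<and> (\<forall>k\<in>E. (\<Sum>i\<in>I. a k i * c i) = 0)"
  using assms
proof (induction E arbitrary: I a rule: finite_induct)
  case empty
  then have "I \<noteq> {}" by auto
  then show ?case by (intro exI[of _ "\<lambda>_. 1"]) auto
next
  case (insert k E)
  show ?case
  proof (cases "\<forall>i\<in>I. a k i = 0")
    case True
    have "card E < card I" using insert by simp
    from insert.IH[OF \<open>finite I\<close> this, of a] obtain c
      where "\<exists>i\<in>I. c i \<noteq> 0" "\<forall>k\<in>E. (\<Sum>i\<in>I. a k i * c i) = 0" by (elim exE conjE)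
    moreover have "(\<Sum>i\<in>I. a k i * c i) = 0" using True by simp
    ultimately show ?thesis by (intro exI[of _ c]) simp
  next
    case False
    then obtain j where j: "j \<in> I" "a k j \<noteq> 0" by blast
    let ?I = "I - {j}"
    have "card E < card ?I" using insert j by simp
    from insert.IH[OF _ this, of "\<lambda>k' i. a k' i - a k' j * a k i / a k j"] \<open>finite I\<close>
    obtain c where c: "\<exists>i\<in>?I. c i \<noteq> 0"
      "\<forall>k'\<in>E. (\<Sum>i\<in>?I. (a k' i - a k' j * a k i / a k j) * c i) = 0"
      by (elim meta_impE exE conjE) simp_all
    define c' where "c' = c(j := - (\<Sum>i\<in>?I. a k i * c i) / a k j)"
    have split: "(\<Sum>i\<in>I. a k' i * c' i) = a k' j * c' j + (\<Sum>i\<in>?I. a k' i * c i)" for k'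
      using j insert.prems by (simp add: sum.remove[of I j] c'_def)
    have "(\<Sum>i\<in>I. a k' i * c' i) = 0" if "k' \<in> E" for k'
    proof -
      have "0 = (\<Sum>i\<in>?I. (a k' i - a k' j * a k i / a k j) * c i)" using c(2) that by simp
      also have "\<dots> = (\<Sum>i\<in>?I. a k' i * c i) - a k' j / a k j * (\<Sum>i\<in>?I. a k i * c i)"
        by (simp add: sum_distrib_left sum_subtractf[symmetric] algebra_simps)
      finally show ?thesis unfolding split by (simp add: c'_def)
    qed
    moreover have "(\<Sum>i\<in>I. a k i * c' i) = 0"
      unfolding split using j by (simp add: c'_def)
    moreover have "\<exists>i\<in>I. c' i \<noteq> 0" using c(1) by (auto simp: c'_def)
    ultimately show ?thesis by blast
  qed
qed


text \<open>Elimination by counting. The form has degree 30 with exponents of the first two variables at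
  most 15, hence 256 free coefficients. Its pullback has weight 120, so by the bound on the norm
  241 linear conditions make it vanish.\<close>

lemma (in double_cover) exists_vanishing_form:
  assumes V: "\<And>i. regular_fun 4 (\<lambda>q s. V q s $ i)"
  shows "\<exists>d (f :: complex ^ 3 \<Rightarrow> complex). is_form d f \<and> f \<noteq> (\<lambda>v. 0) \<and> vanishes (\<lambda>q s. f (V q s))"
proof -
  let ?I = "{..15::nat} \<times> {..15::nat}"
  define mon where "mon = (\<lambda>p (v :: complex ^ 3). v $ 1 ^ fst p * v $ 2 ^ snd p * v $ 3 ^ (30 - fst p - snd p))"
  define pt where "pt = (\<lambda>k::nat. V (of_nat k) (csqrt (poly D (of_nat k))))"
  have "card {..240::nat} < card ?I" by (simp add: card_cartesian_product)
  from homogeneous_system[OF _ _ this, of "\<lambda>k i. mon i (pt k)"]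
  obtain c where c: "\<exists>i\<in>?I. c i \<noteq> 0" "\<forall>k\<in>{..240}. (\<Sum>i\<in>?I. mon i (pt k) * c i) = 0"
    by (elim meta_impE exE conjE) simp_all
  define f where "f = (\<lambda>v. \<Sum>i\<in>?I. c i * mon i v)"
  have "is_form 30 (mon p)" if "p \<in> ?I" for p
  proof -
    obtain i j where p: "p = (i, j)" by force
    have *: "(i * 1 + j * 1) + (30 - i - j) * 1 = 30" using that p by auto
    have "is_form ((i * 1 + j * 1) + (30 - i - j) * 1) (mon p)" unfolding p mon_def fst_conv snd_conv
      by (intro is_form_mult is_form_power is_form_coord)
    then show ?thesis unfolding * .
  qed
  then have f: "is_form 30 f" unfolding f_def by (intro is_form_sum is_form_scale) auto
  moreover have "f \<noteq> (\<lambda>v. 0)"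
  proof
    assume "f = (\<lambda>v. 0)"
    then have z: "f (vector [u, v, 1]) = 0" for u v by simp
    have e: "f (vector [u, v, 1]) = (\<Sum>i\<le>15. (\<Sum>j\<le>15. c (i, j) * v ^ j) * u ^ i)" for u v
      unfolding f_def mon_def
      by (simp add: sum.cartesian_product' sum_distrib_right sum_distrib_left vector_3 mult_ac)
    have "(\<Sum>j\<le>15. c (i, j) * v ^ j) = 0" if "i \<le> 15" for i v
      using z[unfolded e, where v = v] polyfun_eq_0[of "\<lambda>i. \<Sum>j\<le>15. c (i, j) * v ^ j" 15] that by blast
    then have "c (i, j) = 0" if "i \<le> 15" "j \<le> 15" for i j
      using polyfun_eq_0[of "\<lambda>j. c (i, j)" 15] that by blast
    then show False using c(1) by (elim bexE) (simp add: mem_Times_iff split_beta, metis prod.collapse)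
  qed
  moreover have "vanishes (\<lambda>q s. f (V q s))"
  proof (rule vanishes_by_counting[OF regular_form[OF f V]])
    fix k :: nat assume "k \<le> 2 * (30 * 4)"
    then show "f (V (of_nat k) (csqrt (poly D (of_nat k)))) = 0"
      using c(2)[rule_format, of k] unfolding f_def pt_def by (simp add: mult.commute)
  qed
  ultimately show ?thesis by blast
qed

section \<open>The curve of tangent planes through the center\<close>

text \<open>A torus with radii \<open>R\<close>, \<open>r\<close> seen from \<open>(x : y : z : 1)\<close>. All numbers may be complex; \<open>r\<close> is imaginary
  if the torus has no real points. The last hypothesis says that the two nodes of the
  dual quartic do not coincide.\<close>

locale torus_view =
  fixes x y z R r :: complex
  assumes R0: "R \<noteq> 0" and r0: "r \<noteq> 0" and a0: "R^2 \<noteq> r^2"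
    and z0: "z \<noteq> 0" and zr: "z^2 \<noteq> r^2" and xy0: "x^2 + y^2 \<noteq> 0"
    and off_torus: "(x^2 + y^2 + z^2 + (R^2 - r\<^sup>2))^2 \<noteq> 4 * R^2 * (x^2 + y^2)"
    and distinct_nodes: "r^2 * (x^2 + y^2) \<noteq> (R^2 - r\<^sup>2) * z^2"
begin

text \<open>Normals are scaled such that \<open>u + \<i> v = 1\<close> and written \<open>u - \<i> v = q^2\<close>, so that
  \<open>u^2 + v^2 = q^2\<close> has the polynomial root \<open>q\<close>. Let \<open>\<kappa>\<close> be the square root of \<open>u^2 + v^2 + t^2\<close>. Tangency
  to the torus reads \<open>R q + r \<kappa> = x u + y v + z t\<close>, that is \<open>r \<kappa> = c(q) + z t\<close>, together with \<open>\<kappa>^2 = q^2 + t^2\<close>.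
  Eliminating \<open>\<kappa>\<close> gives a quadratic equation for \<open>t\<close>; up to a square its discriminant is \<open>D = c^2 + K q^2\<close>.
  Below, \<open>cP\<close> is \<open>c\<close> and \<open>DP\<close> is \<open>D\<close>.\<close>

definition al where "al = (x - \<i> * y) / 2"
definition be where "be = (x + \<i> * y) / 2"
definition K where "K = z^2 - r\<^sup>2"
definition cP where "cP = [:al, - R, be:]"
definition DP where "DP = cP^2 + smult K [:0, 0, 1:]"

lemma al_be: "4 * (al * be) = x^2 + y^2"
  by (simp add: al_def be_def field_simps power2_eq_square)

lemma al0: "al \<noteq> 0" and be0: "be \<noteq> 0"
  using al_be xy0 by auto

lemma K0: "K \<noteq> 0"
  using zr by (simp add: K_def)

lemma poly_cP: "poly cP q = al - R * q + be * q^2"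
  by (simp add: cP_def power2_eq_square algebra_simps)

lemma poly_DP: "poly DP q = (poly cP q)^2 + K * q^2"
  by (simp add: DP_def power2_eq_square algebra_simps)

lemma poly_pderiv_cP: "poly (pderiv cP) q = 2 * be * q - R"
  by (simp add: cP_def pderiv_pCons)

lemma poly_pderiv_DP: "poly (pderiv DP) q = 2 * poly cP q * (2 * be * q - R) + 2 * K * q"
  by (simp add: DP_def power2_eq_square pderiv_add pderiv_mult pderiv_smult poly_pderiv_cP
      pderiv_pCons algebra_simps)

text \<open>A double root would force the equation of the torus at the center.\<close>

lemma simple_roots:
  assumes "poly DP q = 0"
  shows "poly (pderiv DP) q \<noteq> 0"
proof
  define c where "c = poly cP q"
  define c' where "c' = 2 * be * q - R"
  have c: "c = al - R * q + be * q^2" unfolding c_def by (rule poly_cP)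
  assume "poly (pderiv DP) q = 0"
  then have 1: "c * c' + K * q = 0"
    unfolding poly_pderiv_DP c_def[symmetric] c'_def[symmetric] by algebra
  have 2: "c^2 + K * q^2 = 0" using assms by (simp add: poly_DP c_def)
  have q: "q \<noteq> 0"
  proof
    assume "q = 0"
    then show False using 2 al0 by (simp add: c)
  qed
  have c0: "c \<noteq> 0" using 2 q K0 by auto
  have "c * (c' * q) = c * c" using 1 2 by algebra
  then have "c' * q = c" using c0 by simp
  then have bq: "be * q^2 = al" unfolding c c'_def by algebra
  have "al * (4 * (al * be) - 4 * be * R * q + (R^2 + K)) = 0"
    using 2 bq unfolding c by algebra
  then have "4 * (al * be) - 4 * be * R * q + (R^2 + K) = 0" using al0 by simp
  then have "(x^2 + y^2) + (R^2 + K) = 4 * be * R * q"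
    unfolding al_be by algebra
  then have "((x^2 + y^2) + (R^2 + K))^2 = 4 * R^2 * (4 * (al * be))"
    using bq by algebra
  then show False using off_torus unfolding al_be K_def by (simp add: algebra_simps)
qed

lemma coeff_DP_4: "coeff DP 4 = be^2"
proof -
  have "DP = [:al^2, - 2 * al * R, R^2 + 2 * al * be + K, - 2 * R * be, be^2:]"
    by (simp add: DP_def cP_def power2_eq_square algebra_simps)
  then show ?thesis by (simp add: numeral_eq_Suc)
qed

lemma degree_DP: "degree DP \<le> 4"
proof -
  have "DP = [:al^2, - 2 * al * R, R^2 + 2 * al * be + K, - 2 * R * be, be^2:]"
    by (simp add: DP_def cP_def power2_eq_square algebra_simps)
  then show ?thesis by simp
qed

sublocale double_cover DP
proof
  show DP0: "DP \<noteq> 0" using coeff_DP_4 be0 by auto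
  show "degree DP \<le> 4" by (rule degree_DP)
  have "4 \<le> degree DP" using coeff_DP_4 be0 by (intro le_degree) simp
  then have "\<not> constant (poly DP)" by (simp add: constant_degree)
  then obtain a where a: "poly DP a = 0" using fundamental_theorem_of_algebra by blast
  have "order a DP \<noteq> 0" using a DP0 by (simp add: order_root)
  moreover have "\<not> 2 \<le> order a DP"
  proof
    assume "2 \<le> order a DP"
    then have "[:- a, 1:] ^ 2 dvd DP" using order_divides by blast
    then obtain k where "DP = [:- a, 1:] ^ 2 * k" by (elim dvdE)
    then have "poly (pderiv DP) a = poly (pderiv ([:- a, 1:] ^ 2 * k)) a" by (simp only:)
    also have "\<dots> = 0"
      by (simp only: power2_eq_square pderiv_mult poly_add poly_mult) simp
    finally have "poly (pderiv DP) a = 0" .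
    then show False using simple_roots[OF a] by blast
  qed
  ultimately have "order a DP = 1" by linarith
  then show "\<exists>a. odd (order a DP)" by (intro exI[of _ a]) simp
qed

text \<open>The normal \<open>nvec = (uu, vv, tt)\<close> and its length \<open>kk\<close> (the \<open>\<kappa>\<close> above) in terms of the point
  \<open>(q, s)\<close> of the curve. The vector \<open>contour\<close> points from the center to the point of tangency, scaled by
  \<open>q * kk\<close> to be polynomial.\<close>

definition uu where "uu q = (1 + q^2) / 2"
definition vv where "vv q = \<i> * (q^2 - 1) / 2"
definition tt where "tt q s = (r * s - z * poly cP q) / K"
definition kk where "kk q s = (z * s - r * poly cP q) / K"

definition nvec :: "complex \<Rightarrow> complex \<Rightarrow> complex ^ 3" where
  "nvec q s = vector [uu q, vv q, tt q s]"

definition contour :: "complex \<Rightarrow> complex \<Rightarrow> complex ^ 3" where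
  "contour q s = vector [(R * kk q s + r * q) * uu q - q * kk q s * x,
     (R * kk q s + r * q) * vv q - q * kk q s * y, r * q * tt q s - q * kk q s * z]"

lemma uu_vv: "uu q + \<i> * vv q = 1" "(uu q)^2 + (vv q)^2 = q^2"
  by (simp_all add: uu_def vv_def field_simps power2_eq_square)

lemma cP_uu_vv: "poly cP q = x * uu q + y * vv q - R * q"
  unfolding poly_cP al_def be_def uu_def vv_def by (simp add: field_simps power2_eq_square)

lemma kk_tt_linear: "r * kk q s = poly cP q + z * tt q s"
proof -
  have "r * kk q s - z * tt q s = (z^2 - r\<^sup>2) * poly cP q / K"
    using K0 by (simp add: kk_def tt_def field_simps power2_eq_square)
  then show ?thesis using K0 by (simp add: K_def[symmetric] algebra_simps)
qed

lemma kk_tt_square: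
  assumes "on_curve q s"
  shows "(kk q s)^2 = q^2 + (tt q s)^2"
proof -
  have "s^2 = (poly cP q)^2 + K * q^2" using assms by (simp add: on_curve_def poly_DP)
  then have "(z * s - r * poly cP q)^2 - (r * s - z * poly cP q)^2 = K^2 * q^2"
    unfolding K_def by algebra
  then have "(K * kk q s)^2 - (K * tt q s)^2 = K^2 * q^2"
    using K0 by (simp add: kk_def tt_def)
  then have "K^2 * ((kk q s)^2 - (tt q s)^2 - q\<^sup>2) = 0" by (simp add: algebra_simps power_mult_distrib)
  then have "(kk q s)^2 - (tt q s)^2 - q\<^sup>2 = 0" using K0 by simp
  then show ?thesis by algebra
qed

lemma nvec_contour:
  assumes "on_curve q s"
  shows "nvec q s $ 1 * contour q s $ 1 + nvec q s $ 2 * contour q s $ 2 + nvec q s $ 3 * contour q s $ 3 = 0"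
  unfolding nvec_def contour_def vector_3
  using kk_tt_square[OF assms] kk_tt_linear[of q s] uu_vv[of q] cP_uu_vv[of q] by algebra

lemma regular_uu: "regular_fun 2 (\<lambda>q s. uu q)"
proof -
  have "uu q = poly [:1/2, 0, 1/2:] q" for q :: complex by (simp add: uu_def power2_eq_square field_simps)
  then show ?thesis using regular_poly[of "[:1/2, 0, 1/2:]" 2] by simp
qed

lemma regular_vv: "regular_fun 2 (\<lambda>q s. vv q)"
proof -
  have "vv q = poly [:- \<i>/2, 0, \<i>/2:] q" for q :: complex by (simp add: vv_def power2_eq_square field_simps)
  then show ?thesis using regular_poly[of "[:- \<i>/2, 0, \<i>/2:]" 2] by simp
qed

lemma regular_q: "regular_fun 1 (\<lambda>q s. q)"
  using regular_poly[of "[:0, 1:]" 1] by simp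

lemma regular_cP: "regular_fun 2 (\<lambda>q s. poly cP q)"
  by (intro regular_poly) (simp add: cP_def)

lemma regular_tt: "regular_fun 2 (\<lambda>q s. tt q s)"
  using regular_scale[OF regular_diff[OF regular_scale[OF regular_s, of r]
      regular_scale[OF regular_cP, of z]], of "1 / K"] by (simp add: tt_def)

lemma regular_kk: "regular_fun 2 (\<lambda>q s. kk q s)"
  using regular_scale[OF regular_diff[OF regular_scale[OF regular_s, of z]
      regular_scale[OF regular_cP, of r]], of "1 / K"] by (simp add: kk_def)

lemma regular_nvec: "regular_fun 2 (\<lambda>q s. nvec q s $ i)"
proof -
  have "\<forall>i. regular_fun 2 (\<lambda>q s. nvec q s $ i)"
    unfolding forall_3 nvec_def vector_3 by (intro conjI regular_uu regular_vv regular_tt)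
  then show ?thesis ..
qed

lemma regular_width: "regular_fun 2 (\<lambda>q s. R * kk q s + r * q)"
  by (intro regular_add regular_scale regular_kk regular_fun_mono[OF regular_q]) simp

lemma regular_q_kk: "regular_fun 4 (\<lambda>q s. q * kk q s)"
  by (rule regular_fun_mono[OF regular_mult[OF regular_q regular_kk]]) simp

lemma regular_contour: "regular_fun 4 (\<lambda>q s. contour q s $ i)"
proof -
  have 1: "regular_fun 4 (\<lambda>q s. (R * kk q s + r * q) * uu q - q * kk q s * k)" for k
    using regular_diff[OF regular_mult[OF regular_width regular_uu, simplified] regular_scale[OF regular_q_kk, of k]]
    by (simp add: mult_ac)
  have 2: "regular_fun 4 (\<lambda>q s. (R * kk q s + r * q) * vv q - q * kk q s * k)" for k
    using regular_diff[OF regular_mult[OF regular_width regular_vv, simplified] regular_scale[OF regular_q_kk, of k]]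
    by (simp add: mult_ac)
  have "regular_fun 4 (\<lambda>q s. q * tt q s)"
    by (rule regular_fun_mono[OF regular_mult[OF regular_q regular_tt]]) simp
  from regular_diff[OF regular_scale[OF this, of r] regular_scale[OF regular_q_kk, of z]]
  have 3: "regular_fun 4 (\<lambda>q s. r * q * tt q s - q * kk q s * z)" by (simp add: mult_ac)
  have "\<forall>i. regular_fun 4 (\<lambda>q s. contour q s $ i)"
    unfolding forall_3 contour_def vector_3 using 1 2 3 by blast
  then show ?thesis ..
qed

text \<open>At the point \<open>(0, al)\<close> of the curve most expressions collapse, so it serves as a witness that functions
  do not vanish identically.\<close>

lemma on_curve_0: "on_curve 0 al"
  by (simp add: on_curve_def poly_DP poly_cP)

lemma kk_0: "kk 0 al \<noteq> 0"
proof -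
  have "kk 0 al = (z - r) * al / K" by (simp add: kk_def poly_cP algebra_simps)
  moreover have "z \<noteq> r" using zr by auto
  ultimately show ?thesis using K0 al0 by simp
qed

text \<open>Derivatives along the curve with respect to \<open>q\<close>, multiplied by \<open>2 * s\<close> to remove the denominator of
  \<open>s' = D' / (2 s)\<close>.\<close>

definition tt1 where
  "tt1 q s = (r * poly (pderiv DP) q - z * (2 * be * q - R) * (2 * s)) / K"
definition kk1 where
  "kk1 q s = (z * poly (pderiv DP) q - r * (2 * be * q - R) * (2 * s)) / K"

definition contour1 :: "complex \<Rightarrow> complex \<Rightarrow> complex ^ 3" where
  "contour1 q s = vector [
     (R * kk1 q s + 2 * s * r) * uu q + (R * kk q s + r * q) * (2 * s * q) - (2 * s * kk q s + q * kk1 q s) * x,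
     (R * kk1 q s + 2 * s * r) * vv q + (R * kk q s + r * q) * (2 * s * (\<i> * q)) - (2 * s * kk q s + q * kk1 q s) * y,
     r * (2 * s * tt q s + q * tt1 q s) - (2 * s * kk q s + q * kk1 q s) * z]"

lemma kk1_tt1: "kk q s * kk1 q s = 2 * s * q + tt q s * tt1 q s"
proof -
  define c where "c = poly cP q"
  define c' where "c' = 2 * be * q - R"
  define d where "d = poly (pderiv DP) q"
  have d: "d = 2 * c * c' + 2 * K * q" unfolding d_def c_def c'_def by (rule poly_pderiv_DP)
  have "(z * s - r * c) * (z * d - r * c' * (2 * s)) - (r * s - z * c) * (r * d - z * c' * (2 * s))
      = K * K * (2 * s * q)"
    unfolding d K_def by algebra
  then have "(K * kk q s) * (K * kk1 q s) - (K * tt q s) * (K * tt1 q s) = K * K * (2 * s * q)"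
    using K0 by (simp add: kk_def kk1_def tt_def tt1_def c_def c'_def d_def)
  then have "(K * K) * (kk q s * kk1 q s) = (K * K) * (2 * s * q + tt q s * tt1 q s)"
    by (simp add: algebra_simps)
  then show ?thesis using K0 by simp
qed

text \<open>The contour is the envelope of its tangent lines: the normal is orthogonal not only to the contour
  point but also to its velocity.\<close>

lemma nvec_contour1:
  assumes "on_curve q s"
  shows "nvec q s $ 1 * contour1 q s $ 1 + nvec q s $ 2 * contour1 q s $ 2 + nvec q s $ 3 * contour1 q s $ 3 = 0"
proof -
  have L: "x * uu q + y * vv q + z * tt q s = R * q + r * kk q s"
    using kk_tt_linear[of q s] cP_uu_vv[of q] by algebra
  have "uu q * (2 * s * q) + vv q * (2 * s * (\<i> * q)) = 2 * s * q"
    using uu_vv(1)[of q] by algebra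
  then show ?thesis
    unfolding nvec_def contour1_def vector_3
    using kk_tt_square[OF assms] L uu_vv(2)[of q] kk1_tt1[of q s] by algebra
qed

lemma branch_derivative:
  assumes "on_curve q s" "s \<noteq> 0"
  obtains \<sigma> where "\<sigma> q = s" "\<And>p. on_curve p (\<sigma> p)"
    "(\<sigma> has_field_derivative poly (pderiv DP) q / (2 * s)) (at q)"
proof -
  have D: "poly DP q = s^2" "poly DP q \<noteq> 0" using assms by (auto simp: on_curve_def)
  define \<sigma> where "\<sigma> = (\<lambda>p. s * csqrt (poly DP p / poly DP q))"
  show ?thesis
  proof
    show "\<sigma> q = s" using D by (simp add: \<sigma>_def)
    show "on_curve p (\<sigma> p)" for p
      using D by (simp add: \<sigma>_def on_curve_def power_mult_distrib)
    have "((\<lambda>p. csqrt (poly DP p / poly DP q)) has_field_derivative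
        inverse (2 * csqrt (poly DP q / poly DP q)) * (poly (pderiv DP) q / poly DP q)) (at q)"
      by (rule DERIV_chain2[OF has_field_derivative_csqrt DERIV_cdivide[OF poly_DERIV]])
         (use D in \<open>simp add: complex_nonpos_Reals_iff\<close>)
    from DERIV_cmult[OF this, of s]
    have "(\<sigma> has_field_derivative s * (inverse 2 * (poly (pderiv DP) q / (s * s)))) (at q)"
      unfolding \<sigma>_def using D assms(2) by (simp add: power2_eq_square)
    moreover have "s * (inverse 2 * (poly (pderiv DP) q / (s * s))) = poly (pderiv DP) q / (2 * s)"
      using assms(2) by (simp add: field_simps)
    ultimately show "(\<sigma> has_field_derivative poly (pderiv DP) q / (2 * s)) (at q)" by simp
  qed
qed

lemma gradient_orthogonal_contour1:
  assumes "is_form d f" "gradient_of f G" "vanishes (\<lambda>q s. f (contour q s))" "on_curve q s" "s \<noteq> 0"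
  shows "(\<Sum>i\<in>UNIV. G i (contour q s) * contour1 q s $ i) = 0"
proof -
  obtain \<sigma> where \<sigma>: "\<sigma> q = s" "\<And>p. on_curve p (\<sigma> p)"
    "(\<sigma> has_field_derivative poly (pderiv DP) q / (2 * s)) (at q)"
    using branch_derivative[OF assms(4,5)] by blast
  define d' where "d' = poly (pderiv DP) q"
  have cD: "((\<lambda>p. poly cP p) has_field_derivative (2 * be * q - R)) (at q)"
    using poly_DERIV[of cP q] by (simp add: poly_pderiv_cP)
  have tD: "((\<lambda>p. tt p (\<sigma> p)) has_field_derivative tt1 q s / (2 * s)) (at q)"
    unfolding tt_def
    by (rule DERIV_cong, (rule derivative_intros \<sigma>(3) cD K0)+)
       (use assms(5) K0 in \<open>simp add: tt1_def field_simps\<close>)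
  have kD: "((\<lambda>p. kk p (\<sigma> p)) has_field_derivative kk1 q s / (2 * s)) (at q)"
    unfolding kk_def
    by (rule DERIV_cong, (rule derivative_intros \<sigma>(3) cD K0)+)
       (use assms(5) K0 in \<open>simp add: kk1_def field_simps\<close>)
  have uD: "(uu has_field_derivative q) (at q)"
    unfolding uu_def[abs_def] by (auto intro!: derivative_eq_intros)
  have vD: "(vv has_field_derivative \<i> * q) (at q)"
    unfolding vv_def[abs_def] by (auto intro!: derivative_eq_intros)
  let ?\<gamma>' = "\<chi> i. contour1 q s $ i / (2 * s)"
  have "\<forall>i. ((\<lambda>p. contour p (\<sigma> p) $ i) has_field_derivative ?\<gamma>' $ i) (at q)"
    unfolding forall_3 contour_def vector_3 vec_lambda_beta contour1_def
  proof (intro conjI)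
    show "((\<lambda>p. (R * kk p (\<sigma> p) + r * p) * uu p - p * kk p (\<sigma> p) * x) has_field_derivative
       ((R * kk1 q s + 2 * s * r) * uu q + (R * kk q s + r * q) * (2 * s * q) - (2 * s * kk q s + q * kk1 q s) * x) / (2 * s)) (at q)"
      by (rule DERIV_cong, (rule derivative_intros kD uD)+)
         (use assms(5) \<sigma>(1) in \<open>simp add: field_simps\<close>)
    show "((\<lambda>p. (R * kk p (\<sigma> p) + r * p) * vv p - p * kk p (\<sigma> p) * y) has_field_derivative
       ((R * kk1 q s + 2 * s * r) * vv q + (R * kk q s + r * q) * (2 * s * (\<i> * q)) - (2 * s * kk q s + q * kk1 q s) * y) / (2 * s)) (at q)"
      by (rule DERIV_cong, (rule derivative_intros kD vD)+)
         (use assms(5) \<sigma>(1) in \<open>simp add: field_simps\<close>)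
    show "((\<lambda>p. r * p * tt p (\<sigma> p) - p * kk p (\<sigma> p) * z) has_field_derivative
       (r * (2 * s * tt q s + q * tt1 q s) - (2 * s * kk q s + q * kk1 q s) * z) / (2 * s)) (at q)"
      by (rule DERIV_cong, (rule derivative_intros kD tD)+)
         (use assms(5) \<sigma>(1) in \<open>simp add: field_simps\<close>)
  qed
  then have "((\<lambda>p. f (contour p (\<sigma> p))) has_field_derivative
      (\<Sum>i\<in>UNIV. G i (contour q (\<sigma> q)) * ?\<gamma>' $ i)) (at q)"
    by (intro gradient_ofD[OF assms(2)]) blast
  moreover have "(\<lambda>p. f (contour p (\<sigma> p))) = (\<lambda>p. 0)"
    using assms(3) \<sigma>(2) by (auto simp: vanishes_def)
  ultimately have "((\<lambda>p. 0) has_field_derivative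
      (\<Sum>i\<in>UNIV. G i (contour q (\<sigma> q)) * ?\<gamma>' $ i)) (at q)" by simp
  then have "(\<Sum>i\<in>UNIV. G i (contour q (\<sigma> q)) * ?\<gamma>' $ i) = 0"
    by (rule DERIV_unique[OF _ DERIV_const])
  then have "(\<Sum>i\<in>UNIV. G i (contour q s) * ?\<gamma>' $ i) = 0"
    unfolding \<sigma>(1) .
  then show ?thesis using assms(5) by (simp add: sum_divide_distrib[symmetric])
qed

text \<open>Two vectors orthogonal to the same two independent vectors are parallel; the factor is read off
  from the normalisation \<open>n1 + \<i> n2 = 1\<close>.\<close>

lemma parallel_of_orthogonal:
  fixes g1 g2 g3 n1 n2 n3 d1 d2 d3 e1 e2 e3 :: complex
  assumes "g1 * d1 + g2 * d2 + g3 * d3 = 0" "g1 * e1 + g2 * e2 + g3 * e3 = 0"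
    and "n1 * d1 + n2 * d2 + n3 * d3 = 0" "n1 * e1 + n2 * e2 + n3 * e3 = 0"
    and w: "d1 * e2 - d2 * e1 \<noteq> 0" and n: "n1 + \<i> * n2 = 1"
  shows "g1 = (g1 + \<i> * g2) * n1" "g2 = (g1 + \<i> * g2) * n2" "g3 = (g1 + \<i> * g2) * n3"
proof -
  let ?w = "d1 * e2 - d2 * e1"
  have *: "?w * (g1 * n3 - g3 * n1) = 0" "?w * (g2 * n3 - g3 * n2) = 0"
    using assms(1-4) by algebra+
  have g1: "?w * g1 = - g3 * (d3 * e2 - e3 * d2)" and n1: "?w * n1 = - n3 * (d3 * e2 - e3 * d2)"
    and g2: "?w * g2 = - g3 * (d1 * e3 - e1 * d3)" and n2: "?w * n2 = - n3 * (d1 * e3 - e1 * d3)"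
    using assms(1-4) by algebra+
  have "?w * ?w * (g1 * n2 - g2 * n1) = (?w * g1) * (?w * n2) - (?w * g2) * (?w * n1)"
    by (simp add: algebra_simps)
  also have "\<dots> = 0" unfolding g1 g2 n1 n2 by (simp add: algebra_simps)
  finally have 12: "g1 * n2 = g2 * n1" using w by simp
  have 13: "g1 * n3 = g3 * n1" and 23: "g2 * n3 = g3 * n2" using * w by simp_all
  show "g1 = (g1 + \<i> * g2) * n1" "g2 = (g1 + \<i> * g2) * n2" "g3 = (g1 + \<i> * g2) * n3"
    using n 12 13 23 by algebra+
qed

lemma contour1_independent_0: "contour 0 al $ 1 * contour1 0 al $ 2 - contour 0 al $ 2 * contour1 0 al $ 1 \<noteq> 0"
proof -
  have "contour 0 al $ 1 * contour1 0 al $ 2 - contour 0 al $ 2 * contour1 0 al $ 1 = - 2 * \<i> * R * (al * kk 0 al)^2"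
    unfolding contour_def contour1_def vector_3 uu_def vv_def al_def
    by (simp add: field_simps power2_eq_square)
  then show ?thesis using R0 al0 kk_0 by simp
qed

text \<open>Biduality: both the gradient of a form vanishing along the contour and the normal are
  orthogonal to the contour point and to its velocity. These two are independent at some point of the curve,
  and the conclusion is a polynomial identity on the curve, so it extends to all of it.\<close>

lemma gradient_is_normal:
  assumes "is_form d f" "gradient_of f G" "\<And>i. is_form e (G i)"
    "vanishes (\<lambda>q s. f (contour q s))" "on_curve q s"
  shows "G i (contour q s) = (G 1 (contour q s) + \<i> * G 2 (contour q s)) * nvec q s $ i"
proof -
  define w where "w = (\<lambda>q s. contour q s $ 1 * contour1 q s $ 2 - contour q s $ 2 * contour1 q s $ 1)"
  define h where "h = (\<lambda>i q s. G i (contour q s) - (G 1 (contour q s) + \<i> * G 2 (contour q s)) * nvec q s $ i)"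
  have G: "regular_fun (e * 4 + 2) (\<lambda>q s. G i (contour q s))" for i
    by (rule regular_fun_mono[OF regular_form[OF assms(3) regular_contour]]) simp
  have "regular_fun (e * 4) (\<lambda>q s. G 1 (contour q s) + \<i> * G 2 (contour q s))"
    by (intro regular_add regular_scale regular_form[OF assms(3) regular_contour])
  then have h: "regular_fun (e * 4 + 2) (h i)" for i
    unfolding h_def by (intro regular_diff regular_mult G regular_nvec)
  have tt1: "regular_fun 3 (\<lambda>q s. tt1 q s)" and kk1: "regular_fun 3 (\<lambda>q s. kk1 q s)"
  proof -
    have 1: "regular_fun 3 (\<lambda>q s. poly (pderiv DP) q)"
      using degree_DP by (intro regular_poly) (simp add: degree_pderiv)
    have "degree [:-R, 2 * be:] \<le> 1" by simp
    from regular_mult[OF regular_poly[OF this] regular_s]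
    have 2: "regular_fun 3 (\<lambda>q s. (2 * be * q - R) * s)"
      by (simp add: algebra_simps numeral_3_eq_3)
    show "regular_fun 3 (\<lambda>q s. tt1 q s)"
      using regular_scale[OF regular_diff[OF regular_scale[OF 1, of r] regular_scale[OF 2, of "2 * z"]], of "1 / K"]
      by (simp add: tt1_def algebra_simps add_divide_distrib diff_divide_distrib)
    show "regular_fun 3 (\<lambda>q s. kk1 q s)"
      using regular_scale[OF regular_diff[OF regular_scale[OF 1, of z] regular_scale[OF 2, of "2 * r"]], of "1 / K"]
      by (simp add: kk1_def algebra_simps add_divide_distrib diff_divide_distrib)
  qed
  have sq: "regular_fun 3 (\<lambda>q s. s * q)" and sk: "regular_fun 4 (\<lambda>q s. s * kk q s)"
    and qk: "regular_fun 4 (\<lambda>q s. q * kk1 q s)"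
    using regular_mult[OF regular_s regular_q] regular_mult[OF regular_s regular_kk]
      regular_mult[OF regular_q kk1] by simp_all
  have wd: "regular_fun 5 (\<lambda>q s. (R * kk1 q s + 2 * s * r) * g q + (R * kk q s + r * q) * (2 * s * (k * q))
      - (2 * s * kk q s + q * kk1 q s) * l)" if "regular_fun 2 (\<lambda>q s. g q)" for g k l
  proof -
    have 1: "regular_fun 3 (\<lambda>q s. R * kk1 q s + (2 * r) * s)"
      by (intro regular_add regular_scale kk1 regular_fun_mono[OF regular_s]) simp
    have 2: "regular_fun 5 (\<lambda>q s. (R * kk1 q s + (2 * r) * s) * g q)"
      using regular_mult[OF 1 that] by simp
    have 3: "regular_fun 5 (\<lambda>q s. (2 * k) * ((R * kk q s + r * q) * (s * q)))"
      using regular_scale[OF regular_mult[OF regular_width sq], of "2 * k"] by simp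
    have 4: "regular_fun 5 (\<lambda>q s. l * (2 * (s * kk q s) + q * kk1 q s))"
      by (intro regular_scale regular_add regular_fun_mono[OF sk] regular_fun_mono[OF qk]) simp_all
    from regular_diff[OF regular_add[OF 2 3] 4] show ?thesis by (simp add: mult_ac)
  qed
  have d1: "regular_fun 5 (\<lambda>q s. contour1 q s $ 1)" and d2: "regular_fun 5 (\<lambda>q s. contour1 q s $ 2)"
    using wd[OF regular_uu, of 1 x] wd[OF regular_vv, of \<i> y]
    by (simp_all add: contour1_def vector_3)
  have w: "regular_fun (4 + 5) w"
    unfolding w_def by (intro regular_diff regular_mult regular_contour d1 d2)
  have "vanishes (\<lambda>q s. h i q s * (w q s * s))" for i
    unfolding vanishes_def
  proof (intro allI impI)
    fix q s assume c: "on_curve q s"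
    show "h i q s * (w q s * s) = 0"
    proof (cases "s = 0 \<or> w q s = 0")
      case False
      then have s: "s \<noteq> 0" and w0: "w q s \<noteq> 0" by auto
      have f0: "f (contour q s) = 0" using assms(4) c by (simp add: vanishes_def)
      have 1: "G 1 (contour q s) * contour q s $ 1 + G 2 (contour q s) * contour q s $ 2 + G 3 (contour q s) * contour q s $ 3 = 0"
        using euler_form[OF assms(1,2), of "contour q s"] f0 by (simp add: sum_3)
      have 2: "G 1 (contour q s) * contour1 q s $ 1 + G 2 (contour q s) * contour1 q s $ 2 + G 3 (contour q s) * contour1 q s $ 3 = 0"
        using gradient_orthogonal_contour1[OF assms(1,2,4) c s] by (simp add: sum_3)
      have n: "nvec q s $ 1 + \<i> * nvec q s $ 2 = 1" by (simp add: nvec_def vector_3 uu_vv)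
      note * = parallel_of_orthogonal[OF 1 2 nvec_contour[OF c] nvec_contour1[OF c] w0[unfolded w_def] n]
      have "\<forall>i. h i q s = 0"
        unfolding forall_3 h_def by (intro conjI eq_iff_diff_eq_0[THEN iffD1] *)
      then show ?thesis by simp
    qed auto
  qed
  moreover have "\<not> vanishes (\<lambda>q s. w q s * s)"
  proof
    assume "vanishes (\<lambda>q s. w q s * s)"
    then have "w 0 al * al = 0" using on_curve_0 by (simp add: vanishes_def)
    then show False using contour1_independent_0 al0 by (simp add: w_def)
  qed
  ultimately have "vanishes (h i)"
    using vanishes_mult[OF h[of i] regular_mult[OF w regular_s]] by blast
  then have "h i q s = 0" using assms(5) by (simp add: vanishes_def)
  then show ?thesis unfolding h_def by simp
qed

end

section \<open>The dual quartic\<close>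

context torus_view
begin

text \<open>The plane with normal \<open>n\<close> through the center has the equation \<open>n \<bullet> p = offset n\<close>. The quartic below is
  the section of the dual surface of the torus by the planes through the center.\<close>

definition offset :: "complex ^ 3 \<Rightarrow> complex" where
  "offset n = x * n $ 1 + y * n $ 2 + z * n $ 3"

definition quadA :: "complex ^ 3 \<Rightarrow> complex" where
  "quadA n = (R^2 - r\<^sup>2) * ((n $ 1)^2 + (n $ 2)^2) - r\<^sup>2 * (n $ 3)^2 + (offset n)^2"

definition quartic :: "complex ^ 3 \<Rightarrow> complex" where
  "quartic n = (quadA n)^2 - 4 * R^2 * ((n $ 1)^2 + (n $ 2)^2) * (offset n)^2"

lemma offset_nvec: "offset (nvec q s) = R * q + r * kk q s"
  unfolding offset_def nvec_def vector_3
  using kk_tt_linear[of q s] cP_uu_vv[of q] by algebra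

lemma quartic_nvec:
  assumes "on_curve q s"
  shows "quartic (nvec q s) = 0"
  unfolding quartic_def quadA_def offset_nvec
  unfolding nvec_def vector_3
  using uu_vv(2)[of q] kk_tt_square[OF assms] by algebra

lemma is_form_offset: "is_form 1 offset"
  unfolding offset_def[abs_def]
  by (intro is_form_add is_form_scale is_form_coord)

lemma is_form_quadA: "is_form 2 quadA"
proof -
  have "is_form 2 (\<lambda>n. (offset n)^2)" using is_form_power[OF is_form_offset, of 2] by simp
  with is_form_coord_square show ?thesis unfolding quadA_def[abs_def]
    by (intro is_form_add is_form_diff is_form_scale)
qed

lemma is_form_quartic: "is_form 4 quartic"
proof -
  have o: "is_form 2 (\<lambda>n. (offset n)^2)" using is_form_power[OF is_form_offset, of 2] by simp
  have "is_form 4 (\<lambda>n. (quadA n)^2)" using is_form_power[OF is_form_quadA, of 2] by simp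
  moreover have "is_form (2 + 2) (\<lambda>n. 4 * R^2 * ((n $ 1)^2 + (n $ 2)^2) * (offset n)^2)"
    by (intro is_form_mult is_form_add is_form_scale is_form_coord_square o)
  ultimately show ?thesis unfolding quartic_def[abs_def] by (intro is_form_diff) simp_all
qed

lemma quartic_e3: "quartic (vector [0, 0, 1]) \<noteq> 0"
proof -
  have "quartic (vector [0, 0, 1]) = K^2"
    by (simp add: quartic_def quadA_def offset_def K_def vector_3 algebra_simps)
  then show ?thesis using K0 by simp
qed

text \<open>The values \<open>q\<close> and \<open>- q\<close> give the same line through \<open>u = v = 0\<close>. A coincidence between the two pairs
  happens only at a node, which the last hypothesis excludes.\<close>

lemma four_points:
  assumes "on_curve q s" "on_curve (- q) s'" "q \<noteq> 0" "s \<noteq> 0" "s' \<noteq> 0"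
    and "z^2 * (R^2 - r\<^sup>2) * q^2 \<noteq> r^2 * (al + be * q^2)^2"
  shows "card {tt q s, tt q (- s), tt (- q) s', tt (- q) (- s')} = 4"
proof -
  have sep: "tt p \<sigma> \<noteq> tt p (- \<sigma>)" if "\<sigma> \<noteq> 0" for p \<sigma>
  proof
    assume "tt p \<sigma> = tt p (- \<sigma>)"
    then have "r * \<sigma> = 0" using K0 by (auto simp: tt_def)
    then show False using that r0 by simp
  qed
  have sheets: "tt q \<sigma> \<noteq> tt (- q) \<sigma>'" if "on_curve q \<sigma>" "on_curve (- q) \<sigma>'" for \<sigma> \<sigma>'
  proof
    assume eq: "tt q \<sigma> = tt (- q) \<sigma>'"
    have "(kk q \<sigma>)^2 = (kk (- q) \<sigma>')^2"
      using kk_tt_square[OF that(1)] kk_tt_square[OF that(2)] eq by simp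
    then consider "kk q \<sigma> = kk (- q) \<sigma>'" | "kk q \<sigma> = - kk (- q) \<sigma>'"
      by (auto simp: power2_eq_iff)
    then show False
    proof cases
      case 1
      then have "poly cP q = poly cP (- q)"
        using kk_tt_linear[of q \<sigma>] kk_tt_linear[of "- q" \<sigma>'] eq by simp
      then have "2 * (R * q) = 0" by (simp add: poly_cP)
      then show False using R0 assms(3) by simp
    next
      case 2
      have c: "poly cP q = al - R * q + be * q^2" "poly cP (- q) = al + R * q + be * q^2"
        by (simp_all add: poly_cP)
      have e: "r * kk q \<sigma> = - R * q" "z * tt q \<sigma> = - (al + be * q^2)"
        using kk_tt_linear[of q \<sigma>] kk_tt_linear[of "- q" \<sigma>'] eq 2 unfolding c by algebra+
      have "z^2 * (r * kk q \<sigma>)^2 = r^2 * (z^2 * q^2 + (z * tt q \<sigma>)^2)"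
        using kk_tt_square[OF that(1)] by algebra
      then have "z^2 * (R^2 - r\<^sup>2) * q^2 = r^2 * (al + be * q^2)^2"
        unfolding e by algebra
      then show False using assms(6) by simp
    qed
  qed
  have "tt q s \<noteq> tt q (- s)" "tt (- q) s' \<noteq> tt (- q) (- s')" using sep assms by auto
  moreover have "tt q \<sigma> \<noteq> tt (- q) \<sigma>'" if "\<sigma> \<in> {s, - s}" "\<sigma>' \<in> {s', - s'}" for \<sigma> \<sigma>'
    using sheets that assms on_curve_uminus by blast
  ultimately show ?thesis by simp
qed

text \<open>On almost every line through \<open>u = v = 0\<close> the form is a polynomial in \<open>t\<close> of degree at most three with
  four zeros. This identifies the ideal of the dual curve in low degree without a Nullstellensatz.\<close>

lemma low_form_vanishing:
  assumes f: "is_form d f" and d: "d < 4 \<or> d = 4 \<and> f (vector [0, 0, 1]) = 0"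
    and van: "vanishes (\<lambda>q s. f (nvec q s))"
  shows "f v = 0"
proof -
  \<comment> \<open>The factors exclude the values of \<open>q\<close> for which two of the four zeros coincide.\<close>
  define E where "E = (\<lambda>q. poly [:0, 1:] q * (poly DP q * (poly DP (- q) *
      (z^2 * (R^2 - r\<^sup>2) * q^2 - r\<^sup>2 * (al + be * q^2)^2))))"
  have fiber: "f (vector [uu q, vv q, t]) = 0" if "E q \<noteq> 0" for q t
  proof -
    obtain p where p: "degree p \<le> d" "coeff p d = f (vector [0,0,1])"
      "\<And>t. f (vector [uu q, vv q, t]) = poly p t"
      using form_restricted_to_line[OF f] by blast
    have p4: "degree p < 4"
    proof (cases "d = 4")
      case True
      then have "coeff p 4 = 0" using d p by simp
      then have "degree p \<noteq> 4" using True
        by (metis d degree_0 less_irrefl_nat leading_coeff_0_iff zero_neq_numeral)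
      then show ?thesis using p(1) True by linarith
    qed (use p(1) d in linarith)
    define s where "s = csqrt (poly DP q)"
    define s' where "s' = csqrt (poly DP (- q))"
    have c: "on_curve q s" "on_curve (- q) s'" unfolding s_def s'_def by (rule on_curve_csqrt)+
    let ?T = "{tt q s, tt q (- s), tt (- q) s', tt (- q) (- s')}"
    have "card ?T = 4"
      using that by (intro four_points c) (auto simp: E_def s_def s'_def)
    have u: "uu (- q) = uu q" "vv (- q) = vv q" by (simp_all add: uu_def vv_def)
    have "poly p (tt q \<sigma>) = 0" if "on_curve q \<sigma>" for \<sigma>
      using van that unfolding p(3)[symmetric] nvec_def vanishes_def by blast
    moreover have "poly p (tt (- q) \<sigma>) = 0" if "on_curve (- q) \<sigma>" for \<sigma>
      using van that unfolding p(3)[symmetric] nvec_def vanishes_def using u by metis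
    ultimately have T: "?T \<subseteq> {t. poly p t = 0}"
      using c on_curve_uminus by auto
    have "p = 0"
    proof (rule ccontr)
      assume "p \<noteq> 0"
      then have "card ?T \<le> card {t. poly p t = 0}" by (intro card_mono poly_roots_finite T)
      then show False
        using card_poly_roots_bound[OF \<open>p \<noteq> 0\<close>] p4 \<open>card ?T = 4\<close> by linarith
    qed
    then show ?thesis by (simp add: p(3))
  qed
  have every: "f (vector [uu q, vv q, t]) = 0" for q t
  proof -
    have "regular_fun 2 (\<lambda>q s. vector [uu q, vv q, t] $ i)" for i :: 3
    proof -
      have "\<forall>i::3. regular_fun 2 (\<lambda>q s. vector [uu q, vv q, t] $ i)"
        unfolding forall_3 vector_3
        by (intro conjI regular_uu regular_vv regular_fun_mono[OF regular_const]) simp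
      then show ?thesis ..
    qed
    from regular_form[OF f this]
    have g: "regular_fun (d * 2) (\<lambda>q s. f (vector [uu q, vv q, t]))" by simp
    define p3 where "p3 = smult (z^2 * (R^2 - r\<^sup>2)) [:0, 0, 1:] - smult (r^2) ([:al, 0, be:]^2)"
    define EP where "EP = [:0, 1:] * (DP * ((DP \<circ>\<^sub>p [:0, - 1:]) * p3))"
    have E: "E q = poly EP q" for q
      unfolding E_def EP_def p3_def
      by (simp add: poly_pcompose power2_eq_square algebra_simps)
    have "vanishes (\<lambda>q s. f (vector [uu q, vv q, t]) * poly EP q)"
      using fiber E by (auto simp: vanishes_def)
    then have "vanishes (\<lambda>q s. f (vector [uu q, vv q, t])) \<or> vanishes (\<lambda>q s. poly EP q)"
      by (rule vanishes_mult[OF g regular_poly[OF order_refl]])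
    moreover have "\<not> vanishes (\<lambda>q s. poly EP q)"
    proof
      assume "vanishes (\<lambda>q s. poly EP q)"
      then have "poly EP q = 0" for q using on_curve_csqrt unfolding vanishes_def by blast
      then have "EP = 0" using poly_all_0_iff_0[of EP] by simp
      moreover have "DP \<noteq> 0" by (rule D0)
      moreover have "DP \<circ>\<^sub>p [:0, - 1:] \<noteq> 0"
      proof
        assume "DP \<circ>\<^sub>p [:0, - 1:] = 0"
        then have "poly (DP \<circ>\<^sub>p [:0, - 1:]) 0 = 0" by simp
        then show False using al0 by (simp add: poly_pcompose poly_DP poly_cP)
      qed
      moreover have "p3 \<noteq> 0"
      proof
        assume "p3 = 0"
        then have "poly p3 0 = 0" by simp
        then show False using al0 r0 by (simp add: p3_def power2_eq_square)
      qed
      ultimately show False unfolding EP_def by (simp only: mult_eq_0_iff) simp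
    qed
    ultimately show ?thesis using on_curve_csqrt unfolding vanishes_def by blast
  qed
  have generic: "f (vector [u, w, t]) = 0" if "u + \<i> * w \<noteq> 0" for u w t
  proof -
    define k where "k = u + \<i> * w"
    define q where "q = csqrt ((u - \<i> * w) / k)"
    have q2: "q^2 = (u - \<i> * w) / k" by (simp add: q_def)
    have kq: "k * q^2 = u - \<i> * w" using that by (simp add: q2 k_def)
    have ii: "\<i> * \<i> = -1" by simp
    have u2: "2 * uu q = 1 + q^2" "2 * vv q = \<i> * (q^2 - 1)" by (simp_all add: uu_def vv_def)
    have "2 * u = 2 * (k * uu q)" "2 * w = 2 * (k * vv q)"
      using kq k_def ii u2 by algebra+
    then have uw: "k * uu q = u" "k * vv q = w" by simp_all
    have "k \<noteq> 0" using that by (simp add: k_def)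
    then have "(vector [u, w, t] :: complex ^ 3) = k *s vector [uu q, vv q, t / k]"
      by (simp add: vec_eq_iff forall_3 vector_3 uw)
    then show ?thesis using form_homogeneous[OF f, of k] every by simp
  qed
  have all: "f (vector [u, w, t]) = 0" for u w t
  proof (cases "u + \<i> * w = 0")
    case True
    have off: "f (vector [u + e, w, t]) = 0" if "e \<noteq> 0" for e
    proof (rule generic)
      have "u + e + \<i> * w = e" using True by algebra
      then show "u + e + \<i> * w \<noteq> 0" using that by (simp only:) simp
    qed
    have "((\<lambda>e. vector [u + e, w, t] :: complex ^ 3) \<longlongrightarrow> vector [u, w, t]) (at 0)"
    proof (rule vec_tendstoI)
      have "((\<lambda>e. u + e) \<longlongrightarrow> u + 0) (at 0)" by (intro tendsto_intros)
      then have "\<forall>i::3. ((\<lambda>e. vector [u + e, w, t] $ i) \<longlongrightarrow> vector [u, w, t] $ i) (at 0)"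
        unfolding forall_3 vector_3 by simp
      then show "((\<lambda>e. vector [u + e, w, t] $ i) \<longlongrightarrow> vector [u, w, t] $ i) (at 0)" for i :: 3 ..
    qed
    then have "((\<lambda>e. f (vector [u + e, w, t])) \<longlongrightarrow> f (vector [u, w, t])) (at 0)"
      by (rule continuous_on_tendsto_compose[OF form_continuous[OF f, of UNIV]]) simp_all
    moreover have "((\<lambda>e. f (vector [u + e, w, t])) \<longlongrightarrow> 0) (at 0)"
      by (rule tendsto_eventually) (simp add: eventually_at_filter off)
    ultimately show ?thesis using tendsto_unique[OF at_neq_bot] by blast
  qed (rule generic)
  have "v = vector [v $ 1, v $ 2, v $ 3]" by (simp add: vec_eq_iff forall_3 vector_3)
  then show ?thesis using all by metis
qed

text \<open>At a singular point off \<open>L = 0\<close> the tangent plane would touch the torus at the center itself, which is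
  not on the torus. So the two nodes on \<open>L = 0\<close> are the only singular points.\<close>

lemma quartic_singular:
  assumes F: "quartic n = 0" and dF: "\<And>h. ((\<lambda>\<tau>. quartic (n + \<tau> *s h)) has_field_derivative 0) (at 0)"
  shows "offset n = 0 \<and> quadA n = 0 \<or> n = 0"
proof (cases "offset n = 0")
  case True
  then show ?thesis using F by (simp add: quartic_def)
next
  case L0: False
  define u v t where "u = n $ 1" and "v = n $ 2" and "t = n $ 3"
  define L where "L = offset n"
  define A where "A = quadA n"
  have L: "L = x * u + y * v + z * t" by (simp add: L_def offset_def u_def v_def t_def)
  have A: "A = (R^2 - r\<^sup>2) * (u^2 + v^2) - r\<^sup>2 * t^2 + L^2"
    by (simp add: A_def quadA_def L_def u_def v_def t_def)
  have F': "A^2 = 4 * R^2 * (u^2 + v^2) * L^2"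
    using F by (simp add: quartic_def A_def L_def u_def v_def)
  have dir: "2 * A * (2 * (R^2 - r\<^sup>2) * (u * h $ 1 + v * h $ 2) - 2 * r^2 * t * h $ 3 + 2 * L * offset h)
     - 8 * R^2 * (u * h $ 1 + v * h $ 2) * L^2 - 8 * R^2 * (u^2 + v^2) * L * offset h = 0" for h
  proof -
    define a b c l where "a = h $ 1" and "b = h $ 2" and "c = h $ 3" and "l = offset h"
    have off: "offset (n + \<tau> *s h) = L + \<tau> * l" for \<tau>
      by (simp add: L l_def offset_def u_def v_def t_def algebra_simps)
    have "((\<lambda>\<tau>. ((R^2 - r\<^sup>2) * ((u + \<tau> * a)^2 + (v + \<tau> * b)^2) - r\<^sup>2 * (t + \<tau> * c)^2 + (L + \<tau> * l)^2)^2
        - 4 * R^2 * ((u + \<tau> * a)^2 + (v + \<tau> * b)^2) * (L + \<tau> * l)^2) has_field_derivative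
      2 * A * (2 * (R^2 - r\<^sup>2) * (u * a + v * b) - 2 * r^2 * t * c + 2 * L * l)
     - 8 * R^2 * (u * a + v * b) * L^2 - 8 * R^2 * (u^2 + v^2) * L * l) (at 0)"
      by (rule DERIV_cong, (rule derivative_intros)+, simp add: A, algebra)
    then have "((\<lambda>\<tau>. quartic (n + \<tau> *s h)) has_field_derivative
      2 * A * (2 * (R^2 - r\<^sup>2) * (u * h $ 1 + v * h $ 2) - 2 * r^2 * t * h $ 3 + 2 * L * offset h)
     - 8 * R^2 * (u * h $ 1 + v * h $ 2) * L^2 - 8 * R^2 * (u^2 + v^2) * L * offset h) (at 0)"
      unfolding quartic_def quadA_def off
      by (simp add: a_def b_def c_def l_def u_def v_def t_def)
    then show ?thesis using dF DERIV_unique by blast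
  qed
  have 1: "A * ((R^2 - r\<^sup>2) * u + L * x) = 2 * R^2 * (u * L^2 + (u^2 + v^2) * L * x)"
    and 2: "A * ((R^2 - r\<^sup>2) * v + L * y) = 2 * R^2 * (v * L^2 + (u^2 + v^2) * L * y)"
    and 3: "A * (- r\<^sup>2 * t + L * z) = 2 * R^2 * ((u^2 + v^2) * L * z)"
    using dir[of "vector [1, 0, 0]"] dir[of "vector [0, 1, 0]"] dir[of "vector [0, 0, 1]"]
    unfolding offset_def vector_3 by algebra+
  show ?thesis
  proof (cases "A = 0")
    case True
    have uv: "u^2 + v^2 = 0" using F' True R0 L0 by (simp add: L_def)
    have "R^2 * L^2 * u = 0" "R^2 * L^2 * v = 0" using 1 2 True uv by auto
    then have "u = 0" "v = 0" using R0 L0 by (simp_all add: L_def)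
    moreover have "(z^2 - r\<^sup>2) * t^2 = 0" using A True calculation L by algebra
    ultimately have "n = 0" using zr
      by (simp add: vec_eq_iff forall_3 u_def v_def t_def)
    then show ?thesis by simp
  next
    case A0: False
    \<comment> \<open>The square root of \<open>u^2 + v^2\<close> for which \<open>A = 2 R p L\<close>.\<close>
    define p where "p = A / (2 * R * L)"
    have Ap: "A = 2 * R * p * L" using R0 L0 by (simp add: p_def L_def)
    have "(2 * R * L)^2 * p^2 = (2 * R * L)^2 * (u^2 + v^2)" using F' unfolding Ap by algebra
    then have p2: "p^2 = u^2 + v^2" using R0 L0 by (simp add: L_def)
    have p0: "p \<noteq> 0" using A0 Ap by auto
    let ?m = "L - R * p"
    have RL: "2 * R * L \<noteq> 0" using R0 L0 by (simp add: L_def)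
    have "2 * R * L * (p * ?m * x) = 2 * R * L * ((R * L - (R^2 - r\<^sup>2) * p) * u)"
      using 1 unfolding Ap p2[symmetric] by algebra
    then have x': "p * ?m * x = (R * L - (R^2 - r\<^sup>2) * p) * u" using RL by simp
    have "2 * R * L * (p * ?m * y) = 2 * R * L * ((R * L - (R^2 - r\<^sup>2) * p) * v)"
      using 2 unfolding Ap p2[symmetric] by algebra
    then have y': "p * ?m * y = (R * L - (R^2 - r\<^sup>2) * p) * v" using RL by simp
    have "2 * R * L * p * (?m * z) = 2 * R * L * p * (r^2 * t)"
      using 3 unfolding Ap p2[symmetric] by algebra
    then have z': "?m * z = r^2 * t" using RL p0 by simp
    have m2: "?m^2 = r^2 * (p^2 + t^2)" using A Ap p2 by algebra
    have m0: "?m \<noteq> 0"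
    proof
      assume m: "?m = 0"
      then have "t = 0" using z' r0 by simp
      then show False using m2 m p0 r0 by simp
    qed
    have e: "R * L - (R^2 - r\<^sup>2) * p = R * ?m + r^2 * p" by algebra
    have "p^2 * (?m^2 * (x^2 + y^2)) = p^2 * ((R * ?m + r^2 * p)^2)"
      using x' y' p2 unfolding e by algebra
    then have xy: "?m^2 * (x^2 + y^2) = (R * ?m + r^2 * p)^2" using p0 by simp
    have zz: "?m^2 * z^2 = r ^ 4 * t^2" using z' by algebra
    have "?m^2 * (x^2 + y^2 + z^2 + (R^2 - r\<^sup>2)) = 2 * R * ?m * (R * ?m + r^2 * p)"
      using xy zz m2 by algebra
    then have "(?m^2 * (x^2 + y^2 + z^2 + (R^2 - r\<^sup>2)))^2 = 4 * R^2 * ?m^2 * (?m^2 * (x^2 + y^2))"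
      unfolding xy by algebra
    then have "(?m^2)^2 * (x^2 + y^2 + z^2 + (R^2 - r\<^sup>2))^2 = (?m^2)^2 * (4 * R^2 * (x^2 + y^2))"
      by algebra
    then have False using m0 off_torus by simp
    then show ?thesis ..
  qed
qed

end

section \<open>Points, loci and cameras\<close>

lemma vector_4:
  "(vector [a, b, c, d] :: 'a::zero ^ 4) $ 1 = a" "(vector [a, b, c, d] :: 'a::zero ^ 4) $ 2 = b"
  "(vector [a, b, c, d] :: 'a::zero ^ 4) $ 3 = c" "(vector [a, b, c, d] :: 'a::zero ^ 4) $ 4 = d"
  unfolding vector_def by simp_all

lemma span_line:
  fixes v :: "complex ^ 'n::finite"
  assumes "v \<noteq> 0"
  shows "line (Point (vec.span {v})) = vec.span {v}"
  using assms by (intro Point_inverse) (simp add: vec.dim_eq_card_independent)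

lemma line_generator: "\<exists>v. v \<noteq> 0 \<and> line p = vec.span {v}"
proof -
  have L: "vec.subspace (line p)" "vec.dim (line p) = 1" using line[of p] by auto
  obtain B where B: "B \<subseteq> line p" "vec.independent B" "line p \<subseteq> vec.span B" "card B = vec.dim (line p)"
    by (rule vec.basis_exists)
  then obtain v where v: "B = {v}" using L(2) by (metis card_1_singletonE)
  have "v \<noteq> 0" using B(2) v vec.dependent_zero by blast
  moreover have "line p = vec.span {v}"
    using B L(1) v by (metis subset_antisym vec.span_minimal)
  ultimately show ?thesis by blast
qed

lemma line_eq_span:
  assumes "v \<in> line p" "v \<noteq> 0"
  shows "line p = vec.span {v}"
proof -
  obtain w where w: "w \<noteq> 0" "line p = vec.span {w}" using line_generator by blast
  then obtain k where k: "v = k *s w" using assms(1) by (auto simp: vec.span_singleton)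
  then have "k \<noteq> 0" using assms(2) by auto
  then have "w = inverse k *s v" by (simp add: k)
  then have "w \<in> vec.span {v}" unfolding vec.span_singleton by blast
  then have "vec.span {w} \<subseteq> vec.span {v}" by (intro vec.span_minimal) auto
  moreover have "vec.span {v} \<subseteq> vec.span {w}"
    using assms(1) w(2) by (intro vec.span_minimal) auto
  ultimately show ?thesis using w(2) by blast
qed

lemma in_zero_locus_iff:
  assumes "is_form d f" "v \<in> line p" "v \<noteq> 0"
  shows "p \<in> zero_locus {f} \<longleftrightarrow> f v = 0"
proof
  assume "f v = 0"
  then show "p \<in> zero_locus {f}"
    using form_homogeneous[OF assms(1)] line_eq_span[OF assms(2,3)]
    by (auto simp: zero_locus_def vec.span_singleton)
qed (use assms(2) in \<open>auto simp: zero_locus_def\<close>)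

lemma closure_subset_zero_locus:
  assumes "is_form d f"
  shows "zariski_closure X \<subseteq> zero_locus {f} \<longleftrightarrow> X \<subseteq> zero_locus {f}"
proof
  have "X \<subseteq> zariski_closure X" unfolding zariski_closure_def by blast
  then show "zariski_closure X \<subseteq> zero_locus {f} \<Longrightarrow> X \<subseteq> zero_locus {f}" by blast
  have "zariski_closed (zero_locus {f})" unfolding zariski_closed_def using assms by blast
  then show "X \<subseteq> zero_locus {f} \<Longrightarrow> zariski_closure X \<subseteq> zero_locus {f}"
    unfolding zariski_closure_def by blast
qed

text \<open>A hyperplane and a line outside it are complementary.\<close>

lemma dim_hyperplane_4:
  fixes N :: "complex ^ 4"
  assumes "N $ j \<noteq> 0"
  shows "vec.dim {u. (\<Sum>i\<in>UNIV. N $ i * u $ i) = 0} = 3"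
proof -
  let ?H = "{u. (\<Sum>i\<in>UNIV. N $ i * u $ i) = 0}"
  let ?e = "axis j 1 :: complex ^ 4"
  have e: "(\<Sum>i\<in>UNIV. N $ i * (k *s ?e) $ i) = k * N $ j" for k
  proof -
    have "(\<Sum>i\<in>UNIV. N $ i * (k *s ?e) $ i) = (\<Sum>i\<in>UNIV. if i = j then N $ i * k else 0)"
      by (intro sum.cong) (auto simp: axis_def)
    then show ?thesis by simp
  qed
  have H: "vec.subspace ?H"
    by (intro vec.subspaceI)
       (simp_all add: distrib_left sum.distrib mult.left_commute sum_distrib_left[symmetric])
  have "{a + c |a c. a \<in> ?H \<and> c \<in> vec.span {?e}} = UNIV"
  proof (intro subset_antisym subset_UNIV subsetI)
    fix u :: "complex ^ 4"
    define k where "k = (\<Sum>i\<in>UNIV. N $ i * u $ i) / N $ j"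
    have "(\<Sum>i\<in>UNIV. N $ i * (u - k *s ?e) $ i) = (\<Sum>i\<in>UNIV. N $ i * u $ i) - k * N $ j"
      using e[of k] by (simp add: right_diff_distrib sum_subtractf)
    then have "u - k *s ?e \<in> ?H" using assms by (simp add: k_def)
    moreover have "k *s ?e \<in> vec.span {?e}" by (simp add: vec.span_singleton)
    moreover have "u = (u - k *s ?e) + k *s ?e" by simp
    ultimately show "u \<in> {a + c |a c. a \<in> ?H \<and> c \<in> vec.span {?e}}" by blast
  qed
  moreover have "?H \<inter> vec.span {?e} = {0}"
  proof -
    have "u = 0" if u: "u \<in> ?H" "u \<in> vec.span {?e}" for u
    proof -
      obtain k where k: "u = k *s ?e" using u(2) by (auto simp: vec.span_singleton)
      then have "k * N $ j = 0" using u(1) e[of k] by simp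
      then show ?thesis using assms k by simp
    qed
    then show ?thesis using H vec.subspace_0[of ?H] vec.span_zero by blast
  qed
  moreover have "vec.dim (vec.span {?e}) = 1" by (simp add: axis_eq_0_iff)
  moreover have "vec.dim {0 :: complex ^ 4} = 0" by simp
  ultimately have "vec.dim (UNIV :: (complex ^ 4) set) = vec.dim ?H + 1"
    using vec.dim_sums_Int[OF H vec.subspace_span[of "{?e}"]] by simp
  then show ?thesis by (simp add: vec_dim_card del: vec.dim_UNIV)
qed

lemma complexify_right_inverse:
  assumes "A ** B = (mat 1 :: real ^ 'm::finite ^ 'm)"
  shows "complexify A ** complexify B = mat 1"
proof -
  have "(complexify A ** complexify B) $ i $ j = (mat 1 :: complex ^ 'm ^ 'm) $ i $ j" for i j
  proof -
    have "(complexify A ** complexify B) $ i $ j = complex_of_real ((A ** B) $ i $ j)"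
      by (simp add: complexify_def matrix_matrix_mult_def)
    then show ?thesis unfolding assms by (simp add: mat_def)
  qed
  then show ?thesis by (simp add: vec_eq_iff)
qed

text \<open>A full-rank matrix has a right inverse, whose image is a complement of the kernel; so the kernel stays
  one-dimensional after complexification.\<close>

lemma center_generator:
  assumes "central_projection A"
  shows "\<exists>v. v \<noteq> 0 \<and> line (center A) = vec.span {v} \<and> (\<forall>u. complexify A *v u = 0 \<longleftrightarrow> u \<in> vec.span {v})"
proof -
  let ?A = "complexify A" and ?W = "{v. complexify A *v v = 0}"
  have "surj ((*v) A)"
    using assms full_rank_surjective[of A] by (simp add: central_projection_def)
  then obtain B where "A ** B = mat 1" using matrix_right_invertible_surjective[of A] by blast
  then have AB: "?A ** complexify B = mat 1" by (rule complexify_right_inverse)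
  let ?B = "complexify B"
  have ABv: "?A *v (?B *v y) = y" for y by (simp add: matrix_vector_mul_assoc AB)
  have W: "vec.subspace ?W"
    by (intro vec.subspaceI) (simp_all add: matrix_vector_right_distrib vector_scalar_commute)
  have S: "vec.subspace (range ((*v) ?B))"
    by (intro vec.linear_subspace_image matrix_vector_mul_linear_gen vec.subspace_UNIV)
  have "inj ((*v) ?B)" using ABv by (metis injI)
  then have "vec.dim (range ((*v) ?B)) = vec.dim (UNIV :: (complex ^ 3) set)"
    by (intro vec.dim_image_eq matrix_vector_mul_linear_gen) (simp add: inj_on_def)
  moreover have "{a + c |a c. a \<in> ?W \<and> c \<in> range ((*v) ?B)} = UNIV"
  proof (intro subset_antisym subset_UNIV subsetI)
    fix u :: "complex ^ 4"
    have "u - ?B *v (?A *v u) \<in> ?W" by (simp add: matrix_vector_mult_diff_distrib ABv)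
    moreover have "u = (u - ?B *v (?A *v u)) + ?B *v (?A *v u)" by simp
    ultimately show "u \<in> {a + c |a c. a \<in> ?W \<and> c \<in> range ((*v) ?B)}" by blast
  qed
  moreover have "?W \<inter> range ((*v) ?B) = {0}"
    by (auto simp: ABv intro: range_eqI[of _ _ 0])
  ultimately have "vec.dim ?W = 1"
    using vec.dim_sums_Int[OF W S] by (simp add: vec_dim_card del: vec.dim_UNIV)
  then have lc: "line (center A) = ?W" unfolding center_def using W by (intro Point_inverse) simp
  obtain v where "v \<noteq> 0" "line (center A) = vec.span {v}" using line_generator by blast
  then show ?thesis using lc by (intro exI[of _ v]) auto
qed

text \<open>Up to a coordinate change of the image plane, a camera with center \<open>(x : y : z : 1)\<close> sends a point to its
  displacement from the center.\<close>

lemma camera_matrix: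
  assumes A: "central_projection A" and c: "line (center A) = vec.span {vector [x, y, z, 1]}"
  shows "\<exists>M Mi :: complex ^ 3 ^ 3. M ** Mi = mat 1 \<and> Mi ** M = mat 1 \<and>
    (\<forall>p. complexify A *v p = M *v vector [p $ 1 - x * p $ 4, p $ 2 - y * p $ 4, p $ 3 - z * p $ 4])"
proof -
  obtain v where v: "line (center A) = vec.span {v}"
    "\<And>u. complexify A *v u = 0 \<longleftrightarrow> u \<in> vec.span {v}" using center_generator[OF A] by blast
  let ?o = "vector [x, y, z, 1] :: complex ^ 4"
  have ker: "complexify A *v u = 0 \<longleftrightarrow> u \<in> vec.span {?o}" for u using v c by simp
  define M where "M = (\<chi> i (j :: 3). complexify A $ i $ (if j = 1 then 1 else if j = 2 then 2 else 3))"
  have Ao: "complexify A *v ?o = 0" using ker vec.span_base by blast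
  then have o0: "complexify A $ i $ 4 = - (complexify A $ i $ 1 * x + complexify A $ i $ 2 * y + complexify A $ i $ 3 * z)" for i
  proof -
    have "(complexify A *v ?o) $ i = 0" using Ao by simp
    then have "complexify A $ i $ 1 * x + complexify A $ i $ 2 * y + complexify A $ i $ 3 * z + complexify A $ i $ 4 = 0"
      unfolding matrix_vector_mult_def by (simp add: sum_4 vector_4)
    then show ?thesis by algebra
  qed
  have M: "complexify A *v p = M *v vector [p $ 1 - x * p $ 4, p $ 2 - y * p $ 4, p $ 3 - z * p $ 4]" for p
  proof -
    have "(complexify A *v p) $ i = (M *v vector [p $ 1 - x * p $ 4, p $ 2 - y * p $ 4, p $ 3 - z * p $ 4]) $ i" for i
      unfolding matrix_vector_mult_def M_def vec_lambda_beta sum_4 sum_3 vector_3 o0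
      by (simp, algebra)
    then show ?thesis by (simp add: vec_eq_iff)
  qed
  have "w = 0" if "M *v w = 0" for w
  proof -
    have w3: "w = vector [w $ 1, w $ 2, w $ 3]" by (simp add: vec_eq_iff forall_3 vector_3)
    have "complexify A *v vector [w $ 1, w $ 2, w $ 3, 0] = 0"
      unfolding M using that by (simp add: vector_4 w3[symmetric])
    then obtain k where k: "vector [w $ 1, w $ 2, w $ 3, 0] = k *s ?o"
      unfolding ker vec.span_singleton by blast
    then have "(vector [w $ 1, w $ 2, w $ 3, 0] :: complex ^ 4) $ 4 = (k *s ?o) $ 4" by simp
    then have "k = 0" by (simp add: vector_4)
    then have "(vector [w $ 1, w $ 2, w $ 3, 0] :: complex ^ 4) = 0" using k by simp
    then show ?thesis by (simp add: vec_eq_iff forall_3 forall_4 vector_4)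
  qed
  then obtain Mi where "Mi ** M = mat 1" using matrix_left_invertible_ker[of M] by blast
  moreover from this have "M ** Mi = mat 1" using matrix_left_right_inverse by blast
  ultimately show ?thesis using M by blast
qed

section \<open>Critical points of the projection of a torus\<close>

text \<open>The squares of the radii are \<open>R\<^sup>2 = b / 4\<close> and \<open>r\<^sup>2 = b / 4 - a\<close>, and \<open>r\<close> may be imaginary.\<close>

definition torus_form :: "complex \<Rightarrow> complex \<Rightarrow> complex ^ 4 \<Rightarrow> complex" where
  "torus_form R r v = ((v $ 1)^2 + (v $ 2)^2 + (v $ 3)^2 + (R^2 - r\<^sup>2) * (v $ 4)^2)^2
     - 4 * R^2 * ((v $ 1)^2 + (v $ 2)^2) * (v $ 4)^2"

definition torus_diff :: "complex \<Rightarrow> complex \<Rightarrow> complex ^ 4 \<Rightarrow> complex ^ 4 \<Rightarrow> complex" where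
  "torus_diff R r v u =
     4 * ((v $ 1)^2 + (v $ 2)^2 + (v $ 3)^2 + (R^2 - r\<^sup>2) * (v $ 4)^2)
       * (v $ 1 * u $ 1 + v $ 2 * u $ 2 + v $ 3 * u $ 3 + (R^2 - r\<^sup>2) * (v $ 4 * u $ 4))
     - 8 * R^2 * ((v $ 1 * u $ 1 + v $ 2 * u $ 2) * (v $ 4)^2 + ((v $ 1)^2 + (v $ 2)^2) * (v $ 4 * u $ 4))"

lemma is_form_torus: "is_form 4 (torus_form R r)"
proof -
  have "is_form 2 (\<lambda>v :: complex ^ 4. (v $ 1)^2 + (v $ 2)^2 + (v $ 3)^2 + (R^2 - r\<^sup>2) * (v $ 4)^2)"
    by (intro is_form_add is_form_scale is_form_coord_square)
  from is_form_power[OF this, of 2]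
  have "is_form 4 (\<lambda>v :: complex ^ 4. ((v $ 1)^2 + (v $ 2)^2 + (v $ 3)^2 + (R^2 - r\<^sup>2) * (v $ 4)^2)^2)" by simp
  moreover have "is_form (2 + 2) (\<lambda>v :: complex ^ 4. 4 * R^2 * ((v $ 1)^2 + (v $ 2)^2) * (v $ 4)^2)"
    by (intro is_form_mult is_form_add is_form_scale is_form_coord_square)
  ultimately show ?thesis unfolding torus_form_def[abs_def] by (intro is_form_diff) simp_all
qed

lemma torus_form_derivative:
  "((\<lambda>\<tau>. torus_form R r (v + \<tau> *s u)) has_field_derivative torus_diff R r v u) (at 0)"
proof -
  define v1 v2 v3 v4 u1 u2 u3 u4 where d: "v1 = v $ 1" "v2 = v $ 2" "v3 = v $ 3" "v4 = v $ 4"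
    "u1 = u $ 1" "u2 = u $ 2" "u3 = u $ 3" "u4 = u $ 4"
  have "((\<lambda>\<tau>. ((v1 + \<tau> * u1)^2 + (v2 + \<tau> * u2)^2 + (v3 + \<tau> * u3)^2 + (R^2 - r\<^sup>2) * (v4 + \<tau> * u4)^2)^2
     - 4 * R^2 * ((v1 + \<tau> * u1)^2 + (v2 + \<tau> * u2)^2) * (v4 + \<tau> * u4)^2) has_field_derivative
     (4 * (v1^2 + v2^2 + v3^2 + (R^2 - r\<^sup>2) * v4^2) * (v1 * u1 + v2 * u2 + v3 * u3 + (R^2 - r\<^sup>2) * (v4 * u4))
     - 8 * R^2 * ((v1 * u1 + v2 * u2) * v4^2 + (v1^2 + v2^2) * (v4 * u4)))) (at 0)"
    by (rule DERIV_cong, (rule derivative_intros)+, simp, algebra)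
  then show ?thesis unfolding torus_form_def torus_diff_def by (simp add: d)
qed

text \<open>The torus is swept out by a meridian circle at distance \<open>\<rho>\<close> from the axis.\<close>

lemma torus_point:
  assumes "e1^2 + e2^2 = 1" "(\<rho> - R * w)^2 + Z^2 = r^2 * w^2"
  shows "torus_form R r (vector [e1 * \<rho>, e2 * \<rho>, Z, w]) = 0"
proof -
  have 1: "(e1 * \<rho>)^2 + (e2 * \<rho>)^2 = \<rho>^2" using assms(1) by algebra
  have 2: "\<rho>^2 + Z^2 + (R^2 - r\<^sup>2) * w^2 = 2 * R * \<rho> * w" using assms(2) by algebra
  show ?thesis unfolding torus_form_def vector_4 1 2 by algebra
qed

text \<open>Moving a point of the torus along its parallel and its meridian, and scaling it, gives three
  curves that span the tangent space.\<close>

lemma gradient_on_torus: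
  assumes f: "is_form d f" "gradient_of f G"
    and van: "\<And>v. torus_form R r v = 0 \<Longrightarrow> v \<noteq> 0 \<Longrightarrow> f v = 0"
    and e: "e1^2 + e2^2 = 1" and circ: "(\<rho> - R * w)^2 + Z^2 = r^2 * w^2"
    and nz: "\<rho> \<noteq> 0" "w \<noteq> 0" "r \<noteq> 0"
    and v: "v = vector [e1 * \<rho>, e2 * \<rho>, Z, w]"
    and u: "e1 * (\<rho> - R * w) * u $ 1 + e2 * (\<rho> - R * w) * u $ 2 + Z * u $ 3 
        = ((\<rho> - R * w) * \<rho> + Z^2) / w * u $ 4"
  shows "(\<Sum>i\<in>UNIV. G i v * u $ i) = 0"
proof -
  define g1 g2 g3 g4 where g: "g1 = G 1 v" "g2 = G 2 v" "g3 = G 3 v" "g4 = G 4 v"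
  have on: "f (vector [a1 * \<sigma>, a2 * \<sigma>, Z', w]) = 0"
    if "a1^2 + a2^2 = 1" "(\<sigma> - R * w)^2 + Z'^2 = r^2 * w^2" for a1 a2 \<sigma> Z'
  proof (rule van[OF torus_point[OF that]])
    have "(vector [a1 * \<sigma>, a2 * \<sigma>, Z', w] :: complex ^ 4) $ 4 \<noteq> 0" using nz by (simp add: vector_4)
    then show "(vector [a1 * \<sigma>, a2 * \<sigma>, Z', w] :: complex ^ 4) \<noteq> 0" by auto
  qed
  have scal: "g1 * (e1 * \<rho>) + g2 * (e2 * \<rho>) + g3 * Z + g4 * w = 0"
    using euler_form[OF f, of v] on[OF e circ] by (simp add: sum_4 g v vector_4)
  have rot: "g1 * (- e2 * \<rho>) + g2 * (e1 * \<rho>) = 0"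
  proof -
    let ?\<gamma> = "\<lambda>\<tau>. vector [(e1 * cos \<tau> - e2 * sin \<tau>) * \<rho>, (e2 * cos \<tau> + e1 * sin \<tau>) * \<rho>, Z, w] :: complex ^ 4"
    have "\<forall>i. ((\<lambda>\<tau>. ?\<gamma> \<tau> $ i) has_field_derivative (vector [- e2 * \<rho>, e1 * \<rho>, 0, 0] :: complex ^ 4) $ i) (at 0)"
      unfolding forall_4 vector_4 by (auto intro!: derivative_eq_intros)
    then have "((\<lambda>\<tau>. f (?\<gamma> \<tau>)) has_field_derivative
        (\<Sum>i\<in>UNIV. G i (?\<gamma> 0) * (vector [- e2 * \<rho>, e1 * \<rho>, 0, 0] :: complex ^ 4) $ i)) (at 0)"
      by (intro gradient_ofD[OF f(2)]) blast
    moreover have "f (?\<gamma> \<tau>) = 0" for \<tau>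
    proof (rule on[OF _ circ])
      show "(e1 * cos \<tau> - e2 * sin \<tau>)^2 + (e2 * cos \<tau> + e1 * sin \<tau>)^2 = 1"
        using e sin_cos_squared_add[of \<tau>] by algebra
    qed
    ultimately have "((\<lambda>\<tau>. 0) has_field_derivative
        (\<Sum>i\<in>UNIV. G i (?\<gamma> 0) * (vector [- e2 * \<rho>, e1 * \<rho>, 0, 0] :: complex ^ 4) $ i)) (at 0)" by simp
    from DERIV_unique[OF this DERIV_const]
    show ?thesis by (simp add: sum_4 vector_4 g v)
  qed
  define m where "m = \<rho> - R * w"
  have mer: "g1 * (- e1 * Z) + g2 * (- e2 * Z) + g3 * m = 0"
  proof -
    let ?\<gamma> = "\<lambda>\<tau>. vector [e1 * (R * w + m * cos \<tau> - Z * sin \<tau>), e2 * (R * w + m * cos \<tau> - Z * sin \<tau>),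
       Z * cos \<tau> + m * sin \<tau>, w] :: complex ^ 4"
    have "\<forall>i. ((\<lambda>\<tau>. ?\<gamma> \<tau> $ i) has_field_derivative (vector [- e1 * Z, - e2 * Z, m, 0] :: complex ^ 4) $ i) (at 0)"
      unfolding forall_4 vector_4 by (auto intro!: derivative_eq_intros)
    then have "((\<lambda>\<tau>. f (?\<gamma> \<tau>)) has_field_derivative
        (\<Sum>i\<in>UNIV. G i (?\<gamma> 0) * (vector [- e1 * Z, - e2 * Z, m, 0] :: complex ^ 4) $ i)) (at 0)"
      by (intro gradient_ofD[OF f(2)]) blast
    moreover have "f (?\<gamma> \<tau>) = 0" for \<tau>
    proof (rule on[OF e])
      show "(R * w + m * cos \<tau> - Z * sin \<tau> - R * w)^2 + (Z * cos \<tau> + m * sin \<tau>)^2 = r^2 * w^2"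
        using circ[folded m_def] sin_cos_squared_add[of \<tau>] by algebra
    qed
    ultimately have "((\<lambda>\<tau>. 0) has_field_derivative
        (\<Sum>i\<in>UNIV. G i (?\<gamma> 0) * (vector [- e1 * Z, - e2 * Z, m, 0] :: complex ^ 4) $ i)) (at 0)" by simp
    from DERIV_unique[OF this DERIV_const]
    show ?thesis by (simp add: sum_4 vector_4 g v m_def)
  qed
  define \<gamma> where "\<gamma> = e1 * g1 + e2 * g2"
  have "e1 * g2 = e2 * g1" using rot nz by (simp add: algebra_simps)
  then have g12: "g1 = e1 * \<gamma>" "g2 = e2 * \<gamma>" using e unfolding \<gamma>_def by algebra+
  have gz: "g3 * m = \<gamma> * Z" using mer unfolding \<gamma>_def by algebra
  define \<mu> where "\<mu> = \<gamma> * m + g3 * Z"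
  have circ': "m^2 + Z^2 = r^2 * w^2" using circ by (simp add: m_def)
  have \<gamma>': "r^2 * w^2 * \<gamma> = \<mu> * m" and g3': "r^2 * w^2 * g3 = \<mu> * Z"
    using gz circ' unfolding \<mu>_def by algebra+
  have g4w: "g4 * w = - (\<gamma> * \<rho> + g3 * Z)" using scal e unfolding g12 by algebra
  have g4': "r^2 * w^2 * (g4 * w) = - \<mu> * (m * \<rho> + Z^2)" unfolding g4w using \<gamma>' g3' by algebra
  have u': "w * (e1 * m * u $ 1 + e2 * m * u $ 2 + Z * u $ 3) = (m * \<rho> + Z^2) * u $ 4"
    unfolding u[folded m_def] using nz by simp
  have "r^2 * w^2 * w * (g1 * u $ 1 + g2 * u $ 2 + g3 * u $ 3 + g4 * u $ 4)
     = \<mu> * (w * (e1 * m * u $ 1 + e2 * m * u $ 2 + Z * u $ 3)) + (r^2 * w^2 * (g4 * w)) * u $ 4"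
    unfolding g12 using \<gamma>' g3' by algebra
  also have "\<dots> = 0" unfolding u' g4' by algebra
  finally show ?thesis using nz by (simp add: sum_4 g)
qed

locale torus_camera = torus_view x y z R r for x y z R r :: complex +
  fixes a b :: real and A :: "real ^ 4 ^ 3" and M Mi :: "complex ^ 3 ^ 3"
  assumes aR: "complex_of_real a = R^2 - r\<^sup>2" and bR: "complex_of_real b = 4 * R^2"
    and inv: "M ** Mi = mat 1" "Mi ** M = mat 1"
    and proj: "complexify A *v p = M *v vector [p $ 1 - x * p $ 4, p $ 2 - y * p $ 4, p $ 3 - z * p $ 4]"
    and line_center: "line (center A) = vec.span {vector [x, y, z, 1]}"
begin

lemma torus_eq: "torus a b = zero_locus {torus_form R r}"
  unfolding torus_def torus_form_def[abs_def] aR bR ..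

lemma in_torus_iff: "v \<in> line p \<Longrightarrow> v \<noteq> 0 \<Longrightarrow> p \<in> torus a b \<longleftrightarrow> torus_form R r v = 0"
  unfolding torus_eq by (rule in_zero_locus_iff[OF is_form_torus])

lemma torus_form_center: "torus_form R r (vector [x, y, z, 1]) \<noteq> 0"
  using off_torus unfolding torus_form_def vector_4 by simp

lemma torus_form_in_vanishing: "torus_form R r \<in> vanishing_forms (torus a b)"
  unfolding vanishing_forms_def torus_eq using is_form_torus by blast

lemma tangent_cone_subset:
  assumes "v \<in> line p" "v \<noteq> 0"
  shows "tangent_cone_space (torus a b) p \<subseteq> {u. torus_diff R r v u = 0}"
proof
  fix u assume "u \<in> tangent_cone_space (torus a b) p"
  then have "deriv (\<lambda>t. torus_form R r (v + t *s u)) 0 = 0"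
    using torus_form_in_vanishing assms unfolding tangent_cone_space_def by blast
  then show "u \<in> {u. torus_diff R r v u = 0}"
    using DERIV_imp_deriv[OF torus_form_derivative[of R r v u]] by simp
qed

lemma subspace_tangent_cone: "vec.subspace (tangent_cone_space X p)"
proof -
  have d: "\<exists>g. \<forall>u. deriv (\<lambda>t. f (v + t *s u)) 0 = (\<Sum>i\<in>UNIV. g i * u $ i)"
    if f: "f \<in> vanishing_forms X" for f v
  proof -
    obtain d where "is_form d f" using f unfolding vanishing_forms_def by blast
    then obtain G where "gradient_of f G" using form_gradient by blast
    then show ?thesis using DERIV_imp_deriv[OF gradient_line] by (intro exI[of _ "\<lambda>i. G i v"]) blast
  qed
  show ?thesis
  proof (rule vec.subspaceI)
    show "0 \<in> tangent_cone_space X p" unfolding tangent_cone_space_def by simp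
  next
    fix u u' assume u: "u \<in> tangent_cone_space X p" "u' \<in> tangent_cone_space X p"
    show "u + u' \<in> tangent_cone_space X p"
      unfolding tangent_cone_space_def mem_Collect_eq
    proof (intro ballI)
      fix f v assume f: "f \<in> vanishing_forms X" and v: "v \<in> line p - {0}"
      obtain g where g: "\<And>u. deriv (\<lambda>t. f (v + t *s u)) 0 = (\<Sum>i\<in>UNIV. g i * u $ i)" using d[OF f] by blast
      have "(\<Sum>i\<in>UNIV. g i * u $ i) = 0" "(\<Sum>i\<in>UNIV. g i * u' $ i) = 0"
        using u f v unfolding tangent_cone_space_def g[symmetric] by blast+
      then show "deriv (\<lambda>t. f (v + t *s (u + u'))) 0 = 0"
        unfolding g by (simp add: distrib_left sum.distrib)
    qed
  next
    fix k u assume u: "u \<in> tangent_cone_space X p"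
    show "k *s u \<in> tangent_cone_space X p"
      unfolding tangent_cone_space_def mem_Collect_eq
    proof (intro ballI)
      fix f v assume f: "f \<in> vanishing_forms X" and v: "v \<in> line p - {0}"
      obtain g where g: "\<And>u. deriv (\<lambda>t. f (v + t *s u)) 0 = (\<Sum>i\<in>UNIV. g i * u $ i)" using d[OF f] by blast
      have "(\<Sum>i\<in>UNIV. g i * u $ i) = 0"
        using u f v unfolding tangent_cone_space_def g[symmetric] by blast
      then show "deriv (\<lambda>t. f (v + t *s (k *s u))) 0 = 0"
        unfolding g by (simp add: mult.left_commute sum_distrib_left[symmetric])
    qed
  qed
qed

lemma line_proj_map:
  assumes "v \<in> line p" "v \<noteq> 0" "complexify A *v v \<noteq> 0"
  shows "line (proj_map A p) = vec.span {complexify A *v v}"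
proof -
  have "(\<lambda>u. complexify A *v u) ` line p = vec.span {complexify A *v v}"
    unfolding line_eq_span[OF assms(1,2)] vec.span_singleton
    by (simp add: image_image vector_scalar_commute)
  then show ?thesis unfolding proj_map_def using span_line[OF assms(3)] by simp
qed

lemma kernel: "complexify A *v u = 0 \<longleftrightarrow> u \<in> vec.span {vector [x, y, z, 1]}"
proof
  assume "complexify A *v u = 0"
  then have "Mi *v (M *v vector [u $ 1 - x * u $ 4, u $ 2 - y * u $ 4, u $ 3 - z * u $ 4]) = 0"
    unfolding proj by simp
  then have "(vector [u $ 1 - x * u $ 4, u $ 2 - y * u $ 4, u $ 3 - z * u $ 4] :: complex ^ 3) = 0"
    by (simp add: matrix_vector_mul_assoc inv)
  then have "u = u $ 4 *s vector [x, y, z, 1]"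
    by (simp add: vec_eq_iff forall_3 forall_4 vector_3 vector_4 mult.commute)
  then show "u \<in> vec.span {vector [x, y, z, 1]}" unfolding vec.span_singleton by blast
next
  assume "u \<in> vec.span {vector [x, y, z, 1]}"
  then obtain k where "u = k *s vector [x, y, z, 1]" unfolding vec.span_singleton by blast
  then have "vector [u $ 1 - x * u $ 4, u $ 2 - y * u $ 4, u $ 3 - z * u $ 4] = (0 :: complex ^ 3)"
    by (simp add: vec_eq_iff forall_3 vector_3 vector_4)
  then show "complexify A *v u = 0" unfolding proj by simp
qed

lemma torus_not_center:
  assumes "torus_form R r v = 0" "v \<noteq> 0"
  shows "complexify A *v v \<noteq> 0" "v \<in> line p \<Longrightarrow> p \<noteq> center A"
proof -
  show *: "complexify A *v v \<noteq> 0"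
  proof
    assume "complexify A *v v = 0"
    then obtain k where k: "v = k *s vector [x, y, z, 1]" unfolding kernel vec.span_singleton by blast
    then have "k ^ 4 * torus_form R r (vector [x, y, z, 1]) = 0"
      using assms(1) form_homogeneous[OF is_form_torus] by simp
    then show False using torus_form_center assms(2) k by simp
  qed
  show "p \<noteq> center A" if "v \<in> line p"
    using that * kernel line_center by auto
qed

definition pt :: "complex \<Rightarrow> complex \<Rightarrow> complex ^ 4" where
  "pt q s = vector [(R * kk q s + r * q) * uu q, (R * kk q s + r * q) * vv q, r * q * tt q s, q * kk q s]"

lemma proj_pt: "complexify A *v pt q s = M *v contour q s"
  unfolding proj pt_def contour_def vector_4 by (simp add: mult_ac)

text \<open>The tangent cone is defined by all forms vanishing on the torus. One inclusion uses the equation of the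
  torus, the other one the curves on the torus from \<open>gradient_on_torus\<close>; so no knowledge of the
  full ideal of the torus is needed.\<close>

lemma critical_point:
  assumes c: "on_curve q s" and nz: "q \<noteq> 0" "kk q s \<noteq> 0" "R * kk q s + r * q \<noteq> 0"
  shows "Point (vec.span {pt q s}) \<in> critical_points A (torus a b)"
proof -
  let ?p = "Point (vec.span {pt q s})"
  define W where "W = R * kk q s + r * q"
  have k2: "(kk q s)^2 = q^2 + (tt q s)^2" by (rule kk_tt_square[OF c])
  have "pt q s $ 4 \<noteq> 0" using nz by (simp add: pt_def vector_4)
  then have p0: "pt q s \<noteq> 0" by auto
  then have lp: "line ?p = vec.span {pt q s}" by (rule span_line)
  then have pp: "pt q s \<in> line ?p" by (simp add: vec.span_base)
  define e1 e2 where e: "e1 = uu q / q" "e2 = vv q / q"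
  have e12: "e1^2 + e2^2 = 1"
    using uu_vv(2)[of q] nz by (simp add: e power_divide add_divide_distrib[symmetric])
  have pt_eq: "k *s pt q s = vector [e1 * (k * (W * q)), e2 * (k * (W * q)), k * (r * q * tt q s), k * (q * kk q s)]" for k
    using nz by (simp add: vec_eq_iff forall_4 vector_4 pt_def e W_def)
  have circ: "(k * (W * q) - R * (k * (q * kk q s)))^2 + (k * (r * q * tt q s))^2 = r^2 * (k * (q * kk q s))^2" for k
    using k2 unfolding W_def by algebra
  have T0: "torus_form R r (pt q s) = 0"
    using torus_point[OF e12 circ[of 1]] pt_eq[of 1] by simp
  let ?N = "vector [uu q, vv q, tt q s, - offset (nvec q s)] :: complex ^ 4"
  have diff: "torus_diff R r (pt q s) u = 8 * R * (q * kk q s) * (r * q^2 * W) * (\<Sum>i\<in>UNIV. ?N $ i * u $ i)" for u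
  proof -
    have "(R^2 - r\<^sup>2) * kk q s - R * W = - r * offset (nvec q s)"
      unfolding W_def offset_nvec by algebra
    then show ?thesis
      unfolding torus_diff_def pt_def vector_4 sum_4 W_def[symmetric]
      using uu_vv(2)[of q] k2 W_def by algebra
  qed
  have TC: "tangent_cone_space (torus a b) ?p = {u. (\<Sum>i\<in>UNIV. ?N $ i * u $ i) = 0}"
  proof (intro subset_antisym subsetI)
    fix u assume "u \<in> tangent_cone_space (torus a b) ?p"
    then have "torus_diff R r (pt q s) u = 0" using tangent_cone_subset[OF pp p0] by blast
    then show "u \<in> {u. (\<Sum>i\<in>UNIV. ?N $ i * u $ i) = 0}"
      unfolding diff using nz R0 r0 W_def by simp
  next
    fix u assume "u \<in> {u. (\<Sum>i\<in>UNIV. ?N $ i * u $ i) = 0}"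
    then have Nu: "uu q * u $ 1 + vv q * u $ 2 + tt q s * u $ 3 = offset (nvec q s) * u $ 4"
      by (simp add: sum_4 vector_4 algebra_simps)
    show "u \<in> tangent_cone_space (torus a b) ?p"
      unfolding tangent_cone_space_def mem_Collect_eq
    proof (intro ballI)
      fix f v assume f: "f \<in> vanishing_forms (torus a b)" and v: "v \<in> line ?p - {0}"
      obtain k where k: "v = k *s pt q s" "k \<noteq> 0"
      proof -
        have "v \<in> vec.span {pt q s}" "v \<noteq> 0" using v lp by simp_all
        then show ?thesis using that unfolding vec.span_singleton by auto
      qed
      obtain d where d: "is_form d f" using f unfolding vanishing_forms_def by blast
      obtain G where G: "gradient_of f G" using form_gradient[OF d] by blast
      have van: "f v' = 0" if "torus_form R r v' = 0" "v' \<noteq> 0" for v'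
      proof -
        have l: "v' \<in> line (Point (vec.span {v'}))" using span_line[OF that(2)] by (simp add: vec.span_base)
        then have "Point (vec.span {v'}) \<in> torus a b" using in_torus_iff that by blast
        then have "Point (vec.span {v'}) \<in> zero_locus {f}" using f unfolding vanishing_forms_def by blast
        then show ?thesis using l unfolding zero_locus_def by blast
      qed
      have w: "k * (q * kk q s) \<noteq> 0" "k * (W * q) \<noteq> 0" using nz k by (simp_all add: W_def)
      have m: "k * (W * q) - R * (k * (q * kk q s)) = k * r * q^2" unfolding W_def by algebra
      have "e1 * (k * r * q^2) * u $ 1 + e2 * (k * r * q^2) * u $ 2 + k * (r * q * tt q s) * u $ 3
          = (k * r * q) * (uu q * u $ 1 + vv q * u $ 2 + tt q s * u $ 3)"
        using nz by (simp add: e power2_eq_square algebra_simps)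
      also have "\<dots> = (k * r * q) * (offset (nvec q s) * u $ 4)" unfolding Nu ..
      also have "\<dots> = (k * r * q^2 * (k * (W * q)) + (k * (r * q * tt q s))^2) / (k * (q * kk q s)) * u $ 4"
      proof -
        have "k * r * q^2 * (k * (W * q)) + (k * (r * q * tt q s))^2
            = (k * r * q) * offset (nvec q s) * (k * (q * kk q s))"
          unfolding offset_nvec W_def using k2 by algebra
        then show ?thesis using w by simp
      qed
      finally have "(\<Sum>i\<in>UNIV. G i v * u $ i) = 0"
        using gradient_on_torus[OF d G van e12 circ[of k] w(2,1) r0, of v u] pt_eq[of k] k(1) unfolding m by simp
      then show "deriv (\<lambda>t. f (v + t *s u)) 0 = 0"
        using DERIV_imp_deriv[OF gradient_line[OF G]] by simp
    qed
  qed
  have "\<exists>j. ?N $ j \<noteq> 0"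
  proof (rule ccontr)
    assume "\<not> (\<exists>j. ?N $ j \<noteq> 0)"
    then have "?N $ 1 = 0" "?N $ 2 = 0" by blast+
    then show False using uu_vv(1)[of q] by (simp add: vector_4)
  qed
  then obtain j where "?N $ j \<noteq> 0" ..
  then have "vec.dim (tangent_cone_space (torus a b) ?p) = 3"
    unfolding TC by (rule dim_hyperplane_4)
  moreover have "?p \<in> torus a b" using in_torus_iff[OF pp p0] T0 by simp
  moreover have "?p \<noteq> center A" using torus_not_center(2)[OF T0 p0 pp] .
  moreover have "(\<lambda>v. complexify A *v v) ` tangent_cone_space (torus a b) ?p \<noteq> UNIV"
  proof
    assume img: "(\<lambda>v. complexify A *v v) ` tangent_cone_space (torus a b) ?p = UNIV"
    \<comment> \<open>The vector \<open>(1, \<i>, 0)\<close> pairs to 1 with the normal, so it is not a displacement of a tangent vector.\<close>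
    have "M *v vector [1, \<i>, 0] \<in> (\<lambda>v. complexify A *v v) ` tangent_cone_space (torus a b) ?p"
      unfolding img by (rule UNIV_I)
    then obtain u where u: "u \<in> tangent_cone_space (torus a b) ?p"
      "M *v vector [1, \<i>, 0] = complexify A *v u" by auto
    then have "Mi *v (M *v vector [1, \<i>, 0]) = Mi *v (M *v vector [u $ 1 - x * u $ 4, u $ 2 - y * u $ 4, u $ 3 - z * u $ 4])"
      unfolding proj by simp
    then have eq: "(vector [1, \<i>, 0] :: complex ^ 3) = vector [u $ 1 - x * u $ 4, u $ 2 - y * u $ 4, u $ 3 - z * u $ 4]"
      by (simp add: matrix_vector_mul_assoc inv)
    have u123: "u $ 1 - x * u $ 4 = 1" "u $ 2 - y * u $ 4 = \<i>" "u $ 3 - z * u $ 4 = 0"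
      using arg_cong[OF eq, of "\<lambda>v. v $ 1"] arg_cong[OF eq, of "\<lambda>v. v $ 2"] arg_cong[OF eq, of "\<lambda>v. v $ 3"]
      by (simp_all add: vector_3)
    have "uu q * u $ 1 + vv q * u $ 2 + tt q s * u $ 3 + - (x * uu q + y * vv q + z * tt q s) * u $ 4 = 0"
      using u(1) unfolding TC by (simp add: sum_4 vector_4 offset_def nvec_def vector_3)
    then have "uu q * u $ 1 + vv q * u $ 2 + tt q s * u $ 3 = (x * uu q + y * vv q + z * tt q s) * u $ 4"
      by algebra
    then have "uu q + \<i> * vv q = 0" using u123 by algebra
    then show False using uu_vv(1)[of q] by simp
  qed
  ultimately show ?thesis unfolding critical_points_def smooth_part_def by blast
qed

text \<open>The points of the curve excluded in \<open>critical_point\<close> are the zeros of a regular function that does not vanish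
  identically, so it can be cancelled.\<close>

lemma vanishes_of_critical:
  assumes f: "is_form d f" and van: "proj_map A ` critical_points A (torus a b) \<subseteq> zero_locus {f}"
  shows "vanishes (\<lambda>q s. f (M *v contour q s))"
proof -
  have fM: "is_form d (\<lambda>v. f (M *v v))" by (rule is_form_matrix[OF f])
  have "vanishes (\<lambda>q s. f (M *v contour q s) * (q * (kk q s * (R * kk q s + r * q))))"
    unfolding vanishes_def
  proof (intro allI impI)
    fix q s assume c: "on_curve q s"
    show "f (M *v contour q s) * (q * (kk q s * (R * kk q s + r * q))) = 0"
    proof (cases "q = 0 \<or> kk q s = 0 \<or> R * kk q s + r * q = 0")
      case False
      let ?p = "Point (vec.span {pt q s})"
      have cr: "?p \<in> critical_points A (torus a b)" using critical_point[OF c] False by blast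
      have "pt q s $ 4 \<noteq> 0" using False by (simp add: pt_def vector_4)
      then have p0: "pt q s \<noteq> 0" by auto
      then have pp: "pt q s \<in> line ?p" using span_line[OF p0] by (simp add: vec.span_base)
      have "?p \<in> torus a b" using cr unfolding critical_points_def smooth_part_def by blast
      then have "complexify A *v pt q s \<noteq> 0" using torus_not_center(1) in_torus_iff pp p0 by blast
      from line_proj_map[OF pp p0 this] have "M *v contour q s \<in> line (proj_map A ?p)"
        unfolding proj_pt by (simp add: vec.span_base)
      moreover have "proj_map A ?p \<in> zero_locus {f}" using cr van by blast
      ultimately have "f (M *v contour q s) = 0" unfolding zero_locus_def by blast
      then show ?thesis by simp
    qed auto
  qed
  moreover have "regular_fun (d * 4) (\<lambda>q s. f (M *v contour q s))" by (rule regular_form[OF fM regular_contour])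
  moreover have k: "regular_fun 4 (\<lambda>q s. kk q s * (R * kk q s + r * q))"
    using regular_mult[OF regular_kk regular_width] by simp
  moreover note regular_mult[OF regular_q k]
  ultimately have "vanishes (\<lambda>q s. f (M *v contour q s)) \<or> vanishes (\<lambda>q s. q * (kk q s * (R * kk q s + r * q)))"
    using vanishes_mult by blast
  moreover have "\<not> vanishes (\<lambda>q s. q)"
    using on_curve_csqrt[of 1] by (auto simp: vanishes_def)
  moreover have "\<not> vanishes (\<lambda>q s. kk q s * (R * kk q s + r * q))"
  proof
    assume "vanishes (\<lambda>q s. kk q s * (R * kk q s + r * q))"
    then have "kk 0 al * (R * kk 0 al + r * 0) = 0" using on_curve_0 unfolding vanishes_def by blast
    then show False using kk_0 R0 by simp
  qed
  ultimately show ?thesis using vanishes_mult[OF regular_q k] by blast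
qed

text \<open>Critical points that are not on the parametrised curve lie on the absolute or are vertices on the
  axis of the torus. Their images lie on a conic and on a line; \<open>residual\<close> is the equation of both,
  relative to the center.\<close>

definition residual :: "complex ^ 3 \<Rightarrow> complex" where
  "residual w = ((w $ 1)^2 + (w $ 2)^2 + (w $ 3)^2) * (y * w $ 1 - x * w $ 2)"

lemma is_form_residual: "is_form 3 residual"
proof -
  have "is_form (2 + 1) residual" unfolding residual_def[abs_def]
    by (intro is_form_mult is_form_add is_form_diff is_form_scale is_form_coord_square is_form_coord)
  then show ?thesis by simp
qed

text \<open>The parameter is found by inverting the parametrisation: \<open>\<rho>\<close> is the signed distance from the axis,
  \<open>m = \<rho> - R w\<close> its excess over the core circle, and \<open>q = (v1 - \<i> v2) / \<rho>\<close>. Here \<open>m \<noteq> 0\<close> because the planes touching the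
  torus along a circle do not contain the center, and \<open>\<rho> \<noteq> 0\<close> because the tangent planes along the
  isotropic lines of the torus do not.\<close>

lemma critical_on_curve:
  assumes w0: "v $ 4 \<noteq> 0" and T0: "torus_form R r v = 0"
    and d0: "torus_diff R r v (vector [x, y, z, 1]) = 0"
    and ax: "v $ 1 \<noteq> 0 \<or> v $ 2 \<noteq> 0"
  shows "\<exists>q s k. on_curve q s \<and> k \<noteq> 0 \<and> pt q s = k *s v"
proof -
  define v1 v2 v3 w where v: "v1 = v $ 1" "v2 = v $ 2" "v3 = v $ 3" "w = v $ 4"
  define N where "N = v1^2 + v2^2 + v3^2 + (R^2 - r\<^sup>2) * w^2"
  have wn: "w \<noteq> 0" using w0 by (simp add: v)
  have T: "N^2 = 4 * R^2 * (v1^2 + v2^2) * w^2"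
    using T0 unfolding torus_form_def N_def v by simp
  have D: "4 * N * (v1 * x + v2 * y + v3 * z + (R^2 - r\<^sup>2) * w)
     - 8 * R^2 * ((v1 * x + v2 * y) * w^2 + (v1^2 + v2^2) * w) = 0"
    using d0 unfolding torus_diff_def vector_4 N_def v by simp
  define \<rho> where "\<rho> = N / (2 * R * w)"
  have N: "N = 2 * R * \<rho> * w" using R0 wn by (simp add: \<rho>_def)
  have "(2 * R * w)^2 * \<rho>^2 = (2 * R * w)^2 * (v1^2 + v2^2)" using T unfolding N by algebra
  then have \<rho>2: "\<rho>^2 = v1^2 + v2^2" using R0 wn by simp
  have \<rho>0: "\<rho> \<noteq> 0"
  proof
    assume "\<rho> = 0"
    then have s0: "v1^2 + v2^2 = 0" and "8 * R^2 * w^2 * (v1 * x + v2 * y) = 0"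
      using \<rho>2 D N by algebra+
    then have l0: "v1 * x + v2 * y = 0" using R0 wn by simp
    have "v1^2 * (x^2 + y^2) = 0" "v2^2 * (x^2 + y^2) = 0" using s0 l0 by algebra+
    then show False using xy0 ax by (simp add: v)
  qed
  define m where "m = \<rho> - R * w"
  have circ: "m^2 + v3^2 = r^2 * w^2" using N \<rho>2 unfolding N_def m_def by algebra
  have "8 * R * w * (m * (v1 * x + v2 * y) + \<rho> * v3 * z + \<rho> * (- R * m - r\<^sup>2 * w)) = 0"
    using D N \<rho>2 unfolding m_def by algebra
  then have tang: "m * (v1 * x + v2 * y) + \<rho> * v3 * z + \<rho> * (- R * m - r\<^sup>2 * w) = 0"
    using R0 wn by simp
  have m0: "m \<noteq> 0"
  proof
    assume m: "m = 0"
    then have "\<rho> * (v3 * z) = \<rho> * (r^2 * w)" using tang by algebra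
    then have "v3 * z = r^2 * w" using \<rho>0 by simp
    then have "r^2 * w^2 * z^2 = r^2 * w^2 * r^2" using circ m by algebra
    then show False using r0 wn zr by simp
  qed
  define q where "q = (v1 - \<i> * v2) / \<rho>"
  have qr: "q * \<rho> = v1 - \<i> * v2" using \<rho>0 by (simp add: q_def)
  have "(v1 - \<i> * v2) * (v1 + \<i> * v2) = \<rho> * \<rho>" using \<rho>2 by (simp add: power2_eq_square algebra_simps)
  then have "\<rho> * (q * (v1 + \<i> * v2)) = \<rho> * \<rho>" unfolding qr[symmetric] by (simp add: mult_ac)
  then have qk: "q * (v1 + \<i> * v2) = \<rho>" using \<rho>0 by simp
  have q0: "q \<noteq> 0" using qk \<rho>0 by auto
  have ii: "\<i> * \<i> = - 1" by simp
  have u2: "2 * uu q = 1 + q^2" "2 * vv q = \<i> * (q^2 - 1)" by (simp_all add: uu_def vv_def)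
  have "2 * (q * v1) = 2 * (\<rho> * uu q)" "2 * (q * v2) = 2 * (\<rho> * vv q)"
    using qr qk ii u2 by algebra+
  then have qv1: "q * v1 = \<rho> * uu q" and qv2: "q * v2 = \<rho> * vv q" by simp_all
  define t where "t = q * v3 / m"
  define \<kappa> where "\<kappa> = q * r * w / m"
  define c where "c = poly cP q"
  have tm: "m * t = q * v3" and km: "m * \<kappa> = q * r * w" using m0 by (simp_all add: t_def \<kappa>_def)
  have c: "c = x * uu q + y * vv q - R * q" unfolding c_def by (rule cP_uu_vv)
  have "\<rho> * (m * (c + z * t - r * \<kappa>)) = q * (m * (v1 * x + v2 * y) + \<rho> * v3 * z + \<rho> * (- R * m - r\<^sup>2 * w))"
    using qv1 qv2 tm km unfolding c by algebra
  then have lin: "r * \<kappa> = c + z * t" unfolding tang using \<rho>0 m0 by simp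
  have "m^2 * \<kappa>^2 = m^2 * (q^2 + t^2)" using circ tm km by algebra
  then have sq: "\<kappa>^2 = q^2 + t^2" using m0 by simp
  define s where "s = (K * t + z * c) / r"
  have rs: "r * s = K * t + z * c" using r0 by (simp add: s_def)
  have "r^2 * s^2 = r^2 * (c^2 + K * q^2)"
    using rs lin sq K_def by algebra
  then have on: "on_curve q s" using r0 by (simp add: on_curve_def poly_DP c_def)
  have tt: "tt q s = t" using K0 rs by (simp add: tt_def c_def)
  have "r * kk q s = r * \<kappa>"
    using kk_tt_linear[of q s] lin unfolding tt c_def by simp
  then have kk: "kk q s = \<kappa>" using r0 by simp
  define k where "k = q^2 * r / m"
  have mk: "m * k = q^2 * r" using m0 by (simp add: k_def)
  have mW: "m * (R * \<kappa> + r * q) = q * r * \<rho>" using km unfolding m_def by algebra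
  have "m * ((R * \<kappa> + r * q) * uu q) = m * (k * v1)" "m * ((R * \<kappa> + r * q) * vv q) = m * (k * v2)"
    "m * (r * q * t) = m * (k * v3)" "m * (q * \<kappa>) = m * (k * w)"
    using mk mW qv1 qv2 tm km by algebra+
  then have "pt q s = k *s v"
    unfolding pt_def tt kk using m0 by (simp add: vec_eq_iff forall_4 vector_4 v)
  moreover have "k \<noteq> 0" using q0 r0 m0 by (simp add: k_def)
  ultimately show ?thesis using on by blast
qed

text \<open>If the center were not in the tangent space, the projection would map the tangent space isomorphically
  onto the image space and the point would not be critical.\<close>

lemma critical_of_vanishes:
  assumes f: "is_form d f" and van: "vanishes (\<lambda>q s. f (M *v contour q s))"
  shows "proj_map A ` critical_points A (torus a b) \<subseteq> zero_locus {\<lambda>w. f w * residual (Mi *v w)}"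
proof
  fix P assume "P \<in> proj_map A ` critical_points A (torus a b)"
  then obtain p where p: "p \<in> critical_points A (torus a b)" "P = proj_map A p" by blast
  obtain v where v: "v \<noteq> 0" "line p = vec.span {v}" using line_generator by blast
  then have vp: "v \<in> line p" by (simp add: vec.span_base)
  have T0: "torus_form R r v = 0"
    using p in_torus_iff[OF vp v(1)] unfolding critical_points_def smooth_part_def by blast
  have Av: "complexify A *v v \<noteq> 0" using torus_not_center(1)[OF T0 v(1)] .
  have lP: "line P = vec.span {complexify A *v v}" unfolding p(2) by (rule line_proj_map[OF vp v(1) Av])
  have formM: "is_form 3 (\<lambda>w. residual (Mi *v w))"
    by (rule is_form_matrix[OF is_form_residual])
  have crit: "torus_diff R r v (vector [x, y, z, 1]) = 0"
  proof (rule ccontr)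
    assume ne: "torus_diff R r v (vector [x, y, z, 1]) \<noteq> 0"
    let ?TC = "tangent_cone_space (torus a b) p"
    have S: "vec.subspace ?TC" by (rule subspace_tangent_cone)
    have "inj_on ((*v) (complexify A)) (vec.span ?TC)"
      unfolding vec.span_eq_iff[THEN iffD2, OF S]
    proof (rule inj_onI)
      fix u u' assume u: "u \<in> ?TC" "u' \<in> ?TC" "complexify A *v u = complexify A *v u'"
      then have "complexify A *v (u - u') = 0" by (simp add: matrix_vector_mult_diff_distrib)
      then obtain k where k: "u - u' = k *s vector [x, y, z, 1]" unfolding kernel vec.span_singleton by blast
      have "u - u' \<in> ?TC" using S u vec.subspace_diff by blast
      then have "torus_diff R r v (k *s vector [x, y, z, 1]) = 0"
        using tangent_cone_subset[OF vp v(1)] k by auto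
      moreover have "torus_diff R r v (k *s vector [x, y, z, 1]) = k * torus_diff R r v (vector [x, y, z, 1])"
        unfolding torus_diff_def vector_smult_component by algebra
      ultimately have "k = 0" using ne by simp
      then show "u = u'" using k by simp
    qed
    then have "vec.dim ((*v) (complexify A) ` ?TC) = vec.dim ?TC"
      by (intro vec.dim_image_eq matrix_vector_mul_linear_gen)
    also have "vec.dim ?TC = 3" using p unfolding critical_points_def smooth_part_def by blast
    finally have "vec.dim ((*v) (complexify A) ` ?TC) = vec.dim (UNIV :: (complex ^ 3) set)"
      by (simp add: vec_dim_card del: vec.dim_UNIV)
    moreover have "vec.subspace ((*v) (complexify A) ` ?TC)"
      by (intro vec.linear_subspace_image matrix_vector_mul_linear_gen S)
    ultimately have "(*v) (complexify A) ` ?TC = UNIV"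
      using vec.subspace_dim_equal[OF _ vec.subspace_UNIV] by (metis order_refl subset_UNIV)
    then show False using p unfolding critical_points_def by blast
  qed
  have Mi: "Mi *v (complexify A *v v) = vector [v $ 1 - x * v $ 4, v $ 2 - y * v $ 4, v $ 3 - z * v $ 4]"
    unfolding proj by (simp add: matrix_vector_mul_assoc inv)
  have "f (complexify A *v v) * residual (Mi *v (complexify A *v v)) = 0"
  proof (cases "v $ 4 = 0")
    case True
    have "(v $ 1)^2 + (v $ 2)^2 + (v $ 3)^2 = 0" using T0 True by (simp add: torus_form_def)
    then have "residual (Mi *v (complexify A *v v)) = 0" unfolding Mi residual_def vector_3 True by simp
    then show ?thesis by simp
  next
    case w0: False
    show ?thesis
    proof (cases "v $ 1 = 0 \<and> v $ 2 = 0")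
      case True
      then have "residual (Mi *v (complexify A *v v)) = 0" unfolding Mi residual_def vector_3 by simp
      then show ?thesis by simp
    next
      case False
      then obtain q s k where k: "on_curve q s" "k \<noteq> 0" "pt q s = k *s v"
        using critical_on_curve[OF w0 T0 crit] by blast
      have "f (k *s (complexify A *v v)) = 0"
        using van k(1) proj_pt[of q s] unfolding vanishes_def k(3) vector_scalar_commute by metis
      then show ?thesis using form_homogeneous[OF f] k(2) by simp
    qed
  qed
  then show "P \<in> zero_locus {\<lambda>w. f w * residual (Mi *v w)}"
    using in_zero_locus_iff[OF is_form_mult[OF f formM] _ Av, of P] lP by (simp add: vec.span_base)
qed

end

section \<open>Two presentations of the same quartic\<close>

lemma form2_expand:
  fixes f :: "complex ^ 3 \<Rightarrow> complex"
  assumes "is_form 2 f"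
  shows "\<exists>e :: nat \<Rightarrow> complex. \<forall>u v l. f (vector [u, v, l])
    = (e 1 * u^2 + e 2 * (u * v) + e 3 * v^2) + (e 4 * u + e 5 * v) * l + e 6 * l^2"
  using assms
proof (induction rule: is_form_induct)
  case zero
  show ?case by (rule exI[of _ "\<lambda>_. 0"]) simp
next
  case (add f g)
  from add.IH(1) obtain e :: "nat \<Rightarrow> complex" where
    e: "\<forall>u v l. f (vector [u, v, l]) = (e 1 * u^2 + e 2 * (u * v) + e 3 * v^2) + (e 4 * u + e 5 * v) * l + e 6 * l^2"
    by blast
  from add.IH(2) obtain d :: "nat \<Rightarrow> complex" where
    d: "\<forall>u v l. g (vector [u, v, l]) = (d 1 * u^2 + d 2 * (u * v) + d 3 * v^2) + (d 4 * u + d 5 * v) * l + d 6 * l^2"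
    by blast
  show ?case by (rule exI[of _ "\<lambda>i. e i + d i"]) (simp add: e d algebra_simps)
next
  case (monomial k m)
  have m: "m 1 + m 2 + m 3 = 2" using monomial by (simp add: sum_3)
  then have "m 1 = 0 \<or> m 1 = 1 \<or> m 1 = 2" "m 2 = 0 \<or> m 2 = 1 \<or> m 2 = 2" by linarith+
  then consider "m 1 = 2" "m 2 = 0" "m 3 = 0" | "m 1 = 1" "m 2 = 1" "m 3 = 0" | "m 1 = 0" "m 2 = 2" "m 3 = 0"
    | "m 1 = 1" "m 2 = 0" "m 3 = 1" | "m 1 = 0" "m 2 = 1" "m 3 = 1" | "m 1 = 0" "m 2 = 0" "m 3 = 2"
    using m by (elim disjE) simp_all
  then show ?case
  proof cases
    case 1 then show ?thesis by (intro exI[of _ "\<lambda>i. if i = 1 then k else 0"]) (simp add: prod_UNIV_3 vector_3)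
  next
    case 2 then show ?thesis by (intro exI[of _ "\<lambda>i. if i = 2 then k else 0"]) (simp add: prod_UNIV_3 vector_3)
  next
    case 3 then show ?thesis by (intro exI[of _ "\<lambda>i. if i = 3 then k else 0"]) (simp add: prod_UNIV_3 vector_3)
  next
    case 4 then show ?thesis by (intro exI[of _ "\<lambda>i. if i = 4 then k else 0"]) (simp add: prod_UNIV_3 vector_3)
  next
    case 5 then show ?thesis by (intro exI[of _ "\<lambda>i. if i = 5 then k else 0"]) (simp add: prod_UNIV_3 vector_3)
  next
    case 6 then show ?thesis by (intro exI[of _ "\<lambda>i. if i = 6 then k else 0"]) (simp add: prod_UNIV_3 vector_3)
  qed
qed

lemma binary_quadratics_domain:
  fixes a1 a2 a3 b1 b2 b3 :: complex
  assumes "\<And>u v. (a1 * u^2 + a2 * (u * v) + a3 * v^2) * (b1 * u^2 + b2 * (u * v) + b3 * v^2) = 0"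
  shows "a1 = 0 \<and> a2 = 0 \<and> a3 = 0 \<or> b1 = 0 \<and> b2 = 0 \<and> b3 = 0"
proof -
  have "poly ([:a3, a2, a1:] * [:b3, b2, b1:]) u = 0" for u
    using assms[of u 1] by (simp add: power2_eq_square algebra_simps)
  then have "[:a3, a2, a1:] * [:b3, b2, b1:] = 0"
    using poly_all_0_iff_0[of "[:a3, a2, a1:] * [:b3, b2, b1:]"] by (simp only: simp_thms)
  then show ?thesis by (simp only: mult_eq_0_iff) auto
qed

lemma quartic_polynomial_zero:
  fixes c0 c1 c2 c3 c4 :: complex
  assumes "\<And>l. c0 + c1 * l + c2 * l^2 + c3 * l ^ 3 + c4 * l ^ 4 = 0"
  shows "c0 = 0" "c1 = 0" "c2 = 0"
proof -
  have "poly [:c0, c1, c2, c3, c4:] l = 0" for l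
    using assms[of l] by (simp add: power2_eq_square eval_nat_numeral algebra_simps)
  then have "[:c0, c1, c2, c3, c4:] = 0"
    using poly_all_0_iff_0[of "[:c0, c1, c2, c3, c4:]"] by (simp only: simp_thms)
  then show "c0 = 0" "c1 = 0" "c2 = 0" by simp_all
qed

locale two_views = V1: torus_view x y z R r + V2: torus_view x' y' z' R' r'
  for x y z R r x' y' z' R' r' :: complex +
  fixes N Ni :: "complex ^ 3 ^ 3"
  assumes N_inv: "N ** Ni = mat 1" "Ni ** N = mat 1"
begin

lemma Ni_N: "Ni *v (N *v n) = n" and N_Ni: "N *v (Ni *v n) = n"
  by (simp_all add: matrix_vector_mul_assoc N_inv)

text \<open>Singular points go to singular points, so the first line contains both nodes of the second
  quartic. The nodes are written in the basis of \<open>(x', y')\<close> and its quarter turn \<open>(- y', x')\<close>.\<close>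

lemma offset_proportional:
  assumes rel: "\<And>n. V2.quartic (N *v n) = c * V1.quartic n" and c: "c \<noteq> 0"
  shows "\<exists>k. k \<noteq> 0 \<and> (\<forall>n. V2.offset (N *v n) = k * V1.offset n)"
proof -
  define h where "h = csqrt ((r'^2 * (x'^2 + y'^2) - (R'^2 - r'\<^sup>2) * z'^2) / ((R'^2 - r'\<^sup>2) * z'^2))"
  have az: "(R'^2 - r'\<^sup>2) * z'^2 \<noteq> 0" using V2.a0 V2.z0 by simp
  have h2: "(R'^2 - r'\<^sup>2) * z'^2 * h^2 = r'^2 * (x'^2 + y'^2) - (R'^2 - r'\<^sup>2) * z'^2"
    using az by (simp add: h_def)
  have h0: "h \<noteq> 0" using h2 V2.distinct_nodes by auto
  define \<zeta> where "\<zeta> = - (x'^2 + y'^2) / z'"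
  have zz: "z' * \<zeta> = - (x'^2 + y'^2)" using V2.z0 by (simp add: \<zeta>_def)
  define node where "node = (\<lambda>h. vector [x' - h * y', y' + h * x', \<zeta>] :: complex ^ 3)"
  define l where "l = (\<lambda>j. x * Ni $ 1 $ j + y * Ni $ 2 $ j + z * Ni $ 3 $ j)"
  have l: "V1.offset (Ni *v m) = l 1 * m $ 1 + l 2 * m $ 2 + l 3 * m $ 3" for m
    unfolding V1.offset_def l_def matrix_vector_mult_def by (simp add: sum_3) algebra
  have sing: "V1.offset (Ni *v node k) = 0" if "k^2 = h^2" for k
  proof -
    have L: "V2.offset (node k) = 0" unfolding V2.offset_def node_def vector_3 zz by algebra
    have "z'^2 * V2.quadA (node k) = (x'^2 + y'^2) * ((R'^2 - r'\<^sup>2) * z'^2 * k^2 + (R'^2 - r'\<^sup>2) * z'^2 - r'\<^sup>2 * (x'^2 + y'^2))"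
      unfolding V2.quadA_def L power_zero_numeral add_0_right unfolding node_def vector_3 using zz by algebra
    also have "\<dots> = 0" unfolding that h2 by simp
    finally have A: "V2.quadA (node k) = 0" using V2.z0 by simp
    have dF: "((\<lambda>\<tau>. V2.quartic (node k + \<tau> *s g)) has_field_derivative 0) (at 0)" for g
    proof -
      obtain G H where G: "gradient_of V2.quadA G" and H: "gradient_of V2.offset H"
        using form_gradient[OF V2.is_form_quadA] form_gradient[OF V2.is_form_offset] by blast
      have dA: "((\<lambda>\<tau>. V2.quadA (node k + \<tau> *s g)) has_field_derivative (\<Sum>i\<in>UNIV. G i (node k) * g $ i)) (at 0)"
        by (rule gradient_line[OF G])
      have dL: "((\<lambda>\<tau>. V2.offset (node k + \<tau> *s g)) has_field_derivative (\<Sum>i\<in>UNIV. H i (node k) * g $ i)) (at 0)"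
        by (rule gradient_line[OF H])
      have dc: "((\<lambda>\<tau>. (node k + \<tau> *s g) $ i) has_field_derivative g $ i) (at 0)" for i
        by (auto intro!: derivative_eq_intros)
      show ?thesis unfolding V2.quartic_def
        by (rule DERIV_cong, (rule derivative_intros dA dL dc)+) (simp add: A L)
    qed
    have "((\<lambda>\<tau>. V1.quartic (Ni *v node k + \<tau> *s g)) has_field_derivative 0) (at 0)" for g
    proof -
      have "V1.quartic (Ni *v node k + \<tau> *s g) = inverse c * V2.quartic (node k + \<tau> *s (N *v g))" for \<tau>
        using rel[of "Ni *v node k + \<tau> *s g"] c
        by (simp add: matrix_vector_right_distrib vector_scalar_commute N_Ni)
      then show ?thesis using DERIV_cmult[OF dF[of "N *v g"], of "inverse c"] by simp
    qed
    moreover have "V1.quartic (Ni *v node k) = 0"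
      using rel[of "Ni *v node k"] c by (simp add: N_Ni V2.quartic_def A L)
    ultimately have "V1.offset (Ni *v node k) = 0 \<or> Ni *v node k = 0" using V1.quartic_singular by blast
    then show ?thesis by (auto simp: V1.offset_def)
  qed
  have 1: "l 1 * (x' - h * y') + l 2 * (y' + h * x') + l 3 * \<zeta> = 0"
    and 2: "l 1 * (x' - (- h) * y') + l 2 * (y' + (- h) * x') + l 3 * \<zeta> = 0"
    using sing[of h] sing[of "- h"] unfolding l node_def vector_3 by simp_all
  have "2 * h * (l 2 * x' - l 1 * y') = 0" using 1 2 by algebra
  then have a: "l 2 * x' = l 1 * y'" using h0 by simp
  define k' where "k' = l 3 / z'"
  have k': "l 3 = k' * z'" using V2.z0 by (simp add: k'_def)
  have "l 3 * \<zeta> = - k' * (x'^2 + y'^2)" unfolding k' using zz by algebra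
  then have b: "l 1 * x' + l 2 * y' = k' * (x'^2 + y'^2)" using 1 2 by algebra
  have "(x'^2 + y'^2) * l 1 = (x'^2 + y'^2) * (k' * x')" "(x'^2 + y'^2) * l 2 = (x'^2 + y'^2) * (k' * y')"
    using a b by algebra+
  then have l12: "l 1 = k' * x'" "l 2 = k' * y'" using V2.xy0 by simp_all
  have off: "V1.offset n = k' * V2.offset (N *v n)" for n
    using l[of "N *v n"] unfolding Ni_N l12 k' V2.offset_def by algebra
  have "V1.offset (vector [0, 0, 1]) \<noteq> 0" using V1.z0 by (simp add: V1.offset_def vector_3)
  then have "k' \<noteq> 0" using off by auto
  then show ?thesis using off by (intro exI[of _ "inverse k'"]) simp
qed

text \<open>In coordinates \<open>(u, v, l)\<close> with \<open>l = L\<close>, the quartic is \<open>Q^2 - l^2 B\<close>. Its coefficients of \<open>1\<close> and \<open>l\<close> determine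
  \<open>Q\<close> modulo \<open>l^2\<close> up to sign, because binary forms have no zero divisors; then \<open>B\<close> follows from \<open>Q\<close>.\<close>

lemma presentation_shift:
  assumes rel: "\<And>n. V2.quartic (N *v n) = c * V1.quartic n" and c: "c \<noteq> 0"
    and off: "\<And>n. V2.offset (N *v n) = k * V1.offset n" and k: "k \<noteq> 0"
  shows "\<exists>d \<mu>. d \<noteq> 0 \<and> (\<forall>n. V2.quadA (N *v n) = d * (V1.quadA n + \<mu> * (V1.offset n)^2)) \<and>
    (\<forall>n. k^2 * (4 * R'^2 * (((N *v n) $ 1)^2 + ((N *v n) $ 2)^2))
       = d^2 * (4 * R^2 * ((n $ 1)^2 + (n $ 2)^2) + 2 * \<mu> * V1.quadA n + \<mu>^2 * (V1.offset n)^2))"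
proof -
  define T :: "complex ^ 3 ^ 3" where
    "T = vector [vector [1, 0, 0], vector [0, 1, 0], vector [- x / z, - y / z, 1 / z]]"
  have T: "T *v vector [u, v, l] = vector [u, v, (l - x * u - y * v) / z]" for u v l
    by (simp add: T_def vec_eq_iff forall_3 matrix_vector_mult_def sum_3 vector_3 diff_divide_distrib)
  have offT: "V1.offset (T *v vector [u, v, l]) = l" for u v l
    unfolding T V1.offset_def vector_3 using V1.z0 by simp
  define P where "P = (\<lambda>w. V2.quadA (N *v (T *v w)))"
  define Q where "Q = (\<lambda>w. V1.quadA (T *v w))"
  define B1 where "B1 = (\<lambda>n :: complex ^ 3. 4 * R^2 * ((n $ 1)^2 + (n $ 2)^2))"
  define B2 where "B2 = (\<lambda>n :: complex ^ 3. 4 * R'^2 * ((n $ 1)^2 + (n $ 2)^2))"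
  have B: "is_form 2 B1" "is_form 2 B2"
    unfolding B1_def B2_def by (intro is_form_scale is_form_add is_form_coord_square)+
  have "is_form 2 P" unfolding P_def by (intro is_form_matrix[where f = "\<lambda>w. V2.quadA (N *v w)"]
      is_form_matrix[where f = V2.quadA] V2.is_form_quadA)
  from form2_expand[OF this] obtain e :: "nat \<Rightarrow> complex" where
    P: "\<And>u v l. P (vector [u, v, l]) = (e 1 * u^2 + e 2 * (u * v) + e 3 * v^2) + (e 4 * u + e 5 * v) * l + e 6 * l^2"
    by blast
  have "is_form 2 Q" unfolding Q_def by (intro is_form_matrix V1.is_form_quadA)
  from form2_expand[OF this] obtain f :: "nat \<Rightarrow> complex" where
    Q: "\<And>u v l. Q (vector [u, v, l]) = (f 1 * u^2 + f 2 * (u * v) + f 3 * v^2) + (f 4 * u + f 5 * v) * l + f 6 * l^2"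
    by blast
  have "is_form 2 (\<lambda>w. k^2 * B2 (N *v (T *v w)) - c * B1 (T *v w))"
    by (intro is_form_diff is_form_scale is_form_matrix[where f = "\<lambda>w. B2 (N *v w)"]
      is_form_matrix[where f = B1] is_form_matrix[where f = B2] B)
  from form2_expand[OF this] obtain g :: "nat \<Rightarrow> complex" where
    D: "\<And>u v l. k^2 * B2 (N *v (T *v vector [u, v, l])) - c * B1 (T *v vector [u, v, l])
       = (g 1 * u^2 + g 2 * (u * v) + g 3 * v^2) + (g 4 * u + g 5 * v) * l + g 6 * l^2"
    by blast
  have key: "(P w)^2 - k\<^sup>2 * l^2 * B2 (N *v (T *v w)) = c * ((Q w)^2 - l\<^sup>2 * B1 (T *v w))"
    if "w = vector [u, v, l]" for u v l w
    using rel[of "T *v w"] unfolding V2.quartic_def V1.quartic_def off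
    unfolding that offT P_def Q_def B1_def B2_def by algebra
  have zero: "(e 1 * u^2 + e 2 * (u * v) + e 3 * v^2)^2 - c * (f 1 * u^2 + f 2 * (u * v) + f 3 * v^2)^2 = 0"
    "2 * ((e 1 * u^2 + e 2 * (u * v) + e 3 * v^2) * (e 4 * u + e 5 * v)
      - c * (f 1 * u^2 + f 2 * (u * v) + f 3 * v^2) * (f 4 * u + f 5 * v)) = 0" for u v
  proof -
    define p0 p1 q0 q1 g0 g1 where d: "p0 = e 1 * u^2 + e 2 * (u * v) + e 3 * v^2" "p1 = e 4 * u + e 5 * v"
      "q0 = f 1 * u^2 + f 2 * (u * v) + f 3 * v^2" "q1 = f 4 * u + f 5 * v"
      "g0 = g 1 * u^2 + g 2 * (u * v) + g 3 * v^2" "g1 = g 4 * u + g 5 * v"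
    have "(p0^2 - c * q0^2) + 2 * (p0 * p1 - c * q0 * q1) * l
        + (p1^2 + 2 * p0 * e 6 - c * (q1^2 + 2 * q0 * f 6) - g0) * l^2
        + (2 * p1 * e 6 - c * (2 * q1 * f 6) - g1) * l ^ 3 + ((e 6)^2 - c * (f 6)^2 - g 6) * l ^ 4 = 0" for l
    proof -
      have "(p0 + p1 * l + e 6 * l^2)^2 - c * (q0 + q1 * l + f 6 * l^2)^2 = l^2 * (g0 + g1 * l + g 6 * l^2)"
        using key[OF refl, of u v l] D[of u v l] unfolding P Q d by algebra
      then show ?thesis by algebra
    qed
    from quartic_polynomial_zero(1,2)[OF this]
    show "(e 1 * u^2 + e 2 * (u * v) + e 3 * v^2)^2 - c * (f 1 * u^2 + f 2 * (u * v) + f 3 * v^2)^2 = 0"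
      "2 * ((e 1 * u^2 + e 2 * (u * v) + e 3 * v^2) * (e 4 * u + e 5 * v)
      - c * (f 1 * u^2 + f 2 * (u * v) + f 3 * v^2) * (f 4 * u + f 5 * v)) = 0"
      unfolding d by (simp_all only: mult.assoc)
  qed
  define c0 where "c0 = csqrt c"
  have c0: "c0^2 = c" by (simp add: c0_def)
  have "((e 1 - c0 * f 1) * u^2 + (e 2 - c0 * f 2) * (u * v) + (e 3 - c0 * f 3) * v^2)
     * ((e 1 + c0 * f 1) * u^2 + (e 2 + c0 * f 2) * (u * v) + (e 3 + c0 * f 3) * v^2) = 0" for u v
    using zero(1)[of u v] c0 by algebra
  from binary_quadratics_domain[OF this]
  obtain d where d: "d^2 = c" "e 1 = d * f 1" "e 2 = d * f 2" "e 3 = d * f 3"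
  proof
    assume "e 1 - c0 * f 1 = 0 \<and> e 2 - c0 * f 2 = 0 \<and> e 3 - c0 * f 3 = 0"
    then show ?thesis using that[of c0] c0 by simp
  next
    assume "e 1 + c0 * f 1 = 0 \<and> e 2 + c0 * f 2 = 0 \<and> e 3 + c0 * f 3 = 0"
    then show ?thesis using that[of "- c0"] c0 by (simp add: eq_neg_iff_add_eq_0)
  qed
  have d0: "d \<noteq> 0" using d(1) c by auto
  have "(f 1 * u^2 + f 2 * (u * v) + f 3 * v^2) * (0 * u^2 + (e 4 - d * f 4) * (u * v) + (e 5 - d * f 5) * v^2) = 0" for u v
  proof -
    have "2 * d * ((f 1 * u^2 + f 2 * (u * v) + f 3 * v^2) * (0 * u^2 + (e 4 - d * f 4) * (u * v) + (e 5 - d * f 5) * v^2)) = 0"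
      using zero(2)[of u v] unfolding d(2,3,4) d(1)[symmetric] by algebra
    then show ?thesis using d0 by simp
  qed
  from binary_quadratics_domain[OF this]
  have e45: "e 4 = d * f 4" "e 5 = d * f 5"
  proof -
    have "\<not> (f 1 = 0 \<and> f 2 = 0 \<and> f 3 = 0)"
    proof
      assume "f 1 = 0 \<and> f 2 = 0 \<and> f 3 = 0"
      then have "Q (vector [u, v, 0]) = 0" for u v by (simp add: Q)
      then have Q0: "(R^2 - r\<^sup>2) * (u^2 + v^2) - r\<^sup>2 * ((0 - x * u - y * v) / z)^2 = 0" for u v
        unfolding Q_def V1.quadA_def offT unfolding T vector_3 by simp
      have Q1: "z^2 * (R^2 - r\<^sup>2) * (u^2 + v^2) = r^2 * (x * u + y * v)^2" for u v
      proof -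
        have "z * ((0 - x * u - y * v) / z) = - (x * u + y * v)" using V1.z0 by simp
        then show ?thesis using Q0[of u v] by algebra
      qed
      have "z^2 * (R^2 - r\<^sup>2) = r^2 * x^2" "z^2 * (R^2 - r\<^sup>2) = r^2 * y^2"
        "z^2 * (R^2 - r\<^sup>2) * 2 = r^2 * (x + y)^2"
        using Q1[of 1 0] Q1[of 0 1] Q1[of 1 1] by simp_all
      then have "(z^2 * (R^2 - r\<^sup>2))^2 = 0" by algebra
      then show False using V1.z0 V1.a0 by simp
    qed
    then show "e 4 = d * f 4" "e 5 = d * f 5"
      using binary_quadratics_domain[OF \<open>\<And>u v. (f 1 * u^2 + f 2 * (u * v) + f 3 * v^2) * (0 * u^2 + (e 4 - d * f 4) * (u * v) + (e 5 - d * f 5) * v^2) = 0\<close>]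
      by auto
  qed
  define \<mu> where "\<mu> = (e 6 - d * f 6) / d"
  have \<mu>: "e 6 = d * (f 6 + \<mu>)" using d0 by (simp add: \<mu>_def field_simps)
  have PQ: "P (vector [u, v, l]) = d * (Q (vector [u, v, l]) + \<mu> * l^2)" for u v l
    unfolding P Q d(2,3,4) e45 \<mu> by algebra
  have "is_form 2 (\<lambda>w. k^2 * B2 (N *v (T *v w)) - d\<^sup>2 * (B1 (T *v w) + 2 * \<mu> * Q w + \<mu>^2 * (w $ 3)^2))"
    by (intro is_form_diff is_form_add is_form_scale is_form_matrix[where f = "\<lambda>w. B2 (N *v w)"]
      is_form_matrix[where f = B1] is_form_matrix[where f = B2] B \<open>is_form 2 Q\<close> is_form_coord_square)
  from form2_expand[OF this] obtain h :: "nat \<Rightarrow> complex" where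
    H: "\<And>u v l. k^2 * B2 (N *v (T *v vector [u, v, l]))
        - d\<^sup>2 * (B1 (T *v vector [u, v, l]) + 2 * \<mu> * Q (vector [u, v, l]) + \<mu>^2 * l^2)
       = (h 1 * u^2 + h 2 * (u * v) + h 3 * v^2) + (h 4 * u + h 5 * v) * l + h 6 * l^2"
    unfolding vector_3 by blast
  have l2: "l^2 * (k^2 * B2 (N *v (T *v vector [u, v, l]))
        - d\<^sup>2 * (B1 (T *v vector [u, v, l]) + 2 * \<mu> * Q (vector [u, v, l]) + \<mu>^2 * l^2)) = 0" for u v l
    using key[OF refl, of u v l] unfolding PQ d(1)[symmetric] by algebra
  have BB: "k^2 * B2 (N *v (T *v vector [u, v, l]))
        = d^2 * (B1 (T *v vector [u, v, l]) + 2 * \<mu> * Q (vector [u, v, l]) + \<mu>^2 * l^2)" for u v l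
  proof (cases "l = 0")
    case False
    then show ?thesis using l2[of l u v] by simp
  next
    case True
    have "0 + 0 * t + (h 1 * u^2 + h 2 * (u * v) + h 3 * v^2) * t^2 + (h 4 * u + h 5 * v) * t ^ 3 + h 6 * t ^ 4 = 0" for t
      using l2[of t u v] unfolding H by algebra
    from quartic_polynomial_zero(3)[OF this] show ?thesis using H[of u v 0] True by simp
  qed
  have coord: "n = T *v vector [n $ 1, n $ 2, V1.offset n]" for n
    unfolding T V1.offset_def using V1.z0 by (simp add: vec_eq_iff forall_3 vector_3)
  have "V2.quadA (N *v n) = d * (V1.quadA n + \<mu> * (V1.offset n)^2)" for n
    using PQ[of "n $ 1" "n $ 2" "V1.offset n"] unfolding P_def Q_def coord[symmetric] .
  moreover have "k^2 * B2 (N *v n) = d^2 * (B1 n + 2 * \<mu> * V1.quadA n + \<mu>^2 * (V1.offset n)^2)" for n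
    using BB[of "n $ 1" "n $ 2" "V1.offset n"] unfolding Q_def coord[symmetric] .
  ultimately show ?thesis using d0 unfolding B1_def B2_def by blast
qed

end

context torus_view
begin

text \<open>The determinant of the quadratic form \<open>B + 2 \<mu> A + \<mu>^2 L^2\<close> in the shift \<open>\<mu>\<close>.\<close>

definition shift_poly :: "complex poly" where
  "shift_poly = [:0, 1:] * ([:4 * R^2, 2 * (R^2 - r\<^sup>2):] *
     (smult (- 2 * r^2) [:4 * R^2, 2 * (R^2 - r\<^sup>2):]
      + [:2, 1:] * (smult (z^2) [:4 * R^2, 2 * (R^2 - r\<^sup>2):] - smult (2 * r^2 * (x^2 + y^2)) [:0, 1:])))"

lemma shift_poly_nonzero: "shift_poly \<noteq> 0"
proof -
  let ?p = "smult (- 2 * r^2) [:4 * R^2, 2 * (R^2 - r\<^sup>2):]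
      + [:2, 1:] * (smult (z^2) [:4 * R^2, 2 * (R^2 - r\<^sup>2):] - smult (2 * r^2 * (x^2 + y^2)) [:0, 1:])"
  have "poly ?p 0 = 8 * R^2 * K" by (simp add: K_def algebra_simps)
  then have "poly ?p 0 \<noteq> 0" using R0 K0 by simp
  then have "?p \<noteq> 0" by (metis poly_0)
  moreover have "[:4 * R^2, 2 * (R^2 - r\<^sup>2):] \<noteq> 0" using R0 by simp
  ultimately show ?thesis unfolding shift_poly_def by (simp only: mult_eq_0_iff) simp
qed

lemma poly_shift_poly:
  "poly shift_poly \<mu> = \<mu> * ((4 * R^2 + 2 * \<mu> * (R^2 - r\<^sup>2)) *
     (- 2 * r^2 * (4 * R^2 + 2 * \<mu> * (R^2 - r\<^sup>2))
      + (2 + \<mu>) * (z^2 * (4 * R^2 + 2 * \<mu> * (R^2 - r\<^sup>2)) - 2 * r^2 * (x^2 + y^2) * \<mu>)))"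
  unfolding shift_poly_def by (simp add: algebra_simps)

text \<open>A quadratic form that is invariant under translation by \<open>w \<noteq> 0\<close> has \<open>w\<close> in its kernel.\<close>

lemma degenerate_shift:
  fixes w :: "complex ^ 3"
  assumes w: "w \<noteq> 0"
    and inv: "\<And>m. g (w + m) = g m"
    and g: "\<And>n. g n = 4 * R^2 * ((n $ 1)^2 + (n $ 2)^2) + 2 * \<mu> * quadA n + \<mu>^2 * (offset n)^2"
  shows "poly shift_poly \<mu> = 0"
proof -
  define \<beta> where "\<beta> = 4 * R^2 + 2 * \<mu> * (R^2 - r\<^sup>2)"
  define \<nu> where "\<nu> = \<mu> * (2 + \<mu>)"
  define L where "L = offset w"
  define w1 w2 w3 where ws: "w1 = w $ 1" "w2 = w $ 2" "w3 = w $ 3"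
  have L: "L = x * w1 + y * w2 + z * w3" by (simp add: L_def offset_def ws)
  have g': "g n = \<beta> * ((n $ 1)^2 + (n $ 2)^2) - 2 * \<mu> * r^2 * (n $ 3)^2 + \<nu> * (offset n)^2" for n
    unfolding g quadA_def \<beta>_def \<nu>_def by algebra
  have g0: "\<beta> * (w1^2 + w2^2) - 2 * \<mu> * r^2 * w3^2 + \<nu> * L^2 = 0"
    using inv[of 0] unfolding g' by (simp add: ws L_def offset_def)
  have off: "offset (w + m) = L + offset m" for m
    by (simp add: L_def offset_def algebra_simps)
  have pol: "\<beta> * (w1 * m $ 1 + w2 * m $ 2) - 2 * \<mu> * r^2 * (w3 * m $ 3) + \<nu> * (L * offset m) = 0" for m
  proof -
    have "2 * (\<beta> * (w1 * m $ 1 + w2 * m $ 2) - 2 * \<mu> * r^2 * (w3 * m $ 3) + \<nu> * (L * offset m)) = 0"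
      using inv[of m] g0 unfolding g' off vector_add_component ws[symmetric] by algebra
    then show ?thesis by (simp only: mult_eq_0_iff) simp
  qed
  have 1: "\<beta> * w1 + \<nu> * L * x = 0" and 2: "\<beta> * w2 + \<nu> * L * y = 0"
    and 3: "- 2 * \<mu> * r^2 * w3 + \<nu> * L * z = 0"
    using pol[of "vector [1, 0, 0]"] pol[of "vector [0, 1, 0]"] pol[of "vector [0, 0, 1]"]
    unfolding offset_def vector_3 by (simp_all add: algebra_simps)
  have P: "poly shift_poly \<mu> = \<mu> * (\<beta> * (- 2 * r^2 * \<beta> + (2 + \<mu>) * (z^2 * \<beta> - 2 * r^2 * (x^2 + y^2) * \<mu>)))"
    unfolding poly_shift_poly \<beta>_def ..
  show ?thesis
  proof (cases "L = 0")
    case True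
    have "\<beta> * w1 = 0" "\<beta> * w2 = 0" "\<mu> * r^2 * w3 = 0" using 1 2 3 True by simp_all
    moreover have "w1 \<noteq> 0 \<or> w2 \<noteq> 0 \<or> w3 \<noteq> 0"
      using w by (auto simp: ws vec_eq_iff forall_3)
    ultimately have "\<beta> = 0 \<or> \<mu> = 0" using r0 by auto
    then show ?thesis unfolding P by auto
  next
    case False
    have "L * (\<mu> * (- 2 * r^2 * \<beta> + (2 + \<mu>) * (z^2 * \<beta> - 2 * r^2 * (x^2 + y^2) * \<mu>))) = 0"
      using 1 2 3 unfolding L \<nu>_def by algebra
    then have "\<mu> * (- 2 * r^2 * \<beta> + (2 + \<mu>) * (z^2 * \<beta> - 2 * r^2 * (x^2 + y^2) * \<mu>)) = 0"
      using False by (simp only: mult_eq_0_iff simp_thms)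
    then show ?thesis unfolding P by (simp only: mult.left_commute[of \<mu> \<beta>] mult_zero_right)
  qed
qed

end

definition sumsq :: "complex ^ 3 \<Rightarrow> complex" where
  "sumsq w = (w $ 1)^2 + (w $ 2)^2 + (w $ 3)^2"

lemma is_form_sumsq: "is_form 2 sumsq"
  unfolding sumsq_def[abs_def] by (intro is_form_add is_form_coord_square)

text \<open>The left-hand side has rank at most one, so all two-by-two minors of the right-hand side vanish.
  The vectors \<open>(x, y)\<close> and \<open>z\<close> are nonzero, so this leaves only the square of the last coordinate.\<close>

lemma (in torus_view) rank_one_rigidity:
  assumes d: "d \<noteq> 0"
    and sq: "\<And>m. \<rho> * (n1 * m $ 1 + n2 * m $ 2 + n3 * m $ 3)^2
       = e * ((m $ 1)^2 + (m $ 2)^2) + d * (m $ 3)^2 + g * (offset m)^2"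
  shows "e = 0 \<and> g = 0"
proof -
  have v: "\<rho> * (n1 * m1 + n2 * m2 + n3 * m3)^2
       = e * (m1^2 + m2^2) + d * m3^2 + g * (x * m1 + y * m2 + z * m3)^2" for m1 m2 m3
    using sq[of "vector [m1, m2, m3]"] by (simp add: offset_def vector_3)
  have 11: "\<rho> * n1^2 = e + g * x^2" and 22: "\<rho> * n2^2 = e + g * y^2" and 33: "\<rho> * n3^2 = d + g * z^2"
    using v[of 1 0 0] v[of 0 1 0] v[of 0 0 1] by simp_all
  have "\<rho> * (n1 + n2)^2 = 2 * e + g * (x + y)^2" "\<rho> * (n1 + n3)^2 = e + d + g * (x + z)^2"
    "\<rho> * (n2 + n3)^2 = e + d + g * (y + z)^2"
    using v[of 1 1 0] v[of 1 0 1] v[of 0 1 1] by simp_all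
  then have "2 * (\<rho> * (n1 * n2)) = 2 * (g * (x * y))" "2 * (\<rho> * (n1 * n3)) = 2 * (g * (x * z))"
    "2 * (\<rho> * (n2 * n3)) = 2 * (g * (y * z))"
    using 11 22 33 by algebra+
  then have 12: "\<rho> * (n1 * n2) = g * (x * y)" and 13: "\<rho> * (n1 * n3) = g * (x * z)"
    and 23: "\<rho> * (n2 * n3) = g * (y * z)" by simp_all
  have "e * g * z * y = 0" "e * g * z * x = 0" using 11 22 12 13 23 by algebra+
  moreover have "x \<noteq> 0 \<or> y \<noteq> 0" using xy0 by auto
  ultimately have eg: "e * g = 0" using z0 by auto
  have "e * e = 0" using 11 22 12 eg by algebra
  then have e: "e = 0" by simp
  have "g * d * x^2 = 0" "g * d * y^2 = 0" using 11 22 33 13 23 unfolding e by algebra+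
  then have "g = 0" using d \<open>x \<noteq> 0 \<or> y \<noteq> 0\<close> by auto
  then show ?thesis using e by simp
qed

text \<open>Substituting the known relations into \<open>A = a (u^2 + v^2) - r^2 t^2 + L^2\<close> expresses the square of the new
  \<open>t\<close> by \<open>u^2 + v^2\<close>, \<open>t^2\<close> and \<open>L^2\<close>. Rigidity makes it a multiple of \<open>t^2\<close>, and the vanishing of the
  coefficient of \<open>u^2 + v^2\<close> equates the two ratios \<open>R : r\<close>, so that both factors coincide.\<close>

lemma (in two_views) same_presentation_conformal:
  assumes A: "\<And>m. V2.quadA (N *v m) = d * V1.quadA m" and L: "\<And>m. V2.offset (N *v m) = j * V1.offset m"
    and B: "\<And>m. R'^2 * (((N *v m) $ 1)^2 + ((N *v m) $ 2)^2) = q * R^2 * ((m $ 1)^2 + (m $ 2)^2)"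
    and d: "d \<noteq> 0" and q: "q * j^2 = d^2"
  shows "\<exists>s. s \<noteq> 0 \<and> (\<forall>m. sumsq (N *v m) = s * sumsq m)"
proof -
  define a a' where "a = R^2 - r\<^sup>2" and "a' = R'^2 - r'\<^sup>2"
  define e where "e = a' * q * R^2 / R'^2 - d * a"
  have e: "R'^2 * e = a' * q * R^2 - R'\<^sup>2 * d * a" using V2.R0 by (simp add: e_def field_simps)
  have row: "(N *v m) $ 3 = N $ 3 $ 1 * m $ 1 + N $ 3 $ 2 * m $ 2 + N $ 3 $ 3 * m $ 3" for m
    by (simp add: matrix_vector_mult_def sum_3)
  have third: "r'^2 * ((N *v m) $ 3)^2 = e * ((m $ 1)^2 + (m $ 2)^2) + d * r^2 * (m $ 3)^2 + (j^2 - d) * (V1.offset m)^2" for m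
  proof -
    have "R'^2 * (r'^2 * ((N *v m) $ 3)^2)
        = R'^2 * (e * ((m $ 1)^2 + (m $ 2)^2) + d * r^2 * (m $ 3)^2 + (j^2 - d) * (V1.offset m)^2)"
      using A[of m] B[of m] L[of m] e unfolding V2.quadA_def V1.quadA_def a_def a'_def by algebra
    then show ?thesis using V2.R0 by simp
  qed
  have "d * r^2 \<noteq> 0" using d V1.r0 by simp
  from V1.rank_one_rigidity[OF this third[unfolded row]]
  have e0: "e = 0" and jd: "j^2 = d" by simp_all
  have "q = d" using q d unfolding jd by (simp add: power2_eq_square)
  define s where "s = d * R^2 / R'^2"
  have s: "R'^2 * s = d * R^2" using V2.R0 by (simp add: s_def)
  have "d * (a' * R^2) = d * (R'^2 * a)" using e unfolding e0 \<open>q = d\<close> by algebra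
  then have rr: "r'^2 * R^2 = R'^2 * r^2" using d unfolding a_def a'_def by (simp add: algebra_simps)
  have "sumsq (N *v m) = s * sumsq m" for m
  proof -
    have 12: "R'^2 * (((N *v m) $ 1)^2 + ((N *v m) $ 2)^2) = R'^2 * (s * ((m $ 1)^2 + (m $ 2)^2))"
      using B[of m] s unfolding \<open>q = d\<close> by algebra
    have "R^2 * r'^2 * ((N *v m) $ 3)^2 = R^2 * r'^2 * (s * (m $ 3)^2)"
      using third[of m] s rr unfolding e0 jd by algebra
    then have "((N *v m) $ 3)^2 = s * (m $ 3)^2" using V1.R0 V2.r0 by simp
    moreover have "((N *v m) $ 1)^2 + ((N *v m) $ 2)^2 = s * ((m $ 1)^2 + (m $ 2)^2)"
      using 12 V2.R0 by simp
    ultimately show ?thesis unfolding sumsq_def by algebra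
  qed
  moreover have "s \<noteq> 0" using d V1.R0 V2.R0 by (simp add: s_def)
  ultimately show ?thesis by blast
qed

text \<open>By polarisation the bilinear form is multiplied by \<open>s\<close> as well.\<close>

lemma conformal_transpose:
  fixes N :: "complex ^ 3 ^ 3"
  assumes "\<And>m. sumsq (N *v m) = s * sumsq m"
  shows "transpose N *v (N *v w) = s *s w"
proof -
  have v: "(N *v v) $ 1 * (N *v w) $ 1 + (N *v v) $ 2 * (N *v w) $ 2 + (N *v v) $ 3 * (N *v w) $ 3
      = s * (v $ 1 * w $ 1 + v $ 2 * w $ 2 + v $ 3 * w $ 3)" for v
  proof -
    have "2 * ((N *v v) $ 1 * (N *v w) $ 1 + (N *v v) $ 2 * (N *v w) $ 2 + (N *v v) $ 3 * (N *v w) $ 3)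
      = 2 * (s * (v $ 1 * w $ 1 + v $ 2 * w $ 2 + v $ 3 * w $ 3))"
      using assms[of "v + w"] assms[of v] assms[of w]
      unfolding sumsq_def matrix_vector_right_distrib vector_add_component by algebra
    then show ?thesis by (subst (asm) mult_cancel_left) simp
  qed
  have "\<forall>j. (N *v axis j 1) $ i = N $ i $ j" for i
    unfolding forall_3 by (simp add: matrix_vector_mult_def sum_3 axis_def)
  then have col: "(N *v axis j 1) $ i = N $ i $ j" for i j by blast
  have "(transpose N *v (N *v w)) $ i = (s *s w) $ i" for i
  proof -
    have "(transpose N *v (N *v w)) $ i
       = (N *v axis i 1) $ 1 * (N *v w) $ 1 + (N *v axis i 1) $ 2 * (N *v w) $ 2 + (N *v axis i 1) $ 3 * (N *v w) $ 3"
      unfolding col by (simp add: matrix_vector_mult_def transpose_def sum_3)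
    also have "\<dots> = s * ((axis i 1 :: complex ^ 3) $ 1 * w $ 1 + (axis i 1 :: complex ^ 3) $ 2 * w $ 2 + (axis i 1 :: complex ^ 3) $ 3 * w $ 3)"
      by (rule v)
    also have "\<dots> = s * w $ i"
    proof -
      have "\<forall>i. (axis i 1 :: complex ^ 3) $ 1 * w $ 1 + (axis i 1 :: complex ^ 3) $ 2 * w $ 2 + (axis i 1 :: complex ^ 3) $ 3 * w $ 3 = w $ i"
        unfolding forall_3 by (simp add: axis_def)
      then show ?thesis by simp
    qed
    finally show ?thesis by simp
  qed
  then show ?thesis by (simp add: vec_eq_iff)
qed

section \<open>The picture determines the dual quartic\<close>

context torus_view
begin

text \<open>If the contour lay in a line, all its tangent lines would coincide.\<close>

lemma linear_not_vanishing:
  assumes "(c :: complex ^ 3) \<noteq> 0"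
  shows "\<not> vanishes (\<lambda>q s. c $ 1 * contour q s $ 1 + c $ 2 * contour q s $ 2 + c $ 3 * contour q s $ 3)"
proof
  assume van: "vanishes (\<lambda>q s. c $ 1 * contour q s $ 1 + c $ 2 * contour q s $ 2 + c $ 3 * contour q s $ 3)"
  define f where "f = (\<lambda>w :: complex ^ 3. c $ 1 * w $ 1 + c $ 2 * w $ 2 + c $ 3 * w $ 3)"
  have f: "is_form 1 f" unfolding f_def by (intro is_form_add is_form_scale is_form_coord)
  have G: "gradient_of f (\<lambda>i v. c $ i)"
    unfolding gradient_of_def f_def
  proof (intro allI impI)
    fix \<gamma> :: "complex \<Rightarrow> complex ^ 3" and \<gamma>' t
    assume \<gamma>: "\<forall>i. ((\<lambda>\<tau>. \<gamma> \<tau> $ i) has_field_derivative \<gamma>' $ i) (at t)"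
    show "((\<lambda>\<tau>. c $ 1 * \<gamma> \<tau> $ 1 + c $ 2 * \<gamma> \<tau> $ 2 + c $ 3 * \<gamma> \<tau> $ 3) has_field_derivative
        (\<Sum>i\<in>UNIV. c $ i * \<gamma>' $ i)) (at t)"
      unfolding sum_3 by (intro DERIV_add DERIV_cmult \<gamma>[rule_format])
  qed
  have n: "c $ i = (c $ 1 + \<i> * c $ 2) * nvec q s $ i" if "on_curve q s" for q s i
    by (rule gradient_is_normal[OF f G is_form_const _ that]) (use van in \<open>simp add: f_def\<close>)
  have "c $ 2 = 0" using n[OF on_curve_csqrt[of 1], of 2] by (simp add: nvec_def vector_3 vv_def)
  moreover from this have "c $ 1 = 0"
    using n[OF on_curve_0, of 2] by (simp add: nvec_def vector_3 vv_def)
  moreover from calculation have "c $ 3 = 0" using n[OF on_curve_0, of 3] by simp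
  ultimately show False using assms by (simp add: vec_eq_iff forall_3)
qed

lemma gradient_of_matrix:
  fixes M :: "complex ^ 3 ^ 3"
  assumes "gradient_of f G"
  shows "gradient_of (\<lambda>w. f (M *v w)) (\<lambda>j w. (transpose M *v (\<chi> i. G i (M *v w))) $ j)"
  unfolding gradient_of_def
proof (intro allI impI)
  fix \<gamma> :: "complex \<Rightarrow> complex ^ 3" and \<gamma>' t
  assume \<gamma>: "\<forall>i. ((\<lambda>\<tau>. \<gamma> \<tau> $ i) has_field_derivative \<gamma>' $ i) (at t)"
  have "((\<lambda>\<tau>. (M *v \<gamma> \<tau>) $ i) has_field_derivative (M *v \<gamma>') $ i) (at t)" for i
    unfolding matrix_vector_mult_def vec_lambda_beta sum_3
    by (intro DERIV_add DERIV_cmult \<gamma>[rule_format])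
  from gradient_ofD[OF assms this]
  have "((\<lambda>\<tau>. f (M *v \<gamma> \<tau>)) has_field_derivative (\<Sum>i\<in>UNIV. G i (M *v \<gamma> t) * (M *v \<gamma>') $ i)) (at t)" .
  moreover have "(\<Sum>i\<in>UNIV. g i * (M *v \<gamma>') $ i) = (\<Sum>j\<in>UNIV. (transpose M *v (\<chi> i. g i)) $ j * \<gamma>' $ j)" for g
  proof -
    have "(\<Sum>i\<in>UNIV. g i * (M *v \<gamma>') $ i) = (\<Sum>i\<in>UNIV. \<Sum>j\<in>UNIV. M $ i $ j * g i * \<gamma>' $ j)"
      by (simp add: matrix_vector_mult_def sum_distrib_left mult_ac)
    also have "\<dots> = (\<Sum>j\<in>UNIV. \<Sum>i\<in>UNIV. M $ i $ j * g i * \<gamma>' $ j)" by (rule sum.swap)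
    also have "\<dots> = (\<Sum>j\<in>UNIV. (transpose M *v (\<chi> i. g i)) $ j * \<gamma>' $ j)"
      unfolding matrix_vector_mult_def transpose_def vec_lambda_beta sum_distrib_right ..
    finally show ?thesis .
  qed
  ultimately show "((\<lambda>\<tau>. f (M *v \<gamma> \<tau>)) has_field_derivative
     (\<Sum>j\<in>UNIV. (transpose M *v (\<chi> i. G i (M *v \<gamma> t))) $ j * \<gamma>' $ j)) (at t)" by simp
qed

lemma gradient_of_sumsq: "gradient_of sumsq (\<lambda>i v. 2 * v $ i)"
  unfolding gradient_of_def
proof (intro allI impI)
  fix \<gamma> :: "complex \<Rightarrow> complex ^ 3" and \<gamma>' t
  assume \<gamma>: "\<forall>i. ((\<lambda>\<tau>. \<gamma> \<tau> $ i) has_field_derivative \<gamma>' $ i) (at t)"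
  have "((\<lambda>\<tau>. (\<gamma> \<tau> $ i)^2) has_field_derivative 2 * \<gamma> t $ i * \<gamma>' $ i) (at t)" for i
    using DERIV_power[OF \<gamma>[rule_format, of i], of 2] by (simp add: mult_ac)
  then show "((\<lambda>\<tau>. sumsq (\<gamma> \<tau>)) has_field_derivative (\<Sum>i\<in>UNIV. 2 * \<gamma> t $ i * \<gamma>' $ i)) (at t)"
    unfolding sumsq_def sum_3 by (intro DERIV_add)
qed

text \<open>The dual of a smooth conic is a conic, but by \<open>low_form_vanishing\<close> no quadratic form vanishes on the
  dual curve.\<close>

lemma conic_not_vanishing:
  fixes X :: "complex ^ 3 ^ 3"
  assumes X: "X ** Xi = mat 1" "Xi ** X = mat 1"
  shows "\<not> vanishes (\<lambda>q s. sumsq (X *v contour q s))"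
proof
  assume van: "vanishes (\<lambda>q s. sumsq (X *v contour q s))"
  define G where "G = (\<lambda>i w. (transpose X *v (\<chi> k. 2 * (X *v w) $ k)) $ i)"
  have G: "gradient_of (\<lambda>w. sumsq (X *v w)) G"
    unfolding G_def by (rule gradient_of_matrix[OF gradient_of_sumsq])
  have f: "is_form 2 (\<lambda>w. sumsq (X *v w))" by (rule is_form_matrix[OF is_form_sumsq])
  have Gf: "is_form 1 (G i)" for i
  proof -
    have "is_form 1 (\<lambda>w. (X *v w) $ k)" for k
      by (rule is_form_matrix[OF is_form_coord])
    then show ?thesis unfolding G_def matrix_vector_mult_def[of "transpose X"] vec_lambda_beta
      by (intro is_form_sum is_form_scale)
  qed
  define \<mu> where "\<mu> = (\<lambda>q s. G 1 (contour q s) + \<i> * G 2 (contour q s))"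
  have \<mu>: "regular_fun 4 (\<lambda>q s. \<mu> q s)"
    unfolding \<mu>_def by (intro regular_add regular_scale regular_form[OF Gf regular_contour, simplified])
  have tX: "transpose Xi *v (transpose X *v v) = v" "transpose X *v (transpose Xi *v v) = v" for v
    by (simp_all only: matrix_vector_mul_assoc matrix_transpose_mul[symmetric] X transpose_mat
        matrix_vector_mul_lid)
  have n: "2 *s (X *v contour q s) = \<mu> q s *s (transpose Xi *v nvec q s)" if c: "on_curve q s" for q s
  proof -
    have "transpose X *v (2 *s (X *v contour q s)) = \<mu> q s *s nvec q s"
    proof -
      have "(transpose X *v (2 *s (X *v contour q s))) $ i = (\<mu> q s *s nvec q s) $ i" for i
      proof -
        have "(\<chi> k. 2 * (X *v contour q s) $ k) = 2 *s (X *v contour q s)" by (simp add: vec_eq_iff)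
        then show ?thesis
          using gradient_is_normal[OF f G Gf van c, of i] unfolding \<mu>_def G_def
            by (simp add: algebra_simps)
      qed
      then show ?thesis by (simp add: vec_eq_iff)
    qed
    then show ?thesis using tX(1)[of "2 *s (X *v contour q s)"] by (simp add: vector_scalar_commute)
  qed
  have "vanishes (\<lambda>q s. (\<mu> q s * \<mu> q s) * sumsq (transpose Xi *v nvec q s))"
    unfolding vanishes_def
  proof (intro allI impI)
    fix q s assume c: "on_curve q s"
    have "sumsq (2 *s (X *v contour q s)) = 0"
      using van c unfolding form_homogeneous[OF is_form_sumsq] vanishes_def by simp
    then show "(\<mu> q s * \<mu> q s) * sumsq (transpose Xi *v nvec q s) = 0"
      unfolding n[OF c] form_homogeneous[OF is_form_sumsq] by (simp add: power2_eq_square)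
  qed
  moreover have f2: "is_form 2 (\<lambda>w. sumsq (transpose Xi *v w))" by (rule is_form_matrix[OF is_form_sumsq])
  ultimately have "vanishes (\<lambda>q s. \<mu> q s * \<mu> q s) \<or> vanishes (\<lambda>q s. sumsq (transpose Xi *v nvec q s))"
    using vanishes_mult[OF regular_mult[OF \<mu> \<mu>] regular_form[OF f2 regular_nvec]] by blast
  then show False
  proof
    assume "vanishes (\<lambda>q s. \<mu> q s * \<mu> q s)"
    then have "\<mu> 0 al = 0" using on_curve_0 by (auto simp: vanishes_def)
    then have "2 *s (X *v contour 0 al) = 0" using n[OF on_curve_0] by simp
    then have "X *v contour 0 al = 0" by (simp add: vec_eq_iff)
    then have "Xi *v (X *v contour 0 al) = 0" by simp
    then have "contour 0 al = 0" by (simp add: matrix_vector_mul_assoc X)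
    then have "contour 0 al $ 1 = 0" by simp
    then show False using kk_0 R0 by (simp add: contour_def vector_3 uu_def)
  next
    assume "vanishes (\<lambda>q s. sumsq (transpose Xi *v nvec q s))"
    from low_form_vanishing[OF f2 _ this, of "transpose X *v vector [1, 0, 0]"]
    show False unfolding tX by (simp add: sumsq_def vector_3)
  qed
qed

end

section \<open>Two cameras with the same picture\<close>

lemma transpose_inverse:
  fixes M :: "complex ^ 3 ^ 3"
  assumes "M ** Mi = mat 1"
  shows "transpose Mi ** transpose M = mat 1" "transpose Mi *v (transpose M *v v) = v"
proof -
  show *: "transpose Mi ** transpose M = mat 1"
    using assms by (simp only: matrix_transpose_mul[symmetric] transpose_mat)
  show "transpose Mi *v (transpose M *v v) = v"
    by (simp only: matrix_vector_mul_assoc * matrix_vector_mul_lid)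
qed

context torus_camera
begin

lemma M_Mi: "M *v (Mi *v w) = w" and Mi_M: "Mi *v (M *v w) = w"
  by (simp_all add: matrix_vector_mul_assoc inv)

lemma proj_image_absolute: "proj_image A euclidean_absolute = zero_locus {\<lambda>w. sumsq (Mi *v w)}"
proof (intro subset_antisym subsetI)
  have fM: "is_form 2 (\<lambda>w. sumsq (Mi *v w))" by (rule is_form_matrix[OF is_form_sumsq])
  fix P assume "P \<in> proj_image A euclidean_absolute"
  then obtain p where p: "p \<in> euclidean_absolute" "P = proj_map A p" unfolding proj_image_def by blast
  obtain v where v: "v \<noteq> 0" "line p = vec.span {v}" using line_generator by blast
  then have vp: "v \<in> line p" by (simp add: vec.span_base)
  then have v4: "v $ 4 = 0" and sq: "(v $ 1)^2 + (v $ 2)^2 + (v $ 3)^2 = 0"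
    using p(1) unfolding euclidean_absolute_def zero_locus_def by auto
  have Mi: "Mi *v (complexify A *v v) = vector [v $ 1, v $ 2, v $ 3]"
    unfolding proj Mi_M v4 by simp
  have Av: "complexify A *v v \<noteq> 0"
  proof
    assume "complexify A *v v = 0"
    then have "(vector [v $ 1, v $ 2, v $ 3] :: complex ^ 3) = 0" using Mi by simp
    then have "v = 0" using v4 by (simp add: vec_eq_iff forall_3 forall_4 vector_3)
    then show False using v(1) by simp
  qed
  have "complexify A *v v \<in> line P"
    unfolding p(2) line_proj_map[OF vp v(1) Av] by (simp add: vec.span_base)
  then show "P \<in> zero_locus {\<lambda>w. sumsq (Mi *v w)}"
    using in_zero_locus_iff[OF fM _ Av] sq unfolding Mi by (simp add: sumsq_def vector_3)
next
  fix P assume P: "P \<in> zero_locus {\<lambda>w. sumsq (Mi *v w)}"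
  obtain w where w: "w \<noteq> 0" "line P = vec.span {w}" using line_generator by blast
  define n where "n = Mi *v w"
  define v where "v = (vector [n $ 1, n $ 2, n $ 3, 0] :: complex ^ 4)"
  have "vector [n $ 1, n $ 2, n $ 3] = n" by (simp add: vec_eq_iff forall_3 vector_3)
  then have Av: "complexify A *v v = w" unfolding proj v_def vector_4 by (simp add: n_def M_Mi)
  then have v0: "v \<noteq> 0" using w(1) by auto
  let ?p = "Point (vec.span {v})"
  have lp: "line ?p = vec.span {v}" by (rule span_line[OF v0])
  then have vp: "v \<in> line ?p" by (simp add: vec.span_base)
  have "sumsq n = 0" using P w(2) unfolding zero_locus_def n_def by (auto simp: vec.span_base)
  then have "(v $ 1)^2 + (v $ 2)^2 + (v $ 3)^2 = 0" "v $ 4 = 0"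
    by (simp_all add: v_def vector_4 sumsq_def)
  moreover have c4: "is_form 1 (\<lambda>v :: complex ^ 4. v $ 4)" by (rule is_form_coord)
  moreover have c2: "is_form 2 (\<lambda>v :: complex ^ 4. (v $ 1)^2 + (v $ 2)^2 + (v $ 3)^2)"
    by (intro is_form_add is_form_coord_square)
  ultimately have "?p \<in> zero_locus {\<lambda>v. v $ 4}" "?p \<in> zero_locus {\<lambda>v. (v $ 1)^2 + (v $ 2)^2 + (v $ 3)^2}"
    using in_zero_locus_iff[OF c4 vp v0] in_zero_locus_iff[OF c2 vp v0] by simp_all
  then have "?p \<in> euclidean_absolute" unfolding euclidean_absolute_def zero_locus_def by auto
  moreover have "?p \<noteq> center A"
  proof
    assume "?p = center A"
    then have "complexify A *v v = 0" using vp line_center kernel by simp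
    then show False using Av w(1) by simp
  qed
  moreover have "proj_map A ?p = P"
    using line_proj_map[OF vp v0] Av w line_inject by metis
  ultimately show "P \<in> proj_image A euclidean_absolute" unfolding proj_image_def by blast
qed

lemma is_conic_absolute: "is_conic (proj_image A euclidean_absolute)"
proof -
  have "sumsq (Mi *v (M *v vector [1, 0, 0])) \<noteq> 0"
    unfolding Mi_M by (simp add: sumsq_def vector_3)
  then have "(\<lambda>w. sumsq (Mi *v w)) \<noteq> (\<lambda>w. 0)" by metis
  then show ?thesis
    unfolding is_conic_def proj_image_absolute using is_form_matrix[OF is_form_sumsq] by blast
qed

lemma regular_image: "regular_fun 4 (\<lambda>q s. (M *v contour q s) $ i)"
  unfolding matrix_vector_mult_def vec_lambda_beta by (intro regular_sum regular_scale regular_contour)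

text \<open>The three functions describe a fixed reference presentation on the dual of the image plane. Only
  the shift \<open>\<mu>\<close> is recorded, since the factors \<open>k\<close> and \<open>d\<close> do not affect the conic.\<close>

definition shifted :: "(complex ^ 3 \<Rightarrow> complex) \<Rightarrow> (complex ^ 3 \<Rightarrow> complex) \<Rightarrow> (complex ^ 3 \<Rightarrow> complex) \<Rightarrow> complex \<Rightarrow> bool" where
  "shifted A0 L0 B0 \<mu> \<longleftrightarrow> (\<exists>k d. k \<noteq> 0 \<and> d \<noteq> 0 \<and>
     (\<forall>l. quadA (transpose M *v l) = d * (A0 l + \<mu> * (L0 l)^2)) \<and>
     (\<forall>l. offset (transpose M *v l) = k * L0 l) \<and>
     (\<forall>l. k^2 * (4 * R^2 * (((transpose M *v l) $ 1)^2 + ((transpose M *v l) $ 2)^2))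
       = d^2 * (B0 l + 2 * \<mu> * A0 l + \<mu>^2 * (L0 l)^2)))"

end

locale two_cameras = C1: torus_camera x y z R r a b A M Mi + C2: torus_camera x' y' z' R' r' a' b' A' M' Mi'
  for x y z R r a b A M Mi x' y' z' R' r' a' b' A' M' Mi' +
  assumes same_picture: "picture A (torus a b) = picture A' (torus a' b')"
begin

sublocale two_views x y z R r x' y' z' R' r' "transpose M' ** transpose Mi" "transpose M ** transpose Mi'"
proof
  have t: "transpose Mi ** transpose M = mat 1" "transpose M ** transpose Mi = mat 1"
    "transpose Mi' ** transpose M' = mat 1" "transpose M' ** transpose Mi' = mat 1"
    using transpose_inverse(1) C1.inv C2.inv by blast+
  show "transpose M' ** transpose Mi ** (transpose M ** transpose Mi') = mat 1"
    by (metis t matrix_mul_assoc matrix_mul_rid)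
  show "transpose M ** transpose Mi' ** (transpose M' ** transpose Mi) = mat 1"
    by (metis t matrix_mul_assoc matrix_mul_rid)
qed

abbreviation N where "N \<equiv> transpose M' ** transpose Mi"

lemma N_transpose: "N *v (transpose M *v l) = transpose M' *v l"
  using transpose_inverse(2)[OF C1.inv(1)]
  by (simp only: matrix_vector_mul_assoc[symmetric])

text \<open>After multiplication with the residual line and conic of the first camera the form vanishes on all critical
  values, a condition that only depends on the picture. The second contour lies neither on that
  line nor on that conic, so the extra factor can be cancelled.\<close>

lemma transfer:
  assumes f: "is_form d f" and van: "C1.vanishes (\<lambda>q s. f (M *v C1.contour q s))"
  shows "C2.vanishes (\<lambda>q s. f (M' *v C2.contour q s))"
proof -
  let ?h = "\<lambda>w. f w * C1.residual (Mi *v w)"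
  let ?X = "Mi ** M'"
  have h: "is_form (d + 3) ?h"
    by (intro is_form_mult f is_form_matrix[OF C1.is_form_residual])
  have "picture A (torus a b) \<subseteq> zero_locus {?h}"
    unfolding picture_def closure_subset_zero_locus[OF h] by (rule C1.critical_of_vanishes[OF f van])
  then have "proj_map A' ` critical_points A' (torus a' b') \<subseteq> zero_locus {?h}"
    unfolding same_picture unfolding picture_def closure_subset_zero_locus[OF h] .
  then have van2: "C2.vanishes (\<lambda>q s. f (M' *v C2.contour q s) * C1.residual (Mi *v (M' *v C2.contour q s)))"
    by (rule C2.vanishes_of_critical[OF h])
  define c where "c = (\<chi> j. y * ?X $ 1 $ j - x * ?X $ 2 $ j)"
  define lin where "lin = (\<lambda>w :: complex ^ 3. c $ 1 * w $ 1 + c $ 2 * w $ 2 + c $ 3 * w $ 3)"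
  have X: "?X ** (Mi' ** M) = mat 1" "(Mi' ** M) ** ?X = mat 1"
    by (metis C1.inv C2.inv matrix_mul_assoc matrix_mul_rid)+
  have res: "C1.residual (Mi *v (M' *v w)) = sumsq (?X *v w) * lin w" for w
  proof -
    have "y * (?X *v w) $ 1 - x * (?X *v w) $ 2 = lin w"
      unfolding lin_def c_def matrix_vector_mult_def[of ?X] vec_lambda_beta sum_3 by algebra
    then show ?thesis
      unfolding matrix_vector_mul_assoc C1.residual_def sumsq_def by simp
  qed
  have "c \<noteq> 0"
  proof
    assume "c = 0"
    then have l0: "lin w = 0" for w by (simp add: lin_def)
    have "y * (?X *v w) $ 1 - x * (?X *v w) $ 2 = lin w" for w
      unfolding lin_def c_def matrix_vector_mult_def[of ?X] vec_lambda_beta sum_3 by algebra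
    then have "y * (?X *v ((Mi' ** M) *v v)) $ 1 - x * (?X *v ((Mi' ** M) *v v)) $ 2 = 0" for v
      using l0 by simp
    then have e: "y * v $ 1 - x * v $ 2 = 0" for v :: "complex ^ 3"
      by (simp add: matrix_vector_mul_assoc X)
    show False using e[of "vector [y, - x, 0]"] C1.xy0
      by (simp add: vector_3 power2_eq_square add.commute)
  qed
  then have nl: "\<not> C2.vanishes (\<lambda>q s. lin (C2.contour q s))"
    unfolding lin_def by (rule C2.linear_not_vanishing)
  have nq: "\<not> C2.vanishes (\<lambda>q s. sumsq (?X *v C2.contour q s))"
    by (rule C2.conic_not_vanishing[OF X])
  have lf: "is_form 1 lin" unfolding lin_def by (intro is_form_add is_form_scale is_form_coord)
  have rq: "C2.regular_fun (2 * 4) (\<lambda>q s. sumsq (?X *v C2.contour q s))"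
    by (rule C2.regular_form[OF is_form_matrix[OF is_form_sumsq] C2.regular_contour])
  have rl: "C2.regular_fun (1 * 4) (\<lambda>q s. lin (C2.contour q s))"
    by (rule C2.regular_form[OF lf C2.regular_contour])
  have rf: "C2.regular_fun (d * 4) (\<lambda>q s. f (M' *v C2.contour q s))"
    by (rule C2.regular_form[OF f C2.regular_image])
  have "C2.vanishes (\<lambda>q s. f (M' *v C2.contour q s) * (sumsq (?X *v C2.contour q s) * lin (C2.contour q s)))"
    using van2 unfolding res .
  then have "C2.vanishes (\<lambda>q s. f (M' *v C2.contour q s))
      \<or> C2.vanishes (\<lambda>q s. sumsq (?X *v C2.contour q s) * lin (C2.contour q s))"
    by (rule C2.vanishes_mult[OF rf C2.regular_mult[OF rq rl]])
  then show ?thesis using C2.vanishes_mult[OF rq rl] nl nq by blast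
qed

end

text \<open>The statement \<open>gradient_is_normal\<close> transported to the coordinates of the image plane, where gradients
  are transformed by the transpose.\<close>

lemma (in torus_camera) gradient_on_image:
  assumes f: "is_form d f" and G: "gradient_of f G" "\<And>i. is_form e (G i)"
    and van: "vanishes (\<lambda>q s. f (M *v contour q s))"
  shows "\<exists>\<mu>. regular_fun (e * 4) \<mu> \<and>
    (\<forall>q s. on_curve q s \<longrightarrow> transpose M *v (\<chi> i. G i (M *v contour q s)) = \<mu> q s *s nvec q s)"
proof -
  define H where "H = (\<lambda>j w. (transpose M *v (\<chi> i. G i (M *v w))) $ j)"
  have fM: "is_form d (\<lambda>w. f (M *v w))" by (rule is_form_matrix[OF f])
  have H: "gradient_of (\<lambda>w. f (M *v w)) H" unfolding H_def by (rule gradient_of_matrix[OF G(1)])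
  have Hf: "is_form e (H j)" for j
    unfolding H_def matrix_vector_mult_def[of "transpose M"] vec_lambda_beta
    by (intro is_form_sum is_form_scale is_form_matrix G(2))
  define \<mu> where "\<mu> = (\<lambda>q s. H 1 (contour q s) + \<i> * H 2 (contour q s))"
  have "regular_fun (e * 4) \<mu>"
    unfolding \<mu>_def by (intro regular_add regular_scale regular_form[OF Hf regular_contour])
  moreover have "transpose M *v (\<chi> i. G i (M *v contour q s)) = \<mu> q s *s nvec q s" if c: "on_curve q s" for q s
  proof -
    have "(transpose M *v (\<chi> i. G i (M *v contour q s))) $ j = (\<mu> q s *s nvec q s) $ j" for j
      using gradient_is_normal[OF fM H Hf van c, of j] unfolding H_def \<mu>_def vector_smult_component .
    then show ?thesis by (simp add: vec_eq_iff)
  qed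
  ultimately show ?thesis by blast
qed

context two_cameras
begin

text \<open>By minimality of its degree, the form \<open>f\<close> has a gradient that does not vanish identically along the first contour.
  The form \<open>h\<close>, the second quartic of that gradient, vanishes on the second contour by
  biduality, hence on the first one; biduality there turns this into the vanishing of the second quartic on the
  first dual curve.\<close>

lemma quartic_relation: "\<exists>c. c \<noteq> 0 \<and> (\<forall>n. C2.quartic (N *v n) = c * C1.quartic n)"
proof -
  interpret S: two_cameras x' y' z' R' r' a' b' A' M' Mi' x y z R r a b A M Mi
    by unfold_locales (rule same_picture[symmetric])
  define J where "J = (\<lambda>d. \<exists>f. is_form d f \<and> f \<noteq> (\<lambda>v. 0) \<and> C1.vanishes (\<lambda>q s. f (M *v C1.contour q s)))"
  have "\<exists>d. J d" unfolding J_def by (rule C1.exists_vanishing_form[OF C1.regular_image])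
  define d where "d = (LEAST d. J d)"
  have "J d" unfolding d_def using \<open>\<exists>d. J d\<close> by (metis LeastI)
  then obtain f where f: "is_form d f" "f \<noteq> (\<lambda>v. 0)" "C1.vanishes (\<lambda>q s. f (M *v C1.contour q s))"
    unfolding J_def by blast
  obtain G where G: "\<And>i. is_form (d - 1) (G i)" "gradient_of f G" using form_gradient[OF f(1)] by blast
  have d0: "d \<noteq> 0"
  proof
    assume d: "d = 0"
    have const: "f v = f 0" for v using form_homogeneous[OF f(1), of 0 v] d by simp
    have "f (M *v C1.contour 0 C1.al) = 0" using f(3) C1.on_curve_0 by (simp add: C1.vanishes_def)
    then have "f v = 0" for v using const by metis
    then show False using f(2) by auto
  qed
  have min: "\<not> (\<forall>i. C1.vanishes (\<lambda>q s. G i (M *v C1.contour q s)))"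
  proof
    assume all: "\<forall>i. C1.vanishes (\<lambda>q s. G i (M *v C1.contour q s))"
    have "\<not> J (d - 1)" using d0 not_less_Least[of "d - 1" J] unfolding d_def by simp
    then have "G i = (\<lambda>v. 0)" for i using G(1) all unfolding J_def by blast
    then have "of_nat d * f v = 0" for v using euler_form[OF f(1) G(2), of v] by simp
    then show False using f(2) d0 by auto
  qed
  obtain \<mu> where \<mu>: "C1.regular_fun ((d - 1) * 4) \<mu>"
    "\<And>q s. C1.on_curve q s \<Longrightarrow> transpose M *v (\<chi> i. G i (M *v C1.contour q s)) = \<mu> q s *s C1.nvec q s"
    using C1.gradient_on_image[OF f(1) G(2,1) f(3)] by blast
  obtain \<mu>' where \<mu>': "\<And>q s. C2.on_curve q s \<Longrightarrow> transpose M' *v (\<chi> i. G i (M' *v C2.contour q s)) = \<mu>' q s *s C2.nvec q s"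
    using C2.gradient_on_image[OF f(1) G(2,1) transfer[OF f(1,3)]] by blast
  define h where "h = (\<lambda>w. C2.quartic (transpose M' *v (\<chi> i. G i w)))"
  have qh: "is_form 4 (\<lambda>w. C2.quartic (transpose M' *v w))"
    by (rule is_form_matrix[OF C2.is_form_quartic])
  have h: "is_form (4 * (d - 1)) h"
    unfolding h_def by (rule is_form_compose[OF qh]) (simp only: vec_lambda_beta G(1))
  have "C2.vanishes (\<lambda>q s. h (M' *v C2.contour q s))"
    unfolding C2.vanishes_def h_def
    using \<mu>' C2.quartic_nvec form_homogeneous[OF C2.is_form_quartic] by simp
  then have hv: "C1.vanishes (\<lambda>q s. h (M *v C1.contour q s))" by (rule S.transfer[OF h])
  have qN: "is_form 4 (\<lambda>n. C2.quartic (N *v n))" by (rule is_form_matrix[OF C2.is_form_quartic])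
  have "C1.vanishes (\<lambda>q s. \<mu> q s ^ 4 * C2.quartic (N *v C1.nvec q s))"
    unfolding C1.vanishes_def
  proof (intro allI impI)
    fix q s assume c: "C1.on_curve q s"
    have "0 = h (M *v C1.contour q s)" using hv c by (simp add: C1.vanishes_def)
    also have "\<dots> = C2.quartic (N *v (\<mu> q s *s C1.nvec q s))"
      unfolding h_def \<mu>(2)[OF c, symmetric] N_transpose ..
    also have "\<dots> = \<mu> q s ^ 4 * C2.quartic (N *v C1.nvec q s)"
      using form_homogeneous[OF qN] .
    finally show "\<mu> q s ^ 4 * C2.quartic (N *v C1.nvec q s) = 0" ..
  qed
  moreover have "\<not> C1.vanishes (\<lambda>q s. \<mu> q s ^ 4)"
  proof
    assume v: "C1.vanishes (\<lambda>q s. \<mu> q s ^ 4)"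
    have "G i (M *v C1.contour q s) = 0" if c: "C1.on_curve q s" for q s i
    proof -
      have "\<mu> q s = 0" using v c by (simp add: C1.vanishes_def)
      then have "transpose Mi *v (transpose M *v (\<chi> i. G i (M *v C1.contour q s))) = 0"
        using \<mu>(2)[OF c] by simp
      then have "(\<chi> i. G i (M *v C1.contour q s)) = 0"
        unfolding transpose_inverse(2)[OF C1.inv(1)] .
      then show ?thesis by (simp add: vec_eq_iff)
    qed
    then show False using min by (simp add: C1.vanishes_def)
  qed
  ultimately have vN: "C1.vanishes (\<lambda>q s. C2.quartic (N *v C1.nvec q s))"
    using C1.vanishes_mult[OF C1.regular_power[OF \<mu>(1)] C1.regular_form[OF qN C1.regular_nvec]] by blast
  \<comment> \<open>The factor is chosen to cancel the pure fourth power of the last coordinate.\<close>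
  let ?e = "vector [0, 0, 1] :: complex ^ 3"
  define c where "c = C2.quartic (N *v ?e) / C1.quartic ?e"
  have eq: "C2.quartic (N *v n) = c * C1.quartic n" for n
  proof -
    have "is_form 4 (\<lambda>n. C2.quartic (N *v n) - c * C1.quartic n)"
      by (intro is_form_diff is_form_scale qN C1.is_form_quartic)
    moreover have "C2.quartic (N *v ?e) - c * C1.quartic ?e = 0" using C1.quartic_e3 by (simp add: c_def)
    moreover have "C1.vanishes (\<lambda>q s. C2.quartic (N *v C1.nvec q s) - c * C1.quartic (C1.nvec q s))"
      using vN C1.quartic_nvec by (simp add: C1.vanishes_def)
    ultimately have "C2.quartic (N *v n) - c * C1.quartic n = 0"
      by (intro C1.low_form_vanishing[where f = "\<lambda>n. C2.quartic (N *v n) - c * C1.quartic n" and d = 4]) auto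
    then show ?thesis by simp
  qed
  moreover have "c \<noteq> 0"
  proof
    assume "c = 0"
    then have "C2.quartic ?e = 0" using eq[of "(transpose M ** transpose Mi') *v ?e"] by (simp add: N_Ni)
    then show False using C2.quartic_e3 by simp
  qed
  ultimately show ?thesis by blast
qed

text \<open>The form \<open>u^2 + v^2\<close> of the second camera does not depend on \<open>t\<close>, so the shifted form is degenerate.\<close>

lemma exists_shift:
  "\<exists>\<mu>. poly C1.shift_poly \<mu> = 0 \<and>
     C2.shifted (\<lambda>l. C1.quadA (transpose M *v l)) (\<lambda>l. C1.offset (transpose M *v l))
       (\<lambda>l. 4 * R^2 * (((transpose M *v l) $ 1)^2 + ((transpose M *v l) $ 2)^2)) \<mu>"
proof -
  obtain c where c: "c \<noteq> 0" "\<And>n. C2.quartic (N *v n) = c * C1.quartic n" using quartic_relation by blast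
  obtain k where k: "k \<noteq> 0" "\<And>n. C2.offset (N *v n) = k * C1.offset n"
    using offset_proportional[OF c(2,1)] by blast
  obtain d \<mu> where d: "d \<noteq> 0" and A: "\<And>n. C2.quadA (N *v n) = d * (C1.quadA n + \<mu> * (C1.offset n)^2)"
    and B: "\<And>n. k^2 * (4 * R'^2 * (((N *v n) $ 1)^2 + ((N *v n) $ 2)^2))
       = d^2 * (4 * R^2 * ((n $ 1)^2 + (n $ 2)^2) + 2 * \<mu> * C1.quadA n + \<mu>^2 * (C1.offset n)^2)"
    using presentation_shift[OF c(2,1) k(2,1)] by blast
  let ?e = "vector [0, 0, 1] :: complex ^ 3"
  define w where "w = (transpose M ** transpose Mi') *v ?e"
  have Nw: "N *v w = ?e" unfolding w_def by (rule N_Ni)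
  have "poly C1.shift_poly \<mu> = 0"
  proof (rule C1.degenerate_shift)
    show "w \<noteq> 0"
    proof
      assume "w = 0"
      then have "?e = 0" using Nw by simp
      then show False by (simp add: vec_eq_iff forall_3 vector_3)
    qed
    define g where "g = (\<lambda>n. k^2 * (4 * R'^2 * (((N *v n) $ 1)^2 + ((N *v n) $ 2)^2)) / d^2)"
    show "g (w + m) = g m" for m
      unfolding g_def matrix_vector_right_distrib Nw by (simp add: vector_3)
    show "g n = 4 * R^2 * ((n $ 1)^2 + (n $ 2)^2) + 2 * \<mu> * C1.quadA n + \<mu>^2 * (C1.offset n)^2" for n
      unfolding g_def B using d by simp
  qed
  moreover have "C2.shifted (\<lambda>l. C1.quadA (transpose M *v l)) (\<lambda>l. C1.offset (transpose M *v l))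
       (\<lambda>l. 4 * R^2 * (((transpose M *v l) $ 1)^2 + ((transpose M *v l) $ 2)^2)) \<mu>"
    unfolding C2.shifted_def
    by (rule exI[of _ k], rule exI[of _ d])
       (use k(1) d A[of "transpose M *v _"] k(2)[of "transpose M *v _"] B[of "transpose M *v _"] in
         \<open>simp only: N_transpose simp_thms not_False_eq_True\<close>)
  ultimately show ?thesis by blast
qed

text \<open>Equal shifts relative to the same reference presentation make the two presentations proportional.\<close>

lemma same_shift_same_conic:
  assumes "C1.shifted A0 L0 B0 \<mu>" "C2.shifted A0 L0 B0 \<mu>"
  shows "proj_image A euclidean_absolute = proj_image A' euclidean_absolute"
proof -
  from assms(1) obtain k d where k: "k \<noteq> 0" and d: "d \<noteq> 0"
    and A1: "\<And>l. C1.quadA (transpose M *v l) = d * (A0 l + \<mu> * (L0 l)^2)"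
    and L1: "\<And>l. C1.offset (transpose M *v l) = k * L0 l"
    and B1: "\<And>l. k^2 * (4 * R^2 * (((transpose M *v l) $ 1)^2 + ((transpose M *v l) $ 2)^2))
       = d^2 * (B0 l + 2 * \<mu> * A0 l + \<mu>^2 * (L0 l)^2)"
    unfolding C1.shifted_def by blast
  from assms(2) obtain k' d' where k': "k' \<noteq> 0" and d': "d' \<noteq> 0"
    and A2: "\<And>l. C2.quadA (transpose M' *v l) = d' * (A0 l + \<mu> * (L0 l)^2)"
    and L2: "\<And>l. C2.offset (transpose M' *v l) = k' * L0 l"
    and B2: "\<And>l. k'^2 * (4 * R'^2 * (((transpose M' *v l) $ 1)^2 + ((transpose M' *v l) $ 2)^2))
       = d'^2 * (B0 l + 2 * \<mu> * A0 l + \<mu>^2 * (L0 l)^2)"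
    unfolding C2.shifted_def by blast
  have m: "transpose M *v (transpose Mi *v m) = m" for m
    by (rule transpose_inverse(2)[OF C1.inv(2)])
  have N: "N *v m = transpose M' *v (transpose Mi *v m)" for m
    by (simp only: matrix_vector_mul_assoc)
  have "\<exists>s. s \<noteq> 0 \<and> (\<forall>m. sumsq (N *v m) = s * sumsq m)"
  proof (rule same_presentation_conformal)
    fix m
    let ?l = "transpose Mi *v m"
    show "C2.quadA (N *v m) = (d' / d) * C1.quadA m"
    proof -
      have "C1.quadA m = d * (A0 ?l + \<mu> * (L0 ?l)^2)" using A1[of ?l] unfolding m .
      then show ?thesis unfolding N A2 using d by simp
    qed
    show "C2.offset (N *v m) = (k' / k) * C1.offset m"
    proof -
      have "C1.offset m = k * L0 ?l" using L1[of ?l] unfolding m .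
      then show ?thesis unfolding N L2 using k by simp
    qed
    define Z where "Z = B0 ?l + 2 * \<mu> * A0 ?l + \<mu>^2 * (L0 ?l)^2"
    have b1: "k^2 * (4 * R^2 * ((m $ 1)^2 + (m $ 2)^2)) = d^2 * Z" using B1[of ?l] unfolding m Z_def .
    have b2: "k'^2 * (4 * R'^2 * (((N *v m) $ 1)^2 + ((N *v m) $ 2)^2)) = d'^2 * Z" using B2[of ?l] unfolding N Z_def .
    define q where "q = d'^2 * k^2 / (d^2 * k'^2)"
    have q: "q * (d^2 * k'^2) = d'^2 * k^2" using d k' by (simp add: q_def)
    have "(4 * (k'^2 * d^2)) * (R'^2 * (((N *v m) $ 1)^2 + ((N *v m) $ 2)^2)) = (4 * (k'^2 * d^2)) * (q * R^2 * ((m $ 1)^2 + (m $ 2)^2))"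
      using b1 b2 q by algebra
    then show "R'^2 * (((N *v m) $ 1)^2 + ((N *v m) $ 2)^2) = (d'^2 * k^2 / (d^2 * k'^2)) * R^2 * ((m $ 1)^2 + (m $ 2)^2)"
      unfolding q_def[symmetric] using d k' by (simp only: mult_cancel_left) simp
  next
    show "d' / d \<noteq> 0" using d d' by simp
    show "d'^2 * k^2 / (d^2 * k'^2) * (k' / k)^2 = (d' / d)^2"
      using d d' k k' by (simp add: field_simps power2_eq_square)
  qed
  then obtain s where s: "s \<noteq> 0" "\<And>m. sumsq (N *v m) = s * sumsq m" by blast
  have tN: "transpose N = Mi ** M'" by (simp add: matrix_transpose_mul)
  have "sumsq (Mi *v w) = s * sumsq (Mi' *v w)" for w
  proof -
    define m where "m = Mi *v w"
    have "Mi *v (M' *v (N *v m)) = s *s m"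
      using conformal_transpose[OF s(2), of m] unfolding tN by (simp only: matrix_vector_mul_assoc[symmetric])
    then have "M *v (Mi *v (M' *v (N *v m))) = s *s w"
      by (simp add: vector_scalar_commute m_def C1.M_Mi)
    then have "Mi' *v (M' *v (N *v m)) = s *s (Mi' *v w)"
      by (simp add: C1.M_Mi vector_scalar_commute)
    then have "N *v m = s *s (Mi' *v w)" by (simp only: C2.Mi_M)
    then have "s * sumsq m = s^2 * sumsq (Mi' *v w)"
      using s(2)[of m] form_homogeneous[OF is_form_sumsq] by simp
    then have "s * sumsq m = s * (s * sumsq (Mi' *v w))" by (simp add: power2_eq_square mult.assoc)
    then show ?thesis using s(1) unfolding m_def by simp
  qed
  then show ?thesis
    unfolding C1.proj_image_absolute C2.proj_image_absolute zero_locus_def using s(1) by simp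
qed

end

section \<open>Generic centers\<close>

definition major_radius :: "real \<Rightarrow> complex" where
  "major_radius b = csqrt (of_real b) / 2"

definition minor_radius :: "real \<Rightarrow> real \<Rightarrow> complex" where
  "minor_radius a b = csqrt (of_real (b / 4 - a))"

lemma radii: "4 * (major_radius b)^2 = of_real b" "(major_radius b)^2 - (minor_radius a b)^2 = of_real a"
  by (simp_all add: major_radius_def minor_radius_def power_divide)

text \<open>The factors are the hypotheses of \<open>torus_view\<close> on the center, made homogeneous; the first one keeps the
  center out of the infinite plane.\<close>

definition genericity_form :: "complex \<Rightarrow> complex \<Rightarrow> complex ^ 4 \<Rightarrow> complex" where
  "genericity_form R r v = v $ 4 * (v $ 3 * (((v $ 3)^2 - r\<^sup>2 * (v $ 4)^2) * (((v $ 1)^2 + (v $ 2)^2) *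
     (torus_form R r v * (r^2 * ((v $ 1)^2 + (v $ 2)^2) - (R^2 - r\<^sup>2) * (v $ 3)^2)))))"

lemma is_form_genericity: "is_form 12 (genericity_form R r)"
proof -
  have "is_form (1 + (1 + (2 + (2 + (4 + 2))))) (genericity_form R r)"
    unfolding genericity_form_def[abs_def]
    by (intro is_form_mult is_form_coord is_form_torus is_form_diff is_form_add is_form_scale is_form_coord_square)
  then show ?thesis by simp
qed

definition generic_centers :: "real \<Rightarrow> real \<Rightarrow> 4 cproj set" where
  "generic_centers a b = - zero_locus {genericity_form (major_radius b) (minor_radius a b)}"

lemma open_generic_centers: "zariski_open (generic_centers a b)"
  unfolding zariski_open_def zariski_closed_def generic_centers_def
  using is_form_genericity by (intro exI[of _ "{genericity_form (major_radius b) (minor_radius a b)}"]) auto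

lemma generic_centers_finite_part: "generic_centers a b \<inter> infinite_plane = {}"
proof -
  have "p \<in> zero_locus {genericity_form (major_radius b) (minor_radius a b)}" if "p \<in> infinite_plane" for p
    using that unfolding infinite_plane_def zero_locus_def genericity_form_def by simp
  then show ?thesis unfolding generic_centers_def by blast
qed

text \<open>A point with \<open>y = 0\<close>, \<open>z^2 = b\<close> and \<open>x^2 = b\<close> makes all factors nonzero, except for \<open>b = 8 a\<close>, where its two nodes
  coincide and \<open>x^2 = 2 b\<close> is used instead.\<close>

lemma generic_centers_nonempty:
  assumes "admissible a b"
  shows "generic_centers a b \<noteq> {}"
proof -
  have ab: "a > 0" "b > 0" "b \<noteq> 4 * a" using assms by (simp_all add: admissible_def)
  define k :: real where "k = (if b = 8 * a then 2 else 1)"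
  have k: "k > 0" by (simp add: k_def)
  define X where "X = csqrt (of_real (k * b))"
  define Z where "Z = csqrt (of_real b)"
  define v where "v = (vector [X, 0, Z, 1] :: complex ^ 4)"
  have XZ: "X^2 = of_real (k * b)" "Z^2 = of_real b" by (simp_all add: X_def Z_def)
  let ?R = "major_radius b" and ?r = "minor_radius a b"
  have r2: "?r^2 = of_real (b / 4 - a)" by (simp add: minor_radius_def)
  have R2: "4 * ?R^2 = of_real b" by (rule radii)
  then have T: "torus_form ?R ?r v = of_real ((k * b + b + a)^2 - b * (k * b))"
    unfolding torus_form_def v_def vector_4 R2 radii(2)
    by (simp add: XZ)
  have "(k * b + b + a)^2 - b * (k * b) \<noteq> 0"
  proof -
    have "(k * b + b + a)^2 - b * (k * b) = (k * b)^2 + k * b^2 + (b + a)^2 + 2 * (k * b * a)"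
      by (simp add: power2_eq_square algebra_simps)
    moreover have "(k * b)^2 + k * b^2 + (b + a)^2 + 2 * (k * b * a) > 0"
      using ab k by (intro add_pos_pos) simp_all
    ultimately show ?thesis by simp
  qed
  then have "torus_form ?R ?r v \<noteq> 0" unfolding T by (simp only: of_real_eq_0_iff) simp
  moreover have "?r^2 * ((v $ 1)^2 + (v $ 2)^2) - (?R^2 - ?r^2) * (v $ 3)^2 = of_real ((b / 4 - a) * (k * b) - a * b)"
    unfolding v_def vector_4 XZ radii(2) unfolding r2 by simp
  moreover have "(b / 4 - a) * (k * b) - a * b \<noteq> 0"
  proof -
    have "(b / 4 - a) * (k * b) - a * b = b * ((b / 4 - a) * k - a)" by (simp add: algebra_simps)
    moreover have "(b / 4 - a) * k - a \<noteq> 0" using ab by (simp add: k_def)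
    ultimately show ?thesis using ab by simp
  qed
  moreover have "(v $ 3)^2 - ?r^2 * (v $ 4)^2 = of_real (b - (b / 4 - a))"
    unfolding v_def vector_4 XZ r2 by simp
  moreover have "b - (b / 4 - a) \<noteq> 0" using ab by simp
  moreover have "(v $ 1)^2 + (v $ 2)^2 = of_real (k * b)" "k * b \<noteq> 0"
    using ab k by (simp_all add: v_def vector_4 XZ)
  moreover have v4: "v $ 4 = 1" and "v $ 3 \<noteq> 0" using ab by (simp_all add: v_def vector_4 Z_def)
  ultimately have g: "genericity_form ?R ?r v \<noteq> 0"
    unfolding genericity_form_def by (simp only: mult_eq_0_iff of_real_eq_0_iff) simp
  have v0: "v \<noteq> 0" using v4 by auto
  have "v \<in> line (Point (vec.span {v}))" unfolding span_line[OF v0] by (simp add: vec.span_base)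
  then have "Point (vec.span {v}) \<in> generic_centers a b"
    unfolding generic_centers_def using in_zero_locus_iff[OF is_form_genericity _ v0] g by blast
  then show ?thesis by blast
qed

lemma generic_camera:
  assumes ab: "admissible a b" and A: "central_projection A" and c: "center A \<in> generic_centers a b"
  shows "\<exists>x y z M Mi. torus_camera x y z (major_radius b) (minor_radius a b) a b A M Mi"
proof -
  let ?R = "major_radius b" and ?r = "minor_radius a b"
  obtain v where v: "v \<noteq> 0" "line (center A) = vec.span {v}" using line_generator by blast
  then have "v \<in> line (center A)" by (simp add: vec.span_base)
  from in_zero_locus_iff[OF is_form_genericity this v(1)] c
  have g: "genericity_form ?R ?r v \<noteq> 0" unfolding generic_centers_def by blast
  then have v4: "v $ 4 \<noteq> 0" by (auto simp: genericity_form_def)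
  define x y z where "x = v $ 1 / v $ 4" and "y = v $ 2 / v $ 4" and "z = v $ 3 / v $ 4"
  let ?o = "vector [x, y, z, 1] :: complex ^ 4"
  have o: "?o = inverse (v $ 4) *s v"
    using v4 by (simp add: vec_eq_iff forall_4 vector_4 x_def y_def z_def divide_inverse mult.commute)
  have "genericity_form ?R ?r ?o \<noteq> 0"
    unfolding o form_homogeneous[OF is_form_genericity] using g v4 by simp
  then have ne: "z \<noteq> 0" "z^2 \<noteq> ?r^2" "x^2 + y^2 \<noteq> 0" "torus_form ?R ?r ?o \<noteq> 0"
    "?r^2 * (x^2 + y^2) \<noteq> (?R^2 - ?r^2) * z^2"
    unfolding genericity_form_def vector_4 by auto
  have "?o \<in> line (center A)" unfolding v(2) o by (intro vec.span_scale vec.span_base) simp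
  moreover have "?o $ 4 \<noteq> 0" by (simp add: vector_4)
  then have "?o \<noteq> 0" by (metis zero_index)
  ultimately have lc: "line (center A) = vec.span {?o}" by (rule line_eq_span)
  obtain M Mi :: "complex ^ 3 ^ 3" where M: "M ** Mi = mat 1" "Mi ** M = mat 1"
    "\<And>p. complexify A *v p = M *v vector [p $ 1 - x * p $ 4, p $ 2 - y * p $ 4, p $ 3 - z * p $ 4]"
    using camera_matrix[OF A lc] by blast
  have ab': "a > 0" "b > 0" "b \<noteq> 4 * a" using ab by (simp_all add: admissible_def)
  have "torus_camera x y z ?R ?r a b A M Mi"
  proof
    show "?R \<noteq> 0" using ab' by (simp add: major_radius_def)
    have "b / 4 - a \<noteq> 0" using ab' by simp
    then have "complex_of_real (b / 4 - a) \<noteq> 0" by (simp only: of_real_eq_0_iff not_False_eq_True)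
    then show "?r \<noteq> 0" unfolding minor_radius_def by (simp only: csqrt_eq_0 not_False_eq_True)
    show "?R^2 \<noteq> ?r^2" using radii(2)[of b a] ab' by auto
    show "(x^2 + y^2 + z^2 + (?R^2 - ?r^2))^2 \<noteq> 4 * ?R^2 * (x^2 + y^2)"
      using ne(4) unfolding torus_form_def vector_4 by simp
  qed (use ne radii M lc in simp_all)
  then show ?thesis by blast
qed

definition candidate_camera :: "real ^ 4 ^ 3 \<Rightarrow> real \<Rightarrow> real \<Rightarrow> real \<Rightarrow> real \<Rightarrow> real ^ 4 ^ 3 \<Rightarrow> bool" where
  "candidate_camera A a b a1 b1 A1 \<longleftrightarrow> admissible a1 b1 \<and> central_projection A1 \<and>
     center A1 \<in> generic_centers a1 b1 \<and> picture A1 (torus a1 b1) = picture A (torus a b)"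

text \<open>Candidates are sent injectively to roots of the shift polynomial of the given camera.\<close>

theorem finitely_many_conics:
  assumes "admissible a b" "central_projection A" "center A \<in> generic_centers a b"
  shows "finite {D. \<exists>a1 b1 A1. candidate_camera A a b a1 b1 A1 \<and> proj_image A1 euclidean_absolute = D}"
proof -
  obtain x y z M Mi where C: "torus_camera x y z (major_radius b) (minor_radius a b) a b A M Mi"
    using generic_camera[OF assms] by blast
  interpret C: torus_camera x y z "major_radius b" "minor_radius a b" a b A M Mi by (rule C)
  let ?A = "\<lambda>l. C.quadA (transpose M *v l)" and ?L = "\<lambda>l. C.offset (transpose M *v l)"
    and ?B = "\<lambda>l. 4 * (major_radius b)^2 * (((transpose M *v l) $ 1)^2 + ((transpose M *v l) $ 2)^2)"
  define shift where "shift = (\<lambda>D \<mu>. \<exists>a1 b1 A1 x1 y1 z1 M1 Mi1. candidate_camera A a b a1 b1 A1 \<and>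
    torus_camera x1 y1 z1 (major_radius b1) (minor_radius a1 b1) a1 b1 A1 M1 Mi1 \<and>
    proj_image A1 euclidean_absolute = D \<and>
    torus_camera.shifted x1 y1 z1 (major_radius b1) (minor_radius a1 b1) M1 ?A ?L ?B \<mu>)"
  define roots where "roots = {\<mu>. poly C.shift_poly \<mu> = 0}"
  have "finite roots" unfolding roots_def by (rule poly_roots_finite[OF C.shift_poly_nonzero])
  have ex: "\<exists>\<mu>\<in>roots. shift D \<mu>"
    if D: "candidate_camera A a b a1 b1 A1" "proj_image A1 euclidean_absolute = D" for D a1 b1 A1
  proof -
    from D(1) have c: "admissible a1 b1" "central_projection A1" "center A1 \<in> generic_centers a1 b1"
      and pic: "picture A1 (torus a1 b1) = picture A (torus a b)" unfolding candidate_camera_def by blast+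
    obtain x1 y1 z1 M1 Mi1 where C1: "torus_camera x1 y1 z1 (major_radius b1) (minor_radius a1 b1) a1 b1 A1 M1 Mi1"
      using generic_camera[OF c] by blast
    interpret C1: torus_camera x1 y1 z1 "major_radius b1" "minor_radius a1 b1" a1 b1 A1 M1 Mi1 by (rule C1)
    interpret P: two_cameras x y z "major_radius b" "minor_radius a b" a b A M Mi
      x1 y1 z1 "major_radius b1" "minor_radius a1 b1" a1 b1 A1 M1 Mi1
      by unfold_locales (rule pic[symmetric])
    obtain \<mu> where "poly C.shift_poly \<mu> = 0" "C1.shifted ?A ?L ?B \<mu>" using P.exists_shift by blast
    then show ?thesis unfolding shift_def roots_def using D C1 by blast
  qed
  have unique: "shift D \<mu> \<Longrightarrow> shift D' \<mu> \<Longrightarrow> D = D'" for D D' \<mu>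
    unfolding shift_def candidate_camera_def
  proof (elim exE conjE)
    fix a1 b1 A1 x1 y1 z1 M1 Mi1 a2 b2 A2 x2 y2 z2 M2 Mi2
    assume 1: "picture A1 (torus a1 b1) = picture A (torus a b)"
      "torus_camera x1 y1 z1 (major_radius b1) (minor_radius a1 b1) a1 b1 A1 M1 Mi1"
      "proj_image A1 euclidean_absolute = D"
      "torus_camera.shifted x1 y1 z1 (major_radius b1) (minor_radius a1 b1) M1 ?A ?L ?B \<mu>"
    assume 2: "picture A2 (torus a2 b2) = picture A (torus a b)"
      "torus_camera x2 y2 z2 (major_radius b2) (minor_radius a2 b2) a2 b2 A2 M2 Mi2"
      "proj_image A2 euclidean_absolute = D'"
      "torus_camera.shifted x2 y2 z2 (major_radius b2) (minor_radius a2 b2) M2 ?A ?L ?B \<mu>"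
    interpret C1: torus_camera x1 y1 z1 "major_radius b1" "minor_radius a1 b1" a1 b1 A1 M1 Mi1 by (rule 1(2))
    interpret C2: torus_camera x2 y2 z2 "major_radius b2" "minor_radius a2 b2" a2 b2 A2 M2 Mi2 by (rule 2(2))
    interpret P: two_cameras x1 y1 z1 "major_radius b1" "minor_radius a1 b1" a1 b1 A1 M1 Mi1
      x2 y2 z2 "major_radius b2" "minor_radius a2 b2" a2 b2 A2 M2 Mi2
      by unfold_locales (rule trans[OF 1(1) 2(1)[symmetric]])
    show "D = D'" using P.same_shift_same_conic[OF 1(4) 2(4)] 1(3) 2(3) by simp
  qed
  have "{D. \<exists>a1 b1 A1. candidate_camera A a b a1 b1 A1 \<and> proj_image A1 euclidean_absolute = D}
      \<subseteq> (\<lambda>\<mu>. THE D. shift D \<mu>) ` roots"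
  proof
    fix D assume "D \<in> {D. \<exists>a1 b1 A1. candidate_camera A a b a1 b1 A1 \<and> proj_image A1 euclidean_absolute = D}"
    then obtain \<mu> where \<mu>: "\<mu> \<in> roots" "shift D \<mu>" using ex by blast
    then have "(THE D. shift D \<mu>) = D" by (intro the_equality unique)
    then show "D \<in> (\<lambda>\<mu>. THE D. shift D \<mu>) ` roots" using \<mu>(1) by (metis imageI)
  qed
  then show ?thesis using \<open>finite roots\<close> finite_surj by blast
qed

theorem mainTheorem1:
  "\<exists>U :: real \<Rightarrow> real \<Rightarrow> 4 cproj set.
     (\<forall>a b. admissible a b \<longrightarrow>
        zariski_open (U a b) \<and> U a b \<noteq> {} \<and> U a b \<inter> infinite_plane = {}) \<and>
     (\<forall>a b A. admissible a b \<and> central_projection A \<and> center A \<in> U a b \<longrightarrow>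
        (let candidates =
           {D. is_conic D \<and>
               (\<exists>a1 b1 A1. admissible a1 b1 \<and> central_projection A1 \<and> center A1 \<in> U a1 b1 \<and>
                  picture A1 (torus a1 b1) = picture A (torus a b) \<and>
                  proj_image A1 euclidean_absolute = D)}
         in finite candidates \<and> proj_image A euclidean_absolute \<in> candidates))"
proof (rule exI[of _ generic_centers], intro conjI allI impI open_generic_centers generic_centers_finite_part)
  fix a b assume "admissible a b"
  then show "generic_centers a b \<noteq> {}" by (rule generic_centers_nonempty)
next
  fix a b A assume h: "admissible a b \<and> central_projection A \<and> center A \<in> generic_centers a b"
  let ?S = "{D. is_conic D \<and>
               (\<exists>a1 b1 A1. admissible a1 b1 \<and> central_projection A1 \<and> center A1 \<in> generic_centers a1 b1 \<and>
                  picture A1 (torus a1 b1) = picture A (torus a b) \<and>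
                  proj_image A1 euclidean_absolute = D)}"
  have "?S \<subseteq> {D. \<exists>a1 b1 A1. candidate_camera A a b a1 b1 A1 \<and> proj_image A1 euclidean_absolute = D}"
    unfolding candidate_camera_def by blast
  then have "finite ?S" using finitely_many_conics h finite_subset by blast
  moreover have "is_conic (proj_image A euclidean_absolute)"
  proof -
    obtain x y z M Mi where "torus_camera x y z (major_radius b) (minor_radius a b) a b A M Mi"
      using generic_camera h by blast
    then show ?thesis by (rule torus_camera.is_conic_absolute)
  qed
  then have "proj_image A euclidean_absolute \<in> ?S" using h by blast
  ultimately show "let candidates = ?S
         in finite candidates \<and> proj_image A euclidean_absolute \<in> candidates"
    unfolding Let_def by (rule conjI)
qed

end
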